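(* Let $f\in\mathcal{F}^*$, and assume that $\mathcal{C}$ is a closed maximal solution of $\kappa=f(r)$. Then $\mathcal{C}$ is oriented counter-clockwise when $f>0$, and clockwise when $f<0$. Moreover, the following are equivalent: (i) $\mathcal{C}$ is a Jordan solution; (ii) $[\mathcal{C}]$ either is a circle with radius $s_f$ centered at $0$, or else $[\mathcal{C}]=e^{i\vartheta}[\mathcal{C}_{f,s}]$ for some $\vartheta\in\mathbb{R}$ and a unique $s\in\mathbb{O}_f$.
   Context: Curves. Let $c:\mathbb{J}_c\to\mathbb{C}$ be a smooth path parametrized by arc length ($|\dot c|=1$), where $\mathbb{J}_c\subset\mathbb{R}$ is an open interval with $0\in\mathbb{J}_c$. Two such paths $c,\widehat c$ are equivalent if $\mathbb{J}_{\widehat c}=\alpha+\mathbb{J}_c$ for some $\alpha\in\mathbb{R}$ and $\widehat c(t)=c(t-\alpha)$ for all $t\in\mathbb{J}_{\widehat c}$; an equivalence class $\mathcal{C}$ is an oriented smooth curve, and $[\mathcal{C}]=c(\mathbb{J}_c)$ for $c\in\mathcal{C}$. Write $\dot c=e^{i\vartheta_c}$ with $\vartheta_c$ smooth; the curvature is $\kappa_c=\dot\vartheta_c$. Given smooth ($C^\infty$) $f:\mathbb{R}^+\to\mathbb{R}$, $\mathbb{R}^+=\,]0,\infty[$, $\mathcal{C}$ is a solution of $\kappa=f(r)$ if $\kappa_c(t)=f(|c(t)|)$ for all $t\in\mathbb{J}_c$ with $c(t)\ne0$. A solution $\mathcal{C}$ is maximal if $[\mathcal{C}]\subset[\widehat{\mathcal{C}}]$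 for a solution $\widehat{\mathcal{C}}$ implies $[\mathcal{C}]=[\widehat{\mathcal{C}}]$; closed if $[\mathcal{C}]$ is compact. A Jordan solution is a maximal solution $\mathcal{C}$ with $[\mathcal{C}]$ homeomorphic to the unit circle. For a possibly non-simple closed solution, "oriented counter-clockwise (clockwise)" means that the total rotation of the unit tangent $\dot c$ over one period of the curve is positive (negative). Class of functions. Fix $F:\mathbb{R}^+\to\mathbb{R}$ with $F'(s)=sf(s)-1$. $\mathcal{F}$ is the set of smooth $f:\mathbb{R}^+\to\mathbb{R}$ with $f(s)f'(s)F''(s)\neq0$ for all $s\in\mathbb{R}^+$. For $f\in\mathcal{F}$ let $\epsilon_f\in\{-1,1\}$ be such that $\epsilon_fF''>0$, and $\mathbb{I}_f=\,]\lim_{s\to0}\epsilon_fsf(s),\lim_{s\to\infty}\epsilon_fsf(s)[$. Let $\mathcal{F}^*=\{f\in\mathcal{F}:1\in\mathbb{I}_f\}$. For $f\in\mathcal{F}^*$, $\epsilon_f$ is the constant sign of $f$, and $s_f\in\mathbb{R}^+$ is the unique solution of $sf(s)=\epsilon_f$. Flow and net winding. The ODE $\dot z=izf(|z|)-i$ on $\mathbb{C}\setminus\{0\}$ generates a unique topological flow $\Phi_f$ on $\mathbb{C}$ (a continuous one-parameter group of homeomorphisms, with $t\mapsto\Phi_f(t,z)$ satisfying the ODE whenever $\Phi_f(t,z)\neq0$). For $f\in\mathcal{F}^*$ every point is periodic. For $0<s<s_f$ the net winding is $\omega_f(\epsilon_fs)=\pm\frac1{2\pi}\int_0^{T}f(|\Phi_f(t,\epsilon_fs)|)\,dt$,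 with $T>0$ the minimal period of $\epsilon_fs$ and the sign $+$ (respectively $-$) if the periodic orbit is oriented counter-clockwise (respectively clockwise). For $0<s\le s_f$ let $\mathcal{C}_{f,s}$ be a maximal solution of $\kappa=f(r)$ with $c(0)=\epsilon_fs$ and $\vartheta_c(0)=\frac12\pi$ for some $c\in\mathcal{C}_{f,s}$. Finally $\mathbb{O}_f=\bigcup_{n\ge2}\{0<s<s_f:\omega_f(\epsilon_fs)=1/n\}$. *)

theory Defs
  imports "HOL-Analysis.Analysis" "HOL-Complex_Analysis.Winding_Numbers"
begin

section \<open>Oriented smooth curves in the plane\<close>

text \<open>\<open>C\<^sup>\<infinity>\<close> functions on an open set of reals: \<open>D n\<close> is the \<open>n\<close>-th derivative. Values of \<open>g\<close>
  outside \<open>S\<close> are irrelevant.\<close>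

definition smooth_on :: "real set \<Rightarrow> (real \<Rightarrow> 'a::real_normed_vector) \<Rightarrow> bool" where
  "smooth_on S g \<longleftrightarrow> (\<exists>D :: nat \<Rightarrow> real \<Rightarrow> 'a. D 0 = g \<and>
     (\<forall>n. \<forall>t\<in>S. (D n has_vector_derivative D (Suc n) t) (at t)))"

text \<open>A path is a pair of its domain and a total function of which only the values on the domain
  matter.\<close>

type_synonym plane_path = "real set \<times> (real \<Rightarrow> complex)"

definition arc_paths :: "plane_path set" where
  "arc_paths = {(J, c). open J \<and> is_interval J \<and> 0 \<in> J \<and> smooth_on J c \<and>
     (\<forall>t\<in>J. norm (vector_derivative c (at t)) = 1)}"

definition path_equiv :: "(plane_path \<times> plane_path) set" where
  "path_equiv = {((J, c), (J', c')). (J, c) \<in> arc_paths \<and> (J', c') \<in> arc_paths \<and>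
     (\<exists>\<alpha>. J' = (\<lambda>t. \<alpha> + t) ` J \<and> (\<forall>t\<in>J'. c' t = c (t - \<alpha>)))}"

lemma equiv_path_equiv: "equiv arc_paths path_equiv"
proof (rule equivI)
  show "path_equiv \<subseteq> arc_paths \<times> arc_paths"
    by (auto simp: path_equiv_def)
  show "refl_on arc_paths path_equiv"
    by (auto simp: refl_on_def path_equiv_def intro!: exI[of _ 0])
  show "sym path_equiv"
  proof (rule symI)
    fix p q assume "(p, q) \<in> path_equiv"
    then obtain J c J' c' \<alpha> where *: "p = (J, c)" "q = (J', c')" "p \<in> arc_paths" "q \<in> arc_paths"
      "J' = (\<lambda>t. \<alpha> + t) ` J" "\<forall>t\<in>J'. c' t = c (t - \<alpha>)"
      by (auto simp: path_equiv_def)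
    have "J = (\<lambda>t. - \<alpha> + t) ` J'" "\<forall>t\<in>J. c t = c' (t - (- \<alpha>))"
      using * by (auto simp: image_image add.commute)
    then show "(q, p) \<in> path_equiv"
      using * unfolding path_equiv_def by blast
  qed
  show "trans path_equiv"
  proof (rule transI)
    fix p q r assume "(p, q) \<in> path_equiv" "(q, r) \<in> path_equiv"
    then obtain J c J' c' J'' c'' \<alpha> \<beta> where *: "p = (J, c)" "q = (J', c')" "r = (J'', c'')"
      "p \<in> arc_paths" "r \<in> arc_paths"
      "J' = (\<lambda>t. \<alpha> + t) ` J" "\<forall>t\<in>J'. c' t = c (t - \<alpha>)"
      "J'' = (\<lambda>t. \<beta> + t) ` J'" "\<forall>t\<in>J''. c'' t = c' (t - \<beta>)"
      by (auto simp: path_equiv_def)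
    have "J'' = (\<lambda>t. (\<alpha> + \<beta>) + t) ` J" "\<forall>t\<in>J''. c'' t = c (t - (\<alpha> + \<beta>))"
      using * by (auto simp: image_image algebra_simps)
    then show "(p, r) \<in> path_equiv"
      using * unfolding path_equiv_def by blast
  qed
qed

type_synonym plane_curve = "plane_path set"

definition oriented_curves :: "plane_curve set" where
  "oriented_curves = arc_paths // path_equiv"

text \<open>The point set \<open>[C] = c(J)\<close>; all representatives of a curve have the same image.\<close>

definition curve_trace :: "plane_curve \<Rightarrow> complex set" where
  "curve_trace C = (\<Union>(J, c)\<in>C. c ` J)"

definition closed_curve :: "plane_curve \<Rightarrow> bool" where
  "closed_curve C \<longleftrightarrow> compact (curve_trace C)"

definition is_tangent_angle :: "plane_path \<Rightarrow> (real \<Rightarrow> real) \<Rightarrow> bool" where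
  "is_tangent_angle p \<theta> \<longleftrightarrow> (case p of (J, c) \<Rightarrow> smooth_on J \<theta> \<and>
     (\<forall>t\<in>J. vector_derivative c (at t) = cis (\<theta> t)))"

text \<open>Tangent angles of a path differ by constant multiples of \<open>2\<pi>\<close>, so the choice is immaterial.\<close>

definition curvature :: "plane_path \<Rightarrow> real \<Rightarrow> real" where
  "curvature p t = deriv (SOME \<theta>. is_tangent_angle p \<theta>) t"


section \<open>Solutions of \<open>\<kappa> = f(r)\<close>\<close>

definition is_solution :: "(real \<Rightarrow> real) \<Rightarrow> plane_curve \<Rightarrow> bool" where
  "is_solution f C \<longleftrightarrow> C \<in> oriented_curves \<and>
     (\<forall>(J, c)\<in>C. \<forall>t\<in>J. c t \<noteq> 0 \<longrightarrow> curvature (J, c) t = f (cmod (c t)))"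

definition maximal_solution :: "(real \<Rightarrow> real) \<Rightarrow> plane_curve \<Rightarrow> bool" where
  "maximal_solution f C \<longleftrightarrow> is_solution f C \<and>
     (\<forall>C'. is_solution f C' \<longrightarrow> curve_trace C \<subseteq> curve_trace C' \<longrightarrow> curve_trace C = curve_trace C')"

definition Jordan_solution :: "(real \<Rightarrow> real) \<Rightarrow> plane_curve \<Rightarrow> bool" where
  "Jordan_solution f C \<longleftrightarrow> maximal_solution f C \<and>
     curve_trace C homeomorphic sphere (0::complex) 1"

definition minimal_period :: "(real \<Rightarrow> 'a) \<Rightarrow> real \<Rightarrow> bool" where
  "minimal_period g T \<longleftrightarrow> 0 < T \<and> (\<forall>t. g (t + T) = g t) \<and>
     (\<forall>S. 0 < S \<and> S < T \<longrightarrow> \<not> (\<forall>t. g (t + S) = g t))"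

text \<open>Maximality is a condition on point sets only, so the representatives of a closed maximal
  solution may be defined on a bounded interval: restricting a periodic solution to an interval
  longer than its period does not change its point set. Hence the period of \<open>C\<close> is taken from a
  periodic solution \<open>g\<close> on the whole line which continues a representative of \<open>C\<close> and has the same
  point set.\<close>

definition periodic_continuation ::
    "(real \<Rightarrow> real) \<Rightarrow> plane_curve \<Rightarrow> (real \<Rightarrow> complex) \<Rightarrow> real \<Rightarrow> bool" where
  "periodic_continuation f C g T \<longleftrightarrow>
     (UNIV, g) \<in> arc_paths \<and> is_solution f (path_equiv `` {(UNIV, g)}) \<and> minimal_period g T \<and>
     (\<exists>(J, c)\<in>C. \<forall>t\<in>J. c t = g t) \<and> range g = curve_trace C"

text \<open>Orientation is the sign of the total rotation of the unit tangent over one period.\<close>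

definition oriented_counterclockwise :: "(real \<Rightarrow> real) \<Rightarrow> plane_curve \<Rightarrow> bool" where
  "oriented_counterclockwise f C \<longleftrightarrow> (\<exists>g T \<theta>. periodic_continuation f C g T \<and>
     is_tangent_angle (UNIV, g) \<theta> \<and> \<theta> T - \<theta> 0 > 0)"

definition oriented_clockwise :: "(real \<Rightarrow> real) \<Rightarrow> plane_curve \<Rightarrow> bool" where
  "oriented_clockwise f C \<longleftrightarrow> (\<exists>g T \<theta>. periodic_continuation f C g T \<and>
     is_tangent_angle (UNIV, g) \<theta> \<and> \<theta> T - \<theta> 0 < 0)"


section \<open>The class of curvature functions\<close>

text \<open>Functions on \<open>]0,\<infinity>[\<close> are total functions on the reals whose values elsewhere are never used.
  The primitive \<open>F\<close> is determined up to an additive constant; only its derivatives occur.\<close>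

definition F_prim :: "(real \<Rightarrow> real) \<Rightarrow> real \<Rightarrow> real" where
  "F_prim f = (SOME F. \<forall>s>0. (F has_real_derivative (s * f s - 1)) (at s))"

definition class_F :: "(real \<Rightarrow> real) set" where
  "class_F = {f. smooth_on {0<..} f \<and>
     (\<forall>s>0. f s * deriv f s * deriv (deriv (F_prim f)) s \<noteq> 0)}"

definition eps :: "(real \<Rightarrow> real) \<Rightarrow> real" where
  "eps f = (THE e. e \<in> {-1, 1} \<and> (\<forall>s>0. e * deriv (deriv (F_prim f)) s > 0))"

text \<open>The end points may be infinite, so the limits are taken in the extended reals.\<close>

definition interval_I :: "(real \<Rightarrow> real) \<Rightarrow> real set" where
  "interval_I f = {x. Lim (at_right 0) (\<lambda>s. ereal (eps f * s * f s)) < ereal x \<and>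
     ereal x < Lim at_top (\<lambda>s. ereal (eps f * s * f s))}"

definition class_F_star :: "(real \<Rightarrow> real) set" where
  "class_F_star = {f \<in> class_F. 1 \<in> interval_I f}"

definition s_crit :: "(real \<Rightarrow> real) \<Rightarrow> real" where
  "s_crit f = (THE s. 0 < s \<and> s * f s = eps f)"


section \<open>Flow and net winding\<close>

text \<open>The group law makes every time-\<open>t\<close> map a homeomorphism with inverse the time-\<open>(-t)\<close> map.\<close>

definition is_flow :: "(real \<Rightarrow> real) \<Rightarrow> (real \<Rightarrow> complex \<Rightarrow> complex) \<Rightarrow> bool" where
  "is_flow f \<Phi> \<longleftrightarrow>
     continuous_on UNIV (\<lambda>(t, z). \<Phi> t z) \<and>
     (\<forall>z. \<Phi> 0 z = z) \<and>
     (\<forall>s t z. \<Phi> (s + t) z = \<Phi> s (\<Phi> t z)) \<and>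
     (\<forall>t z. \<Phi> t z \<noteq> 0 \<longrightarrow>
        ((\<lambda>u. \<Phi> u z) has_vector_derivative
           (\<i> * \<Phi> t z * of_real (f (cmod (\<Phi> t z))) - \<i>)) (at t))"

definition flow :: "(real \<Rightarrow> real) \<Rightarrow> real \<Rightarrow> complex \<Rightarrow> complex" where
  "flow f = (THE \<Phi>. is_flow f \<Phi>)"

definition flow_period :: "(real \<Rightarrow> real) \<Rightarrow> complex \<Rightarrow> real" where
  "flow_period f z = (THE T. minimal_period (\<lambda>t. flow f t z) T)"

text \<open>One turn of the orbit of \<open>z\<close>, as a path on \<open>[0,1]\<close>. Periodic orbits of a flow that are not
  equilibria are simple closed curves, for which the winding number is constantly \<open>1\<close> or constantly
  \<open>-1\<close> on the (nonempty) inside.\<close>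

definition orbit_loop :: "(real \<Rightarrow> real) \<Rightarrow> complex \<Rightarrow> real \<Rightarrow> complex" where
  "orbit_loop f z = (\<lambda>u. flow f (flow_period f z * u) z)"

definition loop_counterclockwise :: "(real \<Rightarrow> complex) \<Rightarrow> bool" where
  "loop_counterclockwise \<gamma> \<longleftrightarrow> (\<forall>w\<in>inside (path_image \<gamma>). winding_number \<gamma> w = 1)"

definition net_winding :: "(real \<Rightarrow> real) \<Rightarrow> complex \<Rightarrow> real" where
  "net_winding f z =
     (if loop_counterclockwise (orbit_loop f z) then 1 else - 1) * (1 / (2 * pi)) *
     integral {0..flow_period f z} (\<lambda>t. f (cmod (flow f t z)))"

text \<open>The initial conditions determine the point set of \<open>C\<^sub>f\<^sub>,\<^sub>s\<close>, which is all that matters.\<close>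

definition C_sol :: "(real \<Rightarrow> real) \<Rightarrow> real \<Rightarrow> plane_curve" where
  "C_sol f s = (SOME C. maximal_solution f C \<and>
     (\<exists>(J, c)\<in>C. c 0 = of_real (eps f * s) \<and>
        (\<exists>\<theta>. is_tangent_angle (J, c) \<theta> \<and> \<theta> 0 = pi / 2)))"

definition O_set :: "(real \<Rightarrow> real) \<Rightarrow> real set" where
  "O_set f = (\<Union>n\<in>{2::nat..}. {s. 0 < s \<and> s < s_crit f \<and>
     net_winding f (of_real (eps f * s)) = 1 / real n})"

end

theory Submission
  imports Defs "HOL-Complex_Analysis.Riemann_Mapping"
begin

text \<open>
  Let \<open>f > 0\<close>. The vector field of the flow is \<open>i\<close> times the gradient of \<open>H z = G |z| - Re z\<close> with
  \<open>G' r = r f r\<close>. Since \<open>r f r\<close> increases, \<open>H\<close> is strictly increasing along the rays from its minimum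
  \<open>a = s\<^sub>f\<close>, so that its level curves are parametrized by the polar angle about \<open>a\<close>; integrating the
  speed along them yields the periodic flow.

  In its reflected moving frame a solution \<open>c\<close> with tangent angle \<open>\<theta>\<close> becomes an orbit \<open>\<zeta>\<close> of the flow; conversely
  \<open>c = -i (cnj \<zeta>) e\<^sup>i\<^sup>\<theta>\<close> with \<open>\<theta>' = f |\<zeta>|\<close>. Thus \<open>c\<close> is a rosette, invariant under the rotation by the increment
  \<open>\<Theta>\<close> of \<open>\<theta>\<close> over one period of \<open>\<zeta>\<close>, which is \<open>2\<pi>\<close> times the net winding. Its trace is compact
  only if \<open>n \<Theta>\<close> is a multiple of \<open>2\<pi>\<close> for some \<open>n\<close>, and the total rotation is positive because \<open>f\<close> is.

  If the trace is a topological circle, \<open>c\<close> is injective modulo its period \<open>n T\<close>. Then \<open>n = 1\<close> is excluded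
  by a four vertex argument, as \<open>f'\<close> has no zero. On a level \<open>H > 0\<close> the curve would cross an axis of
  symmetry outside the extrema of its modulus, on the level \<open>H = 0\<close> it would run through \<open>0\<close> more than
  once, and for \<open>H < 0\<close> the polar angle of \<open>c\<close> increases, which forces \<open>n \<Theta> = 2\<pi>\<close>. Conversely, \<open>n \<Theta> = 2\<pi>\<close> makes \<open>c\<close> convex. The case \<open>f < 0\<close>
  follows by complex conjugation.
\<close>

subsection \<open>Smooth functions of a real variable\<close>

text \<open>The origin shapes the proof. \<open>ham\<close> need not be differentiable there and the
  vector field may jump, so the orbits of level 0 cannot be taken from an existence theorem for
  differential equations. Quadrature along level curves treats all levels alike, with level 0 as a
  limit of its neighbours. For the curves, \<open>f r\<close> need not have a finite limit as r
  tends to 0, so a solution of level 0 confined between two passages through the origin may fail to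
  extend. The trace of such a solution is not compact, whereas a solution that does pass through 0
  supplies the missing curvature at every passage. Maximality and closedness are conditions on point
  sets and say nothing about parametrizations. Hence periodicity is extracted from compactness by a
  Baire argument. Maximality of the rosettes is a comparison of sets: a solution whose trace
  contains a rosette either shares position and frame with it at some point, or meets it in
  countably many points outside a countable set of parameters, which is too few. Without the
  reflection the moving frame would run through the orbits backwards.\<close>

lemma smooth_on_coinduct:
  assumes "g \<in> X"
    and "\<And>g. g \<in> X \<Longrightarrow> \<exists>g'\<in>X. \<forall>t\<in>S. (g has_vector_derivative g' t) (at t)"
  shows "smooth_on S g"
proof -
  \<comment> \<open>The choice function \<open>d\<close> picks a derivative inside \<open>X\<close>,
    and its iterates at \<open>g\<close> form the required sequence. Smoothness thus reduces to
    exhibiting one class of functions closed under differentiation.\<close>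
  obtain d where d: "\<And>g. g \<in> X \<Longrightarrow> d g \<in> X \<and> (\<forall>t\<in>S. (g has_vector_derivative d g t) (at t))"
    using assms(2) by metis
  have X: "(d ^^ n) g \<in> X" for n
    by (induction n) (use assms(1) d in auto)
  show ?thesis
    unfolding smooth_on_def using X d by (intro exI[of _ "\<lambda>n. (d ^^ n) g"]) auto
qed

lemma smooth_on_derivative:
  assumes "smooth_on S g"
  shows "\<exists>g'. smooth_on S g' \<and> (\<forall>t\<in>S. (g has_vector_derivative g' t) (at t))"
proof -
  obtain D where D: "D 0 = g" "\<And>n t. t \<in> S \<Longrightarrow> (D n has_vector_derivative D (Suc n) t) (at t)"
    using assms unfolding smooth_on_def by blast
  have "smooth_on S (D 1)"
    unfolding smooth_on_def using D by (intro exI[of _ "\<lambda>n. D (Suc n)"]) auto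
  then show ?thesis
    using D(2)[of _ 0] D(1) by auto
qed

lemma smooth_on_antiderivative:
  assumes "smooth_on S g'" "\<And>t. t \<in> S \<Longrightarrow> (g has_vector_derivative g' t) (at t)"
  shows "smooth_on S g"
proof (rule smooth_on_coinduct[of g "insert g {h. smooth_on S h}"])
  fix h assume "h \<in> insert g {h. smooth_on S h}"
  then consider "h = g" | "smooth_on S h" by blast
  then show "\<exists>h'\<in>insert g {h. smooth_on S h}. \<forall>t\<in>S. (h has_vector_derivative h' t) (at t)"
  proof cases
    case 1
    then show ?thesis using assms by blast
  next
    case 2
    then show ?thesis using smooth_on_derivative[of S h] by auto
  qed
qed simp

lemma smooth_on_continuous: "smooth_on S g \<Longrightarrow> continuous_on S g"
  using smooth_on_derivative[of S g] has_vector_derivative_continuous[of g]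
  by (fastforce intro: continuous_at_imp_continuous_on)

lemma smooth_on_subset: "smooth_on S g \<Longrightarrow> T \<subseteq> S \<Longrightarrow> smooth_on T g"
  unfolding smooth_on_def by blast

lemma smooth_on_cong:
  assumes "smooth_on S g" "open S" "\<And>t. t \<in> S \<Longrightarrow> h t = g t"
  shows "smooth_on S h"
proof (rule smooth_on_coinduct)
  show "h \<in> {h. \<exists>g. smooth_on S g \<and> (\<forall>t\<in>S. h t = g t)}"
    using assms by blast
next
  fix h assume "h \<in> {h. \<exists>g. smooth_on S g \<and> (\<forall>t\<in>S. h t = g t)}"
  then obtain g where g: "smooth_on S g" "\<forall>t\<in>S. h t = g t" by blast
  then obtain g' where g': "smooth_on S g'" "\<And>t. t \<in> S \<Longrightarrow> (g has_vector_derivative g' t) (at t)"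
    using smooth_on_derivative[OF g(1)] by blast
  have "(h has_vector_derivative g' t) (at t)" if "t \<in> S" for t
    by (rule has_vector_derivative_transform_within_open[OF g'(2)[OF that] assms(2) that])
      (use g in auto)
  then show "\<exists>g'\<in>{h. \<exists>g. smooth_on S g \<and> (\<forall>t\<in>S. h t = g t)}.
      \<forall>t\<in>S. (h has_vector_derivative g' t) (at t)"
    using g' by blast
qed

text \<open>\<open>vector_derivative\<close> selects the derivative independently of the
  neighbourhood, so the local derivatives fit together into one function, which is again locally
  smooth.\<close>

lemma smooth_on_local:
  assumes "\<And>t. t \<in> S \<Longrightarrow> \<exists>U. open U \<and> t \<in> U \<and> smooth_on U g"
  shows "smooth_on S g"
proof (rule smooth_on_coinduct)
  let ?X = "{g. \<forall>t\<in>S. \<exists>U. open U \<and> t \<in> U \<and> smooth_on U g}"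
  show "g \<in> ?X" using assms by blast
  fix g assume g: "g \<in> ?X"
  define g' where "g' t = vector_derivative g (at t)" for t
  have *: "\<exists>U. open U \<and> t \<in> U \<and> smooth_on U g' \<and> (g has_vector_derivative g' t) (at t)"
    if t: "t \<in> S" for t
  proof -
    obtain U where U: "open U" "t \<in> U" "smooth_on U g"
      using g t by blast
    obtain h where h: "smooth_on U h" "\<And>t. t \<in> U \<Longrightarrow> (g has_vector_derivative h t) (at t)"
      using smooth_on_derivative[OF U(3)] by blast
    have eq: "g' u = h u" if "u \<in> U" for u
      unfolding g'_def using h(2)[OF that] by (rule vector_derivative_at)
    then show ?thesis
      using U h smooth_on_cong[OF h(1) U(1) eq] by auto
  qed
  show "\<exists>g'\<in>?X. \<forall>t\<in>S. (g has_vector_derivative g' t) (at t)"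
  proof (intro bexI[of _ g'] CollectI ballI)
    fix t assume "t \<in> S"
    from *[OF this] show "(g has_vector_derivative g' t) (at t)" by auto
  next
    fix t assume "t \<in> S"
    from *[OF this] show "\<exists>U. open U \<and> t \<in> U \<and> smooth_on U g'" by auto
  qed
qed

lemma smooth_on_linear:
  assumes "smooth_on S g" "bounded_linear L"
  shows "smooth_on S (\<lambda>t. L (g t))"
proof (rule smooth_on_coinduct)
  let ?X = "{\<lambda>t. L (g t) | g. smooth_on S g}"
  show "(\<lambda>t. L (g t)) \<in> ?X" using assms by blast
  fix k assume "k \<in> ?X"
  then obtain g where g: "smooth_on S g" "k = (\<lambda>t. L (g t))" by blast
  obtain g' where g': "smooth_on S g'" "\<And>t. t \<in> S \<Longrightarrow> (g has_vector_derivative g' t) (at t)"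
    using smooth_on_derivative[OF g(1)] by blast
  show "\<exists>g'\<in>?X. \<forall>t\<in>S. (k has_vector_derivative g' t) (at t)"
    unfolding g(2)
  proof (intro bexI[of _ "\<lambda>t. L (g' t)"] ballI)
    show "((\<lambda>t. L (g t)) has_vector_derivative L (g' t)) (at t)" if "t \<in> S" for t
      using bounded_linear.has_vector_derivative[OF assms(2) g'(2)[OF that]] .
    show "(\<lambda>t. L (g' t)) \<in> ?X" using g'(1) by blast
  qed
qed

lemma smooth_on_shift:
  assumes "smooth_on S g"
  shows "smooth_on {t. t - \<alpha> \<in> S} (\<lambda>t. g (t - \<alpha>))"
proof (rule smooth_on_coinduct)
  let ?X = "{\<lambda>t. g (t - \<alpha>) | g. smooth_on S g}"
  show "(\<lambda>t. g (t - \<alpha>)) \<in> ?X" using assms by blast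
  fix k assume "k \<in> ?X"
  then obtain g where g: "smooth_on S g" "k = (\<lambda>t. g (t - \<alpha>))" by blast
  obtain g' where g': "smooth_on S g'" "\<And>t. t \<in> S \<Longrightarrow> (g has_vector_derivative g' t) (at t)"
    using smooth_on_derivative[OF g(1)] by blast
  have "((\<lambda>t. g (t - \<alpha>)) has_vector_derivative g' (t - \<alpha>)) (at t)" if "t - \<alpha> \<in> S" for t
  proof -
    have "((\<lambda>t. t - \<alpha>) has_vector_derivative 1) (at t)" by (auto intro!: derivative_eq_intros)
    from vector_diff_chain_at[OF this g'(2)[OF that]] show ?thesis by (simp add: o_def)
  qed
  then show "\<exists>g'\<in>?X. \<forall>t\<in>{t. t - \<alpha> \<in> S}. (k has_vector_derivative g' t) (at t)"
    using g' g(2) by (intro bexI[of _ "\<lambda>t. g' (t - \<alpha>)"]) auto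
qed

inductive_set fun_algebra :: "(real \<Rightarrow> complex) set \<Rightarrow> (real \<Rightarrow> complex) set" for \<Gamma> where
  gen: "g \<in> \<Gamma> \<Longrightarrow> g \<in> fun_algebra \<Gamma>"
| const: "(\<lambda>_. k) \<in> fun_algebra \<Gamma>"
| add: "g \<in> fun_algebra \<Gamma> \<Longrightarrow> h \<in> fun_algebra \<Gamma> \<Longrightarrow> (\<lambda>t. g t + h t) \<in> fun_algebra \<Gamma>"
| mult: "g \<in> fun_algebra \<Gamma> \<Longrightarrow> h \<in> fun_algebra \<Gamma> \<Longrightarrow> (\<lambda>t. g t * h t) \<in> fun_algebra \<Gamma>"

text \<open>The sum and product rules carry closure under differentiation from the generators to the
  whole algebra, which then serves as the class in \<open>smooth_on_coinduct\<close>.\<close>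

lemma smooth_on_fun_algebra:
  assumes "g \<in> fun_algebra \<Gamma>"
    and \<Gamma>: "\<And>g. g \<in> \<Gamma> \<Longrightarrow> \<exists>g'\<in>fun_algebra \<Gamma>. \<forall>t\<in>S. (g has_vector_derivative g' t) (at t)"
  shows "smooth_on S g"
proof (rule smooth_on_coinduct[OF assms(1)])
  fix g assume "g \<in> fun_algebra \<Gamma>"
  then show "\<exists>g'\<in>fun_algebra \<Gamma>. \<forall>t\<in>S. (g has_vector_derivative g' t) (at t)"
  proof induction
    case (gen g)
    then show ?case by (rule \<Gamma>)
  next
    case (const k)
    show ?case
      by (intro bexI[of _ "\<lambda>_. 0"]) (auto intro: fun_algebra.const)
  next
    case (add g h)
    then obtain g' h' where "g' \<in> fun_algebra \<Gamma>" "\<forall>t\<in>S. (g has_vector_derivative g' t) (at t)"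
       "h' \<in> fun_algebra \<Gamma>" "\<forall>t\<in>S. (h has_vector_derivative h' t) (at t)" by blast
    then show ?case
      by (intro bexI[of _ "\<lambda>t. g' t + h' t"] ballI fun_algebra.add has_vector_derivative_add) auto
  next
    case (mult g h)
    then obtain g' h' where "g' \<in> fun_algebra \<Gamma>" "\<forall>t\<in>S. (g has_vector_derivative g' t) (at t)"
       "h' \<in> fun_algebra \<Gamma>" "\<forall>t\<in>S. (h has_vector_derivative h' t) (at t)" by blast
    with mult(1,2) show ?case
      by (intro bexI[of _ "\<lambda>t. g t * h' t + g' t * h t"] ballI fun_algebra.add fun_algebra.mult
          has_vector_derivative_mult) auto
  qed
qed

lemma smooth_on_mult:
  fixes g h :: "real \<Rightarrow> complex"
  assumes "smooth_on S g" "smooth_on S h"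
  shows "smooth_on S (\<lambda>t. g t * h t)"
proof (rule smooth_on_fun_algebra)
  show "(\<lambda>t. g t * h t) \<in> fun_algebra {g. smooth_on S g}"
    using assms by (intro fun_algebra.mult fun_algebra.gen) auto
  show "\<exists>g'\<in>fun_algebra {g. smooth_on S g}. \<forall>t\<in>S. (g has_vector_derivative g' t) (at t)"
    if "g \<in> {g. smooth_on S g}" for g
    using smooth_on_derivative[of S g] that fun_algebra.gen[of _ "{g. smooth_on S g}"] by blast
qed

subsection \<open>Antiderivatives and constancy\<close>

lemma antiderivative_on_interval:
  fixes g :: "real \<Rightarrow> 'a::banach"
  assumes "open J" "is_interval J" "continuous_on J g"
  shows "\<exists>G. \<forall>t\<in>J. (G has_vector_derivative g t) (at t)"
proof (cases "J = {}")
  case False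
  then obtain t0 where t0: "t0 \<in> J" by blast
  \<comment> \<open>One of the two integrals always vanishes, so this is the oriented integral from
    \<open>t0\<close> to \<open>t\<close>.\<close>
  define G where "G t = integral {t0..t} g - integral {t..t0} g" for t
  have "(G has_vector_derivative g t) (at t)" if t: "t \<in> J" for t
  proof -
    obtain e1 where e1: "e1 > 0" "cball t e1 \<subseteq> J"
      using assms(1) t open_contains_cball by blast
    \<comment> \<open>The interval from \<open>a\<close> to \<open>b\<close> contains
      \<open>t0\<close> and has \<open>t\<close> in its interior, so that near \<open>t\<close> the
      function \<open>G\<close> is an integral with the fixed lower limit \<open>a\<close>, up to a
      constant.\<close>
    define a b where "a = min (t - e1) t0" and "b = max (t + e1) t0"
    have "a \<in> J" "b \<in> J"
      using e1 t0 by (auto simp: a_def b_def min_def max_def dist_real_def subset_iff)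
    have ab: "a \<le> t0" "t0 \<le> b" "a < t" "t < b" using e1 by (auto simp: a_def b_def)
    have "{a..b} \<subseteq> J"
      using mem_is_interval_1_I[OF assms(2) \<open>a \<in> J\<close> \<open>b \<in> J\<close>] by auto
    then have cont: "continuous_on {a..b} g" using assms(3) continuous_on_subset by blast
    have int: "g integrable_on {u..v}" if "a \<le> u" "v \<le> b" for u v
      using cont that by (intro integrable_continuous_real) (auto elim: continuous_on_subset)
    have G: "G u = integral {a..u} g - integral {a..t0} g" if "u \<in> {a<..<b}" for u
    proof (cases "t0 \<le> u")
      case True
      then have "integral {u..t0} g = 0" by (cases "u = t0") auto
      then show ?thesis
        using Henstock_Kurzweil_Integration.integral_combine[of a t0 u g] ab that True
        by (auto simp: G_def int algebra_simps)
    next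
      case False
      then have "integral {t0..u} g = 0" by auto
      then show ?thesis
        using Henstock_Kurzweil_Integration.integral_combine[of a u t0 g] ab that False
        by (auto simp: G_def int algebra_simps)
    qed
    have "((\<lambda>u. integral {a..u} g) has_vector_derivative g t) (at t within {a..b})"
      using integral_has_vector_derivative[OF cont] ab by auto
    then have "((\<lambda>u. integral {a..u} g) has_vector_derivative g t) (at t)"
      using ab at_within_interior[of t "{a..b}"] by simp
    then have "((\<lambda>u. integral {a..u} g - integral {a..t0} g) has_vector_derivative g t) (at t)"
      by (auto intro!: derivative_eq_intros)
    then show ?thesis
      by (rule has_vector_derivative_transform_within_open[of _ _ _ "{a<..<b}"]) (use ab G in auto)
  qed
  then show ?thesis by blast
qed auto

text \<open>Exceptional sets are required to be finite in compact intervals, as the zeros of a regular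
  curve are.\<close>

lemma zero_derivative_constant:
  fixes g :: "real \<Rightarrow> 'a::banach"
  assumes "is_interval J" "continuous_on J g"
    and "\<And>a b. a \<in> J \<Longrightarrow> b \<in> J \<Longrightarrow> finite {t\<in>{a..b}. Z t}"
    and "\<And>t. t \<in> J \<Longrightarrow> \<not> Z t \<Longrightarrow> (g has_vector_derivative 0) (at t)"
    and "s \<in> J" "t \<in> J"
  shows "g s = g t"
proof -
  have *: "g v = g u" if "u \<in> J" "v \<in> J" "u \<le> v" for u v
  proof -
    have J: "{u..v} \<subseteq> J" using mem_is_interval_1_I[OF assms(1) that(1,2)] by auto
    have "((\<lambda>_. 0) has_integral (g v - g u)) {u..v}"
    proof (rule fundamental_theorem_of_calculus_interior_strong[OF assms(3)[OF that(1,2)] that(3)])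
      show "(g has_vector_derivative 0) (at x)"
        if "x \<in> {u<..<v} - {t \<in> {u..v}. Z t}" for x
        using that subsetD[OF J, of x] assms(4)[of x] by simp
      show "continuous_on {u..v} g" using assms(2) J continuous_on_subset by blast
    qed
    then show ?thesis by (metis eq_iff_diff_eq_0 has_integral_0_eq)
  qed
  show ?thesis using *[of s t] *[of t s] assms(5,6) by (cases "s \<le> t") auto
qed

text \<open>Infinitely many zeros accumulate at some \<open>x\<close>, which is a zero by
  continuity. Along the zeros the difference quotients at \<open>x\<close> vanish, contrary to
  \<open>c' x \<noteq> 0\<close>.\<close>

lemma finite_zeros_regular:
  fixes c :: "real \<Rightarrow> 'a::real_normed_vector"
  assumes "\<And>t. t \<in> {a..b} \<Longrightarrow> (c has_vector_derivative c' t) (at t)"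
    and "\<And>t. t \<in> {a..b} \<Longrightarrow> c t = 0 \<Longrightarrow> c' t \<noteq> 0"
  shows "finite {t\<in>{a..b}. c t = 0}"
proof (rule ccontr)
  let ?Z = "{t\<in>{a..b}. c t = 0}"
  assume "infinite ?Z"
  then obtain x where x: "x \<in> {a..b}" "x islimpt ?Z"
    using Heine_Borel_imp_Bolzano_Weierstrass[OF compact_Icc[of a b], of ?Z] by blast
  have d: "(c has_vector_derivative c' x) (at x)" using assms(1) x(1) by blast
  have "c x = 0"
  proof -
    obtain s where s: "\<And>n. s n \<in> ?Z - {x}" "s \<longlonglongrightarrow> x"
      using x(2) islimpt_sequential by blast
    have "(\<lambda>n. c (s n)) \<longlonglongrightarrow> c x"
      using isCont_tendsto_compose[OF has_vector_derivative_continuous[OF d] s(2)] .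
    moreover have "c (s n) = 0" for n using s(1)[of n] by blast
    ultimately show ?thesis by (simp add: LIMSEQ_const_iff)
  qed
  then have c'x: "c' x \<noteq> 0" using assms(2) x(1) by blast
  have "((\<lambda>y. norm (c y - c x - (y - x) *\<^sub>R c' x) / norm (y - x)) \<longlongrightarrow> 0) (at x)"
    using d by (simp add: has_vector_derivative_def has_derivative_iff_norm)
  then have "\<forall>\<^sub>F y in at x. norm (c y - c x - (y - x) *\<^sub>R c' x) / norm (y - x) < norm (c' x)"
    using c'x order_tendstoD(2) by fastforce
  then have "\<forall>\<^sub>F y in at x. norm (c y - c x - (y - x) *\<^sub>R c' x) / norm (y - x) < norm (c' x) \<and> y \<noteq> x"
    using eventually_neq_at_within eventually_conj by blast
  then have "\<forall>\<^sub>F y in at x. y \<notin> ?Z"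
    by (rule eventually_mono) (use \<open>c x = 0\<close> in auto)
  then show False using x(2) islimpt_iff_eventually by blast
qed

subsection \<open>Tangent angles and curvature\<close>

lemma arc_path_derivative:
  assumes "(J, c) \<in> arc_paths" "t \<in> J"
  shows "(c has_vector_derivative vector_derivative c (at t)) (at t)"
    and "norm (vector_derivative c (at t)) = 1"
proof -
  have "smooth_on J c" using assms(1) by (auto simp: arc_paths_def)
  then show "(c has_vector_derivative vector_derivative c (at t)) (at t)"
    using smooth_on_derivative[of J c] assms(2) by (auto simp: vector_derivative_at)
  show "norm (vector_derivative c (at t)) = 1" using assms by (auto simp: arc_paths_def)
qed

lemma tangent_angle_derivative:
  assumes "(J, c) \<in> arc_paths" "is_tangent_angle (J, c) \<theta>" "t \<in> J"
  shows "(c has_vector_derivative cis (\<theta> t)) (at t)"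
  using arc_path_derivative(1)[OF assms(1,3)] assms(2,3) by (auto simp: is_tangent_angle_def)

lemma cis_real_derivative:
  assumes "(\<theta> has_real_derivative k) (at t within S)"
  shows "((\<lambda>t. cis (\<theta> t)) has_vector_derivative (\<i> * of_real k * cis (\<theta> t))) (at t within S)"
proof -
  have "((\<lambda>t. cos (\<theta> t)) has_real_derivative - sin (\<theta> t) * k) (at t within S)"
       "((\<lambda>t. sin (\<theta> t)) has_real_derivative cos (\<theta> t) * k) (at t within S)"
    by (auto intro!: derivative_eq_intros assms)
  then show ?thesis
    by (auto simp: has_vector_derivative_complex_iff mult_ac)
qed

lemma smooth_on_real_derivative:
  assumes "smooth_on S (g :: real \<Rightarrow> real)"
  shows "\<exists>g'. smooth_on S g' \<and> (\<forall>t\<in>S. (g has_real_derivative g' t) (at t))"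
  using smooth_on_derivative[OF assms] by (simp add: has_real_derivative_iff_has_vector_derivative)

text \<open>The unit tangent \<open>v\<close> is orthogonal to its derivative, so v' = i \<kappa> v
  with real \<kappa>. For a primitive \<theta> of \<kappa> the product of \<open>v\<close> with the
  conjugate of \<open>cis \<theta>\<close> is constant, and the initial value of \<theta> makes this
  constant 1.\<close>

lemma tangent_angle_exists:
  assumes "(J, c) \<in> arc_paths"
  shows "\<exists>\<theta>. is_tangent_angle (J, c) \<theta>"
proof -
  have J: "open J" "is_interval J" "0 \<in> J" "smooth_on J c"
    using assms by (auto simp: arc_paths_def)
  obtain v where v: "smooth_on J v" "\<And>t. t \<in> J \<Longrightarrow> (c has_vector_derivative v t) (at t)"
    using smooth_on_derivative[OF J(4)] by blast
  obtain w where w: "smooth_on J w" "\<And>t. t \<in> J \<Longrightarrow> (v has_vector_derivative w t) (at t)"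
    using smooth_on_derivative[OF v(1)] by blast
  have vd: "vector_derivative c (at t) = v t" if "t \<in> J" for t
    using v(2)[OF that] vector_derivative_at by blast
  have v1: "cnj (v t) * v t = 1" if "t \<in> J" for t
    using arc_path_derivative(2)[OF assms that] vd[OF that] complex_norm_square[of "v t"]
    by (simp add: mult.commute)
  define \<kappa> where "\<kappa> t = Im (cnj (v t) * w t)" for t
  have sm\<kappa>: "smooth_on J \<kappa>"
    unfolding \<kappa>_def
    by (intro smooth_on_linear[OF _ bounded_linear_Im] smooth_on_mult
        smooth_on_linear[OF _ bounded_linear_cnj] v w)
  have w\<kappa>: "w t = \<i> * \<kappa> t * v t" if t: "t \<in> J" for t
  proof -
    have "((\<lambda>t. cnj (v t) * v t) has_vector_derivative (cnj (v t) * w t + cnj (w t) * v t)) (at t)"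
      by (intro has_vector_derivative_mult has_vector_derivative_cnj w t)
    moreover have "((\<lambda>t. cnj (v t) * v t) has_vector_derivative 0) (at t)"
      by (rule has_vector_derivative_transform_within_open[of "\<lambda>_. 1" _ _ J])
        (use v1 J t in auto)
    ultimately have "cnj (v t) * w t + cnj (w t) * v t = 0"
      by (metis vector_derivative_at)
    then have "Re (cnj (v t) * w t) = 0"
      by (simp add: complex_eq_iff algebra_simps)
    then have "cnj (v t) * w t = \<i> * \<kappa> t"
      by (simp add: complex_eq_iff \<kappa>_def)
    then have "(cnj (v t) * v t) * w t = \<i> * \<kappa> t * v t" by (simp only: mult_ac)
    then show ?thesis using v1[OF t] by simp
  qed
  obtain \<theta>1 where \<theta>1: "\<And>t. t \<in> J \<Longrightarrow> (\<theta>1 has_vector_derivative \<kappa> t) (at t)"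
    using antiderivative_on_interval[OF J(1,2) smooth_on_continuous[OF sm\<kappa>]] by blast
  define \<theta> where "\<theta> t = \<theta>1 t + (Arg (v 0) - \<theta>1 0)" for t
  have \<theta>': "(\<theta> has_vector_derivative \<kappa> t) (at t)" if "t \<in> J" for t
    unfolding \<theta>_def using \<theta>1[OF that] by (auto intro!: derivative_eq_intros)
  have const: "cnj (cis (\<theta> s)) * v s = cnj (cis (\<theta> t)) * v t" if "s \<in> J" "t \<in> J" for s t
  proof (rule zero_derivative_constant[OF J(2), where Z = "\<lambda>_. False"])
    have der: "((\<lambda>t. cnj (cis (\<theta> t)) * v t) has_vector_derivative 0) (at t)" if "t \<in> J" for t
    proof -
      have "((\<lambda>t. cnj (cis (\<theta> t)) * v t) has_vector_derivative
         (cnj (cis (\<theta> t)) * w t + cnj (\<i> * of_real (\<kappa> t) * cis (\<theta> t)) * v t)) (at t)"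
        by (intro has_vector_derivative_mult has_vector_derivative_cnj w that cis_real_derivative)
          (use \<theta>'[OF that] in \<open>simp add: has_real_derivative_iff_has_vector_derivative\<close>)
      then show ?thesis using w\<kappa>[OF that] by (simp add: algebra_simps)
    qed
    then show "\<And>t. t \<in> J \<Longrightarrow> \<not> False \<Longrightarrow>
        ((\<lambda>t. cnj (cis (\<theta> t)) * v t) has_vector_derivative 0) (at t)" by blast
    show "continuous_on J (\<lambda>t. cnj (cis (\<theta> t)) * v t)"
      using der has_vector_derivative_continuous continuous_at_imp_continuous_on by blast
  qed (use that in auto)
  have "v t = cis (\<theta> t)" if "t \<in> J" for t
  proof -
    have "norm (v 0) = 1" using arc_path_derivative(2)[OF assms J(3)] vd[OF J(3)] by simp
    then have "v 0 = cis (\<theta> 0)"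
      using cis_Arg[of "v 0"] by (cases "v 0 = 0") (auto simp: \<theta>_def sgn_div_norm)
    then have "cnj (cis (\<theta> t)) * v t = 1"
      using const[OF that J(3)] by (simp add: cis_cnj cis_mult)
    then have "cis (\<theta> t) * (cnj (cis (\<theta> t)) * v t) = cis (\<theta> t)" by simp
    then show ?thesis by (simp add: cis_cnj cis_mult flip: mult.assoc)
  qed
  moreover have "smooth_on J \<theta>"
    using smooth_on_antiderivative[OF sm\<kappa> \<theta>'] by blast
  ultimately have "is_tangent_angle (J, c) \<theta>"
    by (auto simp: is_tangent_angle_def vd)
  then show ?thesis by blast
qed

text \<open>\<open>curvature\<close> differentiates an arbitrarily chosen tangent angle. Any two
  tangent angles have the same \<open>cis\<close>, hence the same derivative.\<close>

lemma tangent_angle_curvature: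
  assumes "(J, c) \<in> arc_paths" "is_tangent_angle (J, c) \<theta>" "t \<in> J"
  shows "(\<theta> has_real_derivative curvature (J, c) t) (at t)"
proof -
  define \<theta>' where "\<theta>' = (SOME \<theta>. is_tangent_angle (J, c) \<theta>)"
  have \<theta>': "is_tangent_angle (J, c) \<theta>'"
    unfolding \<theta>'_def by (rule someI[of _ \<theta>]) (rule assms(2))
  have J: "open J" using assms(1) by (auto simp: arc_paths_def)
  obtain k where k: "(\<theta> has_real_derivative k) (at t)"
    using assms(2,3) smooth_on_real_derivative[of J \<theta>] by (auto simp: is_tangent_angle_def)
  obtain k' where k': "(\<theta>' has_real_derivative k') (at t)"
    using \<theta>' assms(3) smooth_on_real_derivative[of J \<theta>'] by (auto simp: is_tangent_angle_def)
  have eq: "cis (\<theta> u) = cis (\<theta>' u)" if "u \<in> J" for u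
    using assms(2) \<theta>' that by (auto simp: is_tangent_angle_def)
  have "((\<lambda>u. cis (\<theta> u)) has_vector_derivative \<i> * of_real k' * cis (\<theta>' t)) (at t)"
    by (rule has_vector_derivative_transform_within_open[OF cis_real_derivative[OF k'] J assms(3)])
      (simp add: eq)
  from vector_derivative_unique_at[OF cis_real_derivative[OF k] this]
  have "\<i> * of_real k * cis (\<theta> t) = \<i> * of_real k' * cis (\<theta>' t)" .
  then have "k = k'" using eq[OF assms(3)] by simp
  then show ?thesis
    using k k' by (simp add: curvature_def \<theta>'_def DERIV_imp_deriv)
qed

subsection \<open>The Hamiltonian and its level curves\<close>

text \<open>\<open>f\<close> stands for \<open>\<epsilon>\<^sub>ff\<close> and \<open>a\<close> for \<open>s\<^sub>f\<close>.\<close>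

locale attractive_curvature =
  fixes f :: "real \<Rightarrow> real" and a :: real
  assumes f_smooth: "smooth_on {0<..} f"
    and f_pos: "0 < s \<Longrightarrow> 0 < f s"
    and f_mono: "0 < s \<Longrightarrow> s < t \<Longrightarrow> s * f s < t * f t"
    and a_pos: "0 < a"
    and f_a: "a * f a = 1"
begin

lemma f_has_derivative: "0 < s \<Longrightarrow> (f has_real_derivative deriv f s) (at s)"
  using smooth_on_real_derivative[OF f_smooth] DERIV_imp_deriv by fastforce

lemma isCont_f: "0 < s \<Longrightarrow> isCont f s"
  using f_has_derivative DERIV_isCont by blast

section \<open>The profile \<open>s * f s\<close>, extended continuously to all reals\<close>

definition prof0 :: real where "prof0 = Inf ((\<lambda>s. s * f s) ` {0<..})"

text \<open>Since \<open>s * f s\<close> increases, \<open>prof0\<close> is its limit at 0. The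
  constant extension to the left makes \<open>prof\<close> continuous and monotone everywhere, so
  that it has a primitive on the whole line and \<open>ham\<close> is defined at the origin.\<close>

definition prof :: "real \<Rightarrow> real" where "prof s = (if 0 < s then s * f s else prof0)"

lemma prof0_le: "0 < s \<Longrightarrow> prof0 \<le> s * f s"
  unfolding prof0_def
  by (rule cInf_lower) (auto intro!: bdd_belowI[of _ 0] simp: f_pos less_imp_le)

lemma prof0_less: "0 < s \<Longrightarrow> prof0 < s * f s"
  using order.strict_trans1[OF prof0_le[of "s/2"] f_mono[of "s/2" s]] by simp

lemma prof0_nonneg: "0 \<le> prof0"
  unfolding prof0_def by (rule cInf_greatest) (auto simp: f_pos less_imp_le)

lemma prof0_approx: "prof0 < e \<Longrightarrow> \<exists>s>0. s * f s < e"
  unfolding prof0_def using cInf_lessD[of "(\<lambda>s. s * f s) ` {0<..}" e] by auto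

lemma prof_nonneg: "0 \<le> prof s"
  using prof0_nonneg f_pos by (auto simp: prof_def less_imp_le)

lemma prof_strict_mono: "0 \<le> s \<Longrightarrow> s < t \<Longrightarrow> prof s < prof t"
  using f_mono prof0_less by (auto simp: prof_def)

lemma prof_mono: "s \<le> t \<Longrightarrow> prof s \<le> prof t"
  using f_mono[of s t] prof0_le[of t] by (cases "s = t") (auto simp: prof_def)

lemma prof_a: "prof a = 1"
  using a_pos f_a by (simp add: prof_def)

lemma isCont_prof: "isCont prof s"
proof (cases s "0::real" rule: linorder_cases)
  case less
  have "\<forall>\<^sub>F x in nhds s. prof x = prof0"
    by (rule eventually_nhds_in_open[of "{..<0}", THEN eventually_mono]) (use less in \<open>auto simp: prof_def\<close>)
  then show ?thesis using isCont_cong[of prof "\<lambda>_. prof0" s] by simp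
next
  case greater
  have "\<forall>\<^sub>F x in nhds s. prof x = x * f x"
    by (rule eventually_nhds_in_open[of "{0<..}", THEN eventually_mono]) (use greater in \<open>auto simp: prof_def\<close>)
  then show ?thesis
    using isCont_cong[of prof "\<lambda>x. x * f x" s] isCont_f[OF greater] by simp
next
  case equal
  show ?thesis unfolding equal isCont_def
  proof (rule order_tendstoI)
    fix e assume "e < prof 0"
    then show "\<forall>\<^sub>F x in at 0. e < prof x"
      by (intro always_eventually allI) (smt (verit) prof_def prof0_le)
  next
    fix e assume "prof 0 < e"
    then obtain s where s: "s > 0" "s * f s < e" using prof0_approx by (auto simp: prof_def)
    have "\<forall>\<^sub>F x in at 0. x < s" using s(1) by (auto intro: eventually_at_leftI order_tendstoD(2)[OF tendsto_ident_at])
    then show "\<forall>\<^sub>F x in at 0. prof x < e"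
    proof (rule eventually_mono)
      fix x assume "x < s"
      then have "prof x \<le> prof s" by (intro prof_mono) simp
      then show "prof x < e" using s by (simp add: prof_def)
    qed
  qed
qed

definition prim :: "real \<Rightarrow> real" where
  "prim = (SOME g. g 0 = 0 \<and> (\<forall>s. (g has_real_derivative prof s) (at s)))"

lemma prim_0: "prim 0 = 0" and prim_derivative: "(prim has_real_derivative prof s) (at s)"
proof -
  have "continuous_on UNIV prof" using isCont_prof by (simp add: continuous_at_imp_continuous_on)
  then obtain g where "\<forall>t\<in>UNIV. (g has_vector_derivative prof t) (at t)"
    using antiderivative_on_interval[of UNIV prof] by auto
  then have "\<exists>g. g 0 = 0 \<and> (\<forall>s. (g has_real_derivative prof s) (at s))"
    by (intro exI[of _ "\<lambda>s. g s - g 0"])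
      (auto simp: has_real_derivative_iff_has_vector_derivative intro!: derivative_eq_intros)
  from someI_ex[OF this] have "prim 0 = 0 \<and> (\<forall>s. (prim has_real_derivative prof s) (at s))"
    unfolding prim_def .
  then show "prim 0 = 0" "(prim has_real_derivative prof s) (at s)" by auto
qed

lemma isCont_prim: "isCont prim s"
  using prim_derivative DERIV_isCont by blast

lemma prim_strict_mono:
  assumes "0 \<le> s" "s < t"
  shows "prim s < prim t"
proof (rule DERIV_pos_imp_increasing_open[OF assms(2)])
  fix x assume "s < x"
  then have "0 < prof x" using prof_strict_mono[of s x] prof_nonneg[of s] assms by simp
  then show "\<exists>y. (prim has_real_derivative y) (at x) \<and> 0 < y" using prim_derivative by blast
qed (auto simp: isCont_prim continuous_at_imp_continuous_on)

text \<open>On the positive real axis this is a primitive of \<open>s * f s - 1\<close>, that is,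
  \<open>F_prim f\<close> up to a constant.\<close>

definition ham :: "complex \<Rightarrow> real" where "ham z = prim (cmod z) - Re z"

text \<open>Away from 0 this is the gradient of \<open>ham\<close>, and \<open>\<i> * grad z\<close>
  is the field of the flow. At 0 the formula yields the value -1, which carries no meaning as a
  gradient.\<close>

definition grad :: "complex \<Rightarrow> complex" where "grad z = of_real (f (cmod z)) * z - 1"

definition ham_min :: real where "ham_min = ham (of_real a)"

lemma ham_0: "ham 0 = 0" by (simp add: ham_def prim_0)

lemma ham_cnj: "ham (cnj z) = ham z" by (simp add: ham_def)

lemma isCont_ham: "isCont ham z"
  unfolding ham_def
  by (intro continuous_intros isCont_o2[OF _ isCont_prim] linear_continuous_at bounded_linear_Re)

lemma continuous_on_ham: "continuous_on S ham"
  using isCont_ham by (simp add: continuous_at_imp_continuous_on)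

lemma ham_derivative:
  assumes "z \<noteq> 0"
  shows "(ham has_derivative (\<lambda>v. grad z \<bullet> v)) (at z)"
proof -
  have n: "(norm has_derivative (\<lambda>h. h \<bullet> sgn z)) (at z)"
    using has_derivative_norm[OF assms] .
  have "(prim has_derivative (\<lambda>h. prof (cmod z) * h)) (at (norm z))"
    using prim_derivative[of "cmod z"] by (simp add: has_field_derivative_def)
  from has_derivative_compose[OF n this]
  have "((\<lambda>z. prim (norm z)) has_derivative (\<lambda>h. prof (cmod z) * (h \<bullet> sgn z))) (at z)" .
  then have "(ham has_derivative (\<lambda>h. prof (cmod z) * (h \<bullet> sgn z) - Re h)) (at z)"
    unfolding ham_def by (intro derivative_intros) auto
  moreover have "(\<lambda>h. prof (cmod z) * (h \<bullet> sgn z) - Re h) = (\<lambda>v. grad z \<bullet> v)"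
    using assms by (auto simp: fun_eq_iff prof_def grad_def inner_complex_def sgn_div_norm field_simps)
  ultimately show ?thesis by simp
qed

text \<open>\<open>rad_slope\<close> is discontinuous at \<open>0\<close>, but has continuous positive bounds there.\<close>

definition rad_slope :: "complex \<Rightarrow> real" where "rad_slope z = (z - of_real a) \<bullet> grad z"

definition slope_lower :: "complex \<Rightarrow> real" where
  "slope_lower z = (cmod z - a) * (prof (cmod z) - 1) + cmod z - Re z"

definition slope_upper :: "complex \<Rightarrow> real" where
  "slope_upper z = (cmod z + a) * (prof (cmod z) + 1)"

lemma rad_slope_eq:
  "z \<noteq> 0 \<Longrightarrow> rad_slope z = prof (cmod z) * cmod z - Re z - a * f (cmod z) * Re z + a"
proof -
  assume "z \<noteq> 0"
  have "(cmod z)\<^sup>2 = (Re z)\<^sup>2 + (Im z)\<^sup>2" by (rule cmod_power2)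
  then have "f (cmod z) * (cmod z)\<^sup>2 = f (cmod z) * ((Re z)\<^sup>2 + (Im z)\<^sup>2)" by simp
  with \<open>z \<noteq> 0\<close> show ?thesis
    by (simp add: rad_slope_def grad_def inner_complex_def prof_def power2_eq_square algebra_simps)
qed

text \<open>The only term that may be discontinuous at 0 is \<open>a * f (cmod z) * Re z\<close>.
  Estimating \<open>Re z\<close> in it by \<open>cmod z\<close> or by \<open>- cmod z\<close> turns
  it into a multiple of the continuous function \<open>prof (cmod z)\<close>.\<close>

lemma rad_slope_bounds: "slope_lower z \<le> rad_slope z" "rad_slope z \<le> slope_upper z"
proof -
  have "slope_lower z \<le> rad_slope z \<and> rad_slope z \<le> slope_upper z"
  proof (cases "z = 0")
    case True
    then show ?thesis
      using a_pos prof_nonneg[of 0]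
      by (simp add: slope_lower_def slope_upper_def rad_slope_def grad_def inner_complex_def algebra_simps)
  next
    case False
    then have r: "0 < cmod z" and f: "0 < f (cmod z)" using f_pos by auto
    have x: "\<bar>Re z\<bar> \<le> cmod z" by (rule abs_Re_le_cmod)
    have "a * f (cmod z) * Re z \<le> a * f (cmod z) * cmod z"
      using x a_pos f by (intro mult_left_mono) auto
    moreover have "- (a * f (cmod z) * cmod z) \<le> a * f (cmod z) * Re z"
      using x a_pos f mult_left_mono[of "- cmod z" "Re z" "a * f (cmod z)"] by auto
    ultimately show ?thesis
      using x r unfolding rad_slope_eq[OF False] slope_lower_def slope_upper_def
      by (simp add: prof_def algebra_simps)
  qed
  then show "slope_lower z \<le> rad_slope z" "rad_slope z \<le> slope_upper z" by auto
qed

text \<open>As \<open>prof\<close> increases through 1 at \<open>a\<close>, the product is positive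
  off the circle of radius \<open>a\<close>. On that circle \<open>cmod z - Re z\<close> is positive
  except at the point \<open>a\<close>.\<close>

lemma slope_lower_pos: "z \<noteq> of_real a \<Longrightarrow> 0 < slope_lower z"
proof -
  assume z: "z \<noteq> of_real a"
  have x: "Re z \<le> cmod z" by (rule complex_Re_le_cmod)
  consider "cmod z < a" | "cmod z = a" | "a < cmod z" by linarith
  then show ?thesis
  proof cases
    case 1
    then have "prof (cmod z) < 1" using prof_strict_mono[of "cmod z" a] prof_a by simp
    then have "0 < (cmod z - a) * (prof (cmod z) - 1)" using 1 by (intro mult_neg_neg) auto
    then show ?thesis using x by (simp add: slope_lower_def)
  next
    case 2
    have "Re z \<noteq> a"
    proof
      assume "Re z = a"
      then have "Im z = 0" using 2 cmod_power2[of z] by simp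
      then show False using z \<open>Re z = a\<close> by (simp add: complex_eq_iff)
    qed
    then show ?thesis using x 2 by (simp add: slope_lower_def)
  next
    case 3
    then have "1 < prof (cmod z)" using prof_strict_mono[of a "cmod z"] prof_a a_pos by simp
    then have "0 < (cmod z - a) * (prof (cmod z) - 1)" using 3 by (intro mult_pos_pos) auto
    then show ?thesis using x by (simp add: slope_lower_def)
  qed
qed

lemma slope_upper_pos: "0 < slope_upper z"
  using a_pos prof_nonneg[of "cmod z"] norm_ge_zero[of z] unfolding slope_upper_def
  by (intro mult_pos_pos add_nonneg_pos) auto

lemma rad_slope_pos: "z \<noteq> of_real a \<Longrightarrow> 0 < rad_slope z"
  using slope_lower_pos rad_slope_bounds(1) by (meson less_le_trans)

lemma isCont_slope_lower: "isCont slope_lower z" and isCont_slope_upper: "isCont slope_upper z"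
  unfolding slope_lower_def slope_upper_def
  by (intro continuous_intros isCont_o2[OF _ isCont_prof] linear_continuous_at bounded_linear_Re)+

lemma isCont_rad_slope: "z \<noteq> 0 \<Longrightarrow> isCont rad_slope z"
  unfolding rad_slope_def grad_def
  by (intro continuous_intros isCont_o2[OF _ isCont_f]) auto

text \<open>Along the ray the derivative is \<open>rad_slope\<close> divided by \<rho>. It may fail
  to exist at the origin, which a ray from \<open>a\<close> can meet only at \<rho> =
  \<open>a\<close>; there two increasing pieces are joined.\<close>

lemma ham_ray_increasing:
  assumes "0 \<le> \<rho>" "\<rho> < \<rho>'"
  shows "ham (a + of_real \<rho> * cis \<phi>) < ham (a + of_real \<rho>' * cis \<phi>)"
proof -
  define k where "k \<rho> = ham (a + of_real \<rho> * cis \<phi>)" for \<rho>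
  have cont: "continuous_on S k" for S
    unfolding k_def by (intro continuous_on_compose2[OF continuous_on_ham[of UNIV]] continuous_intros) auto
  have der: "\<exists>y. (k has_real_derivative y) (at \<rho>) \<and> 0 < y"
    if "0 < \<rho>" "a + of_real \<rho> * cis \<phi> \<noteq> 0" for \<rho>
  proof -
    let ?z = "a + of_real \<rho> * cis \<phi>"
    have "((\<lambda>\<rho>. a + of_real \<rho> * cis \<phi>) has_derivative (\<lambda>h. h *\<^sub>R cis \<phi>)) (at \<rho>)"
      by (auto intro!: derivative_eq_intros simp: scaleR_conv_of_real)
    from has_derivative_compose[OF this ham_derivative[OF that(2)]]
    have "(k has_derivative (\<lambda>h. grad ?z \<bullet> (h *\<^sub>R cis \<phi>))) (at \<rho>)" unfolding k_def .
    then have "(k has_real_derivative (grad ?z \<bullet> cis \<phi>)) (at \<rho>)"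
      by (simp add: has_field_derivative_def mult_commute_abs)
    moreover have "0 < grad ?z \<bullet> cis \<phi>"
    proof -
      have "?z \<noteq> of_real a" using that(1) by simp
      then have "0 < rad_slope ?z" by (rule rad_slope_pos)
      also have "rad_slope ?z = \<rho> * (grad ?z \<bullet> cis \<phi>)"
        by (simp add: rad_slope_def inner_commute flip: scaleR_conv_of_real)
      finally show ?thesis using that(1) by (simp add: zero_less_mult_iff)
    qed
    ultimately show ?thesis by blast
  qed
  have step: "k s < k t" if "0 \<le> s" "s < t" "\<And>x. s < x \<Longrightarrow> x < t \<Longrightarrow> a + of_real x * cis \<phi> \<noteq> 0" for s t
    by (rule DERIV_pos_imp_increasing_open[OF that(2) _ cont]) (use that der in auto)
  have only: "x = a" if "a + of_real x * cis \<phi> = 0" "0 < x" for x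
  proof -
    have "cmod (of_real x * cis \<phi>) = cmod (- of_real a)" using that(1) by (simp add: add_eq_0_iff2)
    then show ?thesis using that(2) a_pos by (simp add: norm_mult)
  qed
  show ?thesis
  proof (cases "\<rho> < a \<and> a < \<rho>'")
    case True
    then have "k \<rho> < k a" "k a < k \<rho>'" using step[of \<rho> a] step[of a \<rho>'] only assms a_pos by force+
    then show ?thesis by (simp add: k_def)
  next
    case False
    then have "k \<rho> < k \<rho>'" using step[of \<rho> \<rho>'] only assms by force
    then show ?thesis by (simp add: k_def)
  qed
qed

text \<open>Beyond radius \<open>2 * a\<close> the slope of \<open>prim\<close> is at least 1 +
  \<delta>, which outweighs the term \<open>- Re z\<close> of slope at most 1.\<close>

lemma ham_coercive: "\<exists>M. \<forall>z. ham z \<le> h \<longrightarrow> cmod z \<le> M"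
proof -
  define \<delta> where "\<delta> = prof (2 * a) - 1"
  have \<delta>: "0 < \<delta>" using prof_strict_mono[of a "2*a"] prof_a a_pos by (simp add: \<delta>_def)
  have low: "prim (2*a) + (1 + \<delta>) * (r - 2*a) \<le> prim r" if "2 * a \<le> r" for r
  proof -
    have "(\<lambda>r. prim r - (1 + \<delta>) * r) (2*a) \<le> (\<lambda>r. prim r - (1 + \<delta>) * r) r"
    proof (rule DERIV_nonneg_imp_nondecreasing[OF that])
      fix x assume "2 * a \<le> x"
      then have "0 \<le> prof x - (1 + \<delta>)" using prof_mono[of "2*a" x] by (simp add: \<delta>_def)
      moreover have "((\<lambda>r. prim r - (1 + \<delta>) * r) has_real_derivative prof x - (1 + \<delta>)) (at x)"
        by (auto intro!: derivative_eq_intros prim_derivative)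
      ultimately show "\<exists>y. ((\<lambda>r. prim r - (1 + \<delta>) * r) has_real_derivative y) (at x) \<and> 0 \<le> y" by blast
    qed
    then show ?thesis by (simp add: algebra_simps)
  qed
  define M where "M = max (2*a) ((h - prim (2*a) + (1+\<delta>) * (2*a)) / \<delta>)"
  have "cmod z \<le> M" if "ham z \<le> h" for z
  proof (cases "cmod z \<le> 2*a")
    case False
    then have "prim (2*a) + (1 + \<delta>) * (cmod z - 2*a) - cmod z \<le> h"
      using low[of "cmod z"] that complex_Re_le_cmod[of z] by (simp add: ham_def)
    then have "\<delta> * cmod z \<le> h - prim (2*a) + (1+\<delta>) * (2*a)" by (simp add: algebra_simps)
    then have "cmod z \<le> (h - prim (2*a) + (1+\<delta>) * (2*a)) / \<delta>"
      using \<delta> by (simp add: pos_le_divide_eq mult.commute)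
    then show ?thesis by (simp add: M_def)
  qed (simp add: M_def)
  then show ?thesis by blast
qed

lemma ham_gt_min: "z \<noteq> of_real a \<Longrightarrow> ham_min < ham z"
proof -
  assume "z \<noteq> of_real a"
  define \<phi> where "\<phi> = Arg (z - of_real a)"
  have z: "z = a + of_real (cmod (z - of_real a)) * cis \<phi>"
    unfolding \<phi>_def using rcis_cmod_Arg[of "z - of_real a"] by (simp add: rcis_def)
  have "ham (a + of_real 0 * cis \<phi>) < ham (a + of_real (cmod (z - of_real a)) * cis \<phi>)"
    by (rule ham_ray_increasing) (use \<open>z \<noteq> of_real a\<close> in auto)
  then show ?thesis using z by (simp add: ham_min_def)
qed

lemma ham_min_neg: "ham_min < 0"
  using ham_gt_min[of 0] a_pos by (simp add: ham_0)

section \<open>Polar coordinates about \<open>a\<close> on a level curve\<close>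

definition rad :: "real \<Rightarrow> real \<Rightarrow> real" where
  "rad h \<phi> = (THE \<rho>. 0 < \<rho> \<and> ham (a + of_real \<rho> * cis \<phi>) = h)"

definition pol :: "real \<Rightarrow> real \<Rightarrow> complex" where "pol h \<phi> = a + of_real (rad h \<phi>) * cis \<phi>"

lemma ham_ray_less_iff:
  "0 \<le> \<rho> \<Longrightarrow> 0 \<le> \<rho>' \<Longrightarrow> ham (a + of_real \<rho> * cis \<phi>) < ham (a + of_real \<rho>' * cis \<phi>) \<longleftrightarrow> \<rho> < \<rho>'"
  using ham_ray_increasing[of \<rho> \<rho>' \<phi>] ham_ray_increasing[of \<rho>' \<rho> \<phi>]
  by (cases \<rho> \<rho>' rule: linorder_cases) auto

lemma rad_exists1:
  assumes "ham_min < h"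
  shows "\<exists>!\<rho>. 0 < \<rho> \<and> ham (a + of_real \<rho> * cis \<phi>) = h"
proof -
  define k where "k \<rho> = ham (a + of_real \<rho> * cis \<phi>)" for \<rho>
  have cont: "continuous_on S k" for S
    unfolding k_def by (intro continuous_on_compose2[OF continuous_on_ham[of UNIV]] continuous_intros) auto
  obtain M where M: "\<And>z. ham z \<le> h \<Longrightarrow> cmod z \<le> M" using ham_coercive by blast
  \<comment> \<open>At distance \<open>b\<close> from \<open>a\<close> the modulus exceeds
    \<open>M\<close>, so the level there exceeds \<open>h\<close> and the intermediate value theorem
    applies.\<close>
  define b where "b = \<bar>M\<bar> + a + 1"
  have b: "0 < b" "M < b - a" using a_pos by (auto simp: b_def)
  have "b - a \<le> cmod (a + of_real b * cis \<phi>)"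
    using norm_triangle_ineq2[of "of_real b * cis \<phi>" "- of_real a"] a_pos b
    by (simp add: norm_mult add.commute)
  then have "h < k b" using M[of "a + of_real b * cis \<phi>"] b by (force simp: k_def)
  moreover have "k 0 < h" using assms by (simp add: k_def ham_min_def)
  ultimately obtain \<rho> where "0 \<le> \<rho>" "k \<rho> = h"
    using IVT'[of k 0 h b] cont b by force
  with \<open>k 0 < h\<close> have "0 < \<rho> \<and> ham (a + of_real \<rho> * cis \<phi>) = h" by (cases "\<rho> = 0") (auto simp: k_def)
  moreover have "\<rho>' = \<rho>''" if "0 < \<rho>'" "0 < \<rho>''" "k \<rho>' = k \<rho>''" for \<rho>' \<rho>''
    using that ham_ray_less_iff[of \<rho>' \<rho>'' \<phi>] ham_ray_less_iff[of \<rho>'' \<rho>' \<phi>] by (auto simp: k_def)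
  ultimately show ?thesis by (auto simp: k_def intro!: ex1I[of _ \<rho>])
qed

lemma rad_pos: "ham_min < h \<Longrightarrow> 0 < rad h \<phi>"
  and ham_pol: "ham_min < h \<Longrightarrow> ham (pol h \<phi>) = h"
  using theI'[OF rad_exists1, of h \<phi>] by (auto simp: rad_def pol_def)

lemma rad_unique: "0 < \<rho> \<Longrightarrow> rad (ham (a + of_real \<rho> * cis \<phi>)) \<phi> = \<rho>"
proof -
  assume "0 < \<rho>"
  then have "ham_min < ham (a + of_real \<rho> * cis \<phi>)" by (intro ham_gt_min) auto
  from the1_equality[OF rad_exists1[OF this]] \<open>0 < \<rho>\<close> show ?thesis by (auto simp: rad_def)
qed

lemma pol_ham: "0 < \<rho> \<Longrightarrow> z = a + of_real \<rho> * cis \<phi> \<Longrightarrow> pol (ham z) \<phi> = z"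
  using rad_unique by (simp add: pol_def)

lemma pol_neq: "ham_min < h \<Longrightarrow> pol h \<phi> \<noteq> of_real a"
  using rad_pos[of h \<phi>] by (simp add: pol_def)

lemma rad_eqI: "ham_min < h \<Longrightarrow> 0 < \<rho> \<Longrightarrow> ham (a + of_real \<rho> * cis \<phi>) = h \<Longrightarrow> rad h \<phi> = \<rho>"
  using rad_unique by blast

lemma rad_cis_cong: "cis \<phi> = cis \<psi> \<Longrightarrow> rad h \<phi> = rad h \<psi>"
  by (simp add: rad_def)

lemma rad_uminus: "ham_min < h \<Longrightarrow> rad h (- \<phi>) = rad h \<phi>"
  by (rule rad_eqI) (use rad_pos[of h \<phi>] ham_pol[of h \<phi>] ham_cnj[of "pol h \<phi>"] in
      \<open>auto simp: pol_def cis_cnj\<close>)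

lemma pol_uminus: "ham_min < h \<Longrightarrow> pol h (- \<phi>) = cnj (pol h \<phi>)"
  by (simp add: pol_def rad_uminus cis_cnj)

lemma pol_cis_cong: "cis \<phi> = cis \<psi> \<Longrightarrow> pol h \<phi> = pol h \<psi>"
  using rad_cis_cong[of \<phi> \<psi> h] by (simp add: pol_def)

text \<open>By monotonicity along the ray, \<open>b < rad h \<phi>\<close> for positive
  \<open>b\<close> means that the level at distance \<open>b\<close> is below \<open>h\<close>. This
  is an open condition on the pair (h, \<phi>), and so is the reverse inequality.\<close>

lemma tendsto_rad:
  assumes h: "ham_min < h" and h': "(h' \<longlongrightarrow> h) F" and \<phi>': "(\<phi>' \<longlongrightarrow> \<phi>) F"
  shows "((\<lambda>x. rad (h' x) (\<phi>' x)) \<longlongrightarrow> rad h \<phi>) F"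
proof (rule order_tendstoI)
  have ev: "\<forall>\<^sub>F x in F. ham_min < h' x" using order_tendstoD(1)[OF h' h] .
  have hc: "((\<lambda>x. ham (a + of_real b * cis (\<phi>' x))) \<longlongrightarrow> ham (a + of_real b * cis \<phi>)) F" for b
    by (intro isCont_tendsto_compose[OF isCont_ham] tendsto_intros \<phi>'
        isCont_tendsto_compose[OF _ \<phi>', of cis] continuous_intros)
  have diff: "((\<lambda>x. h' x - ham (a + of_real b * cis (\<phi>' x))) \<longlongrightarrow> h - ham (a + of_real b * cis \<phi>)) F" for b
    by (intro tendsto_diff h' hc)
  fix b
  {
    assume b: "b < rad h \<phi>"
    show "\<forall>\<^sub>F x in F. b < rad (h' x) (\<phi>' x)"
    proof (cases "b \<le> 0")
      case True
      show ?thesis using ev by (rule eventually_mono) (use True rad_pos in \<open>force intro: le_less_trans\<close>)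
    next
      case False
      then have "ham (a + of_real b * cis \<phi>) < h"
        using b ham_ray_less_iff[of b "rad h \<phi>" \<phi>] ham_pol[OF h, of \<phi>] by (simp add: pol_def)
      then have "\<forall>\<^sub>F x in F. 0 < h' x - ham (a + of_real b * cis (\<phi>' x))"
        using order_tendstoD(1)[OF diff, of 0 b] by simp
      then show ?thesis using ev
      proof eventually_elim
        case (elim x)
        then show ?case
          using ham_ray_less_iff[of b "rad (h' x) (\<phi>' x)" "\<phi>' x"] ham_pol[of "h' x" "\<phi>' x"]
            rad_pos[of "h' x" "\<phi>' x"] False by (simp add: pol_def)
      qed
    qed
  next
    assume b: "rad h \<phi> < b"
    have b0: "0 < b" using b rad_pos[OF h, of \<phi>] by simp
    then have "h < ham (a + of_real b * cis \<phi>)"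
      using b ham_ray_less_iff[of "rad h \<phi>" b \<phi>] ham_pol[OF h, of \<phi>] rad_pos[OF h, of \<phi>]
      by (simp add: pol_def)
    then have "\<forall>\<^sub>F x in F. h' x - ham (a + of_real b * cis (\<phi>' x)) < 0"
      using order_tendstoD(2)[OF diff, of b 0] by simp
    then show "\<forall>\<^sub>F x in F. rad (h' x) (\<phi>' x) < b" using ev
    proof eventually_elim
      case (elim x)
      then show ?case
        using ham_ray_less_iff[of "rad (h' x) (\<phi>' x)" b "\<phi>' x"] ham_pol[of "h' x" "\<phi>' x"]
          rad_pos[of "h' x" "\<phi>' x"] b0 by (simp add: pol_def)
    qed
  }
qed

lemma tendsto_pol:
  assumes "ham_min < h" "(h' \<longlongrightarrow> h) F" "(\<phi>' \<longlongrightarrow> \<phi>) F"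
  shows "((\<lambda>x. pol (h' x) (\<phi>' x)) \<longlongrightarrow> pol h \<phi>) F"
  unfolding pol_def
  by (intro tendsto_intros tendsto_rad assms isCont_tendsto_compose[OF _ assms(3), of cis]
      continuous_intros)

text \<open>As seen from \<open>a\<close> the origin lies in direction \<pi>, so a zero of
  \<open>pol\<close> requires \<open>cis \<phi> = - 1\<close>.\<close>

lemma finite_zeros_pol:
  assumes "ham_min < h"
  shows "finite {\<phi>\<in>{p..q}. pol h \<phi> = 0}"
proof (rule finite_subset)
  show "{\<phi>\<in>{p..q}. pol h \<phi> = 0} \<subseteq> {\<phi>\<in>{p..q}. cis \<phi> + 1 = 0}"
  proof clarify
    fix \<phi> assume "pol h \<phi> = 0"
    then have eq: "of_real (rad h \<phi>) * cis \<phi> = - complex_of_real a"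
      by (simp add: pol_def add_eq_0_iff2)
    then have "cmod (of_real (rad h \<phi>) * cis \<phi>) = a" using a_pos by simp
    then have "rad h \<phi> = a" using rad_pos[OF assms, of \<phi>] by (simp add: norm_mult)
    then have "of_real a * (cis \<phi> + 1) = 0" using eq by (simp add: algebra_simps)
    then show "cis \<phi> + 1 = 0" using a_pos by simp
  qed
  have "((\<lambda>\<phi>. cis \<phi> + 1) has_vector_derivative \<i> * cis \<phi>) (at \<phi>)" for \<phi>
    using cis_real_derivative[of "\<lambda>x. x" 1 \<phi> UNIV] by (auto intro!: derivative_eq_intros)
  then show "finite {\<phi>\<in>{p..q}. cis \<phi> + 1 = 0}"
    by (rule finite_zeros_regular) auto
qed

end

context attractive_curvature
begin

subsection \<open>Time along a level curve\<close>

text \<open>This is dt/d\<phi> along an orbit: under the field \<open>\<i> * grad\<close> the polar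
  angle about \<open>a\<close> moves with speed \<open>rad_slope\<close> divided by the square of
  \<open>rad\<close>.\<close>

definition weight :: "real \<Rightarrow> real \<Rightarrow> real" where
  "weight h \<phi> = (rad h \<phi>)\<^sup>2 / rad_slope (pol h \<phi>)"

lemma weight_bounds:
  assumes "ham_min < h"
  shows "(rad h \<phi>)\<^sup>2 / slope_upper (pol h \<phi>) \<le> weight h \<phi>"
    and "weight h \<phi> \<le> (rad h \<phi>)\<^sup>2 / slope_lower (pol h \<phi>)"
    and "0 < weight h \<phi>"
proof -
  have p: "pol h \<phi> \<noteq> of_real a" using pol_neq[OF assms] .
  note b = rad_slope_bounds[of "pol h \<phi>"] slope_lower_pos[OF p] rad_slope_pos[OF p]
  show "(rad h \<phi>)\<^sup>2 / slope_upper (pol h \<phi>) \<le> weight h \<phi>"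
    "weight h \<phi> \<le> (rad h \<phi>)\<^sup>2 / slope_lower (pol h \<phi>)"
    unfolding weight_def using b slope_upper_pos by (auto intro!: divide_left_mono mult_pos_pos)
  show "0 < weight h \<phi>" unfolding weight_def using b rad_pos[OF assms, of \<phi>] by simp
qed

lemma tendsto_weight:
  assumes "ham_min < h" "pol h \<phi> \<noteq> 0" "(h' \<longlongrightarrow> h) F" "(\<phi>' \<longlongrightarrow> \<phi>) F"
  shows "((\<lambda>x. weight (h' x) (\<phi>' x)) \<longlongrightarrow> weight h \<phi>) F"
  unfolding weight_def
  using rad_slope_pos[OF pol_neq[OF assms(1)], of \<phi>]
  by (intro tendsto_intros tendsto_rad assms
      isCont_tendsto_compose[OF isCont_rad_slope[OF assms(2)] tendsto_pol[OF assms(1,3,4)]]) simp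

text \<open>The weight lies between two positive continuous functions of (h, \<phi>). Hence the
  bounds hold across level 0 as well, where the weight itself may be discontinuous.\<close>

lemma weight_locally_bounded:
  assumes "compact K" "\<And>h. h \<in> K \<Longrightarrow> ham_min < h"
  shows "\<exists>B. \<forall>h\<in>K. \<forall>\<phi>\<in>{p..q}. weight h \<phi> \<le> B"
    and "\<exists>b>0. \<forall>h\<in>K. \<forall>\<phi>\<in>{p..q}. b \<le> weight h \<phi>"
proof -
  have c1: "continuous_on (K \<times> {p..q}) (\<lambda>x. rad (fst x) (snd x))"
    unfolding continuous_on
    by (intro ballI tendsto_rad tendsto_intros) (use assms in auto)
  have c2: "continuous_on (K \<times> {p..q}) (\<lambda>x. pol (fst x) (snd x))"
    unfolding continuous_on
    by (intro ballI tendsto_pol tendsto_intros) (use assms in auto)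
  have comp: "compact (K \<times> {p..q})" using assms(1) by (intro compact_Times) auto
  have sl: "continuous_on UNIV slope_lower" "continuous_on UNIV slope_upper"
    using isCont_slope_lower isCont_slope_upper by (auto simp: continuous_at_imp_continuous_on)
  have "continuous_on (K \<times> {p..q})
      (\<lambda>x. (rad (fst x) (snd x))\<^sup>2 / slope_lower (pol (fst x) (snd x)))"
    by (intro continuous_intros c1 continuous_on_compose2[OF sl(1) c2] ballI less_imp_neq[symmetric]
        slope_lower_pos pol_neq assms(2)) auto
  from compact_imp_bounded[OF compact_continuous_image[OF this comp]]
  obtain B where B: "\<And>h \<phi>. h \<in> K \<Longrightarrow> \<phi> \<in> {p..q} \<Longrightarrow> \<bar>(rad h \<phi>)\<^sup>2 / slope_lower (pol h \<phi>)\<bar> \<le> B"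
    unfolding bounded_iff by force
  have "weight h \<phi> \<le> B" if "h \<in> K" "\<phi> \<in> {p..q}" for h \<phi>
    using B[OF that] weight_bounds(2)[OF assms(2)[OF that(1)], of \<phi>] by linarith
  then show "\<exists>B. \<forall>h\<in>K. \<forall>\<phi>\<in>{p..q}. weight h \<phi> \<le> B" by blast
  have cu: "continuous_on (K \<times> {p..q})
      (\<lambda>x. (rad (fst x) (snd x))\<^sup>2 / slope_upper (pol (fst x) (snd x)))"
    by (intro continuous_intros c1 continuous_on_compose2[OF sl(2) c2] ballI less_imp_neq[symmetric]
        slope_upper_pos) auto
  show "\<exists>b>0. \<forall>h\<in>K. \<forall>\<phi>\<in>{p..q}. b \<le> weight h \<phi>"
  proof (cases "K \<times> {p..q} = {}")
    case True
    then show ?thesis by (intro exI[of _ 1]) auto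
  next
    case False
    obtain y where y: "y \<in> K \<times> {p..q}" "\<And>x. x \<in> K \<times> {p..q} \<Longrightarrow>
       (rad (fst y) (snd y))\<^sup>2 / slope_upper (pol (fst y) (snd y))
        \<le> (rad (fst x) (snd x))\<^sup>2 / slope_upper (pol (fst x) (snd x))"
      using continuous_attains_inf[OF comp False cu] by blast
    let ?b = "(rad (fst y) (snd y))\<^sup>2 / slope_upper (pol (fst y) (snd y))"
    have "0 < rad (fst y) (snd y)" using y(1) assms(2) by (intro rad_pos) auto
    then have "0 < ?b" using slope_upper_pos by simp
    moreover have "?b \<le> weight h \<phi>" if "h \<in> K" "\<phi> \<in> {p..q}" for h \<phi>
      using y(2)[of "(h, \<phi>)"] that weight_bounds(1)[OF assms(2)[OF that(1)], of \<phi>] by auto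
    ultimately show ?thesis by blast
  qed
qed

text \<open>The level curve through \<open>0\<close> is the only one on which the weight may be discontinuous; its
  integrals are limits of those over neighbouring level curves.\<close>

lemma weight_integral_limit:
  assumes h: "ham_min < h" and h': "\<And>k. ham_min < h' k" "h' \<longlonglongrightarrow> h"
    and int: "\<And>k. weight (h' k) integrable_on {p..q}"
  shows "weight h integrable_on {p..q}"
    and "(\<lambda>k. integral {p..q} (weight (h' k))) \<longlonglongrightarrow> integral {p..q} (weight h)"
proof -
  let ?N = "{\<phi>\<in>{p..q}. pol h \<phi> = 0}"
  let ?S = "{p..q} - ?N"
  have N: "negligible ?N" using finite_zeros_pol[OF h] by blast
  have spike: "g integrable_on ?S \<longleftrightarrow> g integrable_on {p..q}" "integral ?S g = integral {p..q} g"
    for g :: "real \<Rightarrow> real"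
    by (rule integrable_spike_set_eq integral_spike_set; rule negligible_subset[OF N]; blast)+
  obtain B where B: "\<And>k \<phi>. \<phi> \<in> {p..q} \<Longrightarrow> weight (h' k) \<phi> \<le> B"
    using weight_locally_bounded(1)[OF compact_sequence_with_limit[OF h'(2)], of p q] h h'(1) by blast
  have *: "(\<lambda>k. weight (h' k) \<phi>) \<longlonglongrightarrow> weight h \<phi>" if "\<phi> \<in> ?S" for \<phi>
    by (rule tendsto_weight) (use that h h' in auto)
  have le: "norm (weight (h' k) \<phi>) \<le> B" if "\<phi> \<in> ?S" for k \<phi>
    using B[of \<phi> k] weight_bounds(3)[OF h'(1), of k \<phi>] that by auto
  have B': "(\<lambda>_. B) integrable_on ?S" unfolding spike by auto
  have int': "weight (h' k) integrable_on ?S" for k using int spike by blast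
  from dominated_convergence[OF int' B' le *]
  show "weight h integrable_on {p..q}"
    "(\<lambda>k. integral {p..q} (weight (h' k))) \<longlonglongrightarrow> integral {p..q} (weight h)"
    unfolding spike by auto
qed

lemma weight_integrable:
  assumes "ham_min < h"
  shows "weight h integrable_on {p..q}"
proof -
  have *: "weight h integrable_on {p..q}" if "ham_min < h" "h \<noteq> 0" for h
  proof (rule integrable_continuous_real)
    have "pol h \<phi> \<noteq> 0" for \<phi> using ham_pol[OF that(1), of \<phi>] that(2) ham_0 by auto
    then show "continuous_on {p..q} (weight h)"
      unfolding continuous_on by (intro ballI tendsto_weight tendsto_intros that)
  qed
  show ?thesis
  proof (cases "h = 0")
    case True
    \<comment> \<open>The levels 1/(k+1) differ from 0 and tend to it, so integrability passes to
      the limit.\<close>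
    have "ham_min < 0 + 1 / real (Suc k)" for k
      using ham_min_neg by (simp add: add_pos_pos less_trans)
    moreover have "(\<lambda>k. 0 + 1 / real (Suc k)) \<longlonglongrightarrow> 0 + 0"
      by (intro tendsto_intros LIMSEQ_Suc[OF lim_1_over_n])
    ultimately show ?thesis
      using weight_integral_limit(1)[of h "\<lambda>k. 0 + 1 / real (Suc k)" p q] * assms True by auto
  qed (use * assms in auto)
qed

section \<open>Time as a function of the polar angle\<close>

definition tau :: "real \<Rightarrow> real \<Rightarrow> real" where
  "tau h \<phi> = integral {0..\<phi>} (weight h) - integral {\<phi>..0} (weight h)"

definition per :: "real \<Rightarrow> real" where "per h = tau h (2 * pi)"

lemma tau_0: "tau h 0 = 0" by (simp add: tau_def)

lemma tau_diff:
  assumes "ham_min < h" "p \<le> q"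
  shows "tau h q - tau h p = integral {p..q} (weight h)"
proof -
  note int = weight_integrable[OF assms(1)]
  note comb = Henstock_Kurzweil_Integration.integral_combine[OF _ _ int]
  have z: "integral {u..v} (weight h) = 0" if "v \<le> u" for u v
    using that by (cases "u = v") auto
  consider "0 \<le> p" | "p \<le> 0" "0 \<le> q" | "q \<le> 0" using assms by linarith
  then show ?thesis
  proof cases
    case 1
    then show ?thesis using assms comb[of 0 p q] z by (simp add: tau_def)
  next
    case 2
    then show ?thesis using comb[of p 0 q] z by (simp add: tau_def)
  next
    case 3
    then show ?thesis using assms comb[of p q 0] z by (simp add: tau_def)
  qed
qed

text \<open>Only the bounds of the weight enter, so this covers level 0, where \<open>tau\<close>
  may fail to be differentiable at the zeros of \<open>pol\<close>. Strict monotonicity and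
  continuity of \<open>tau\<close> both follow.\<close>

lemma tau_increments:
  assumes "ham_min < h"
  shows "\<exists>b>0. \<exists>B. \<forall>x y. p \<le> x \<longrightarrow> x \<le> y \<longrightarrow> y \<le> q \<longrightarrow>
           b * (y - x) \<le> tau h y - tau h x \<and> tau h y - tau h x \<le> B * (y - x)"
proof -
  obtain B where B: "\<forall>\<phi>\<in>{p..q}. weight h \<phi> \<le> B"
    using weight_locally_bounded(1)[of "{h}" p q] assms by auto
  obtain b where b: "0 < b" "\<forall>\<phi>\<in>{p..q}. b \<le> weight h \<phi>"
    using weight_locally_bounded(2)[of "{h}" p q] assms by auto
  have "b * (y - x) \<le> tau h y - tau h x \<and> tau h y - tau h x \<le> B * (y - x)"
    if "p \<le> x" "x \<le> y" "y \<le> q" for x y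
  proof -
    have c: "(\<lambda>_. r) integrable_on {x..y}" for r :: real by (rule integrable_const_ivl)
    have "integral {x..y} (\<lambda>_. b) \<le> integral {x..y} (weight h)"
      by (rule integral_le[OF c weight_integrable[OF assms]]) (use that b(2) in simp)
    moreover have "integral {x..y} (weight h) \<le> integral {x..y} (\<lambda>_. B)"
      by (rule integral_le[OF weight_integrable[OF assms] c]) (use that B in simp)
    ultimately show ?thesis using tau_diff[OF assms that(2)] that(2) by (simp add: mult.commute)
  qed
  with b(1) show ?thesis by blast
qed

lemma tau_strict_mono: "ham_min < h \<Longrightarrow> \<phi> < \<psi> \<Longrightarrow> tau h \<phi> < tau h \<psi>"
proof -
  assume h: "ham_min < h" and less: "\<phi> < \<psi>"
  obtain b where b: "0 < b" "b * (\<psi> - \<phi>) \<le> tau h \<psi> - tau h \<phi>"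
    using tau_increments[OF h, of \<phi> \<psi>] less by (meson order.refl less_imp_le)
  moreover have "0 < b * (\<psi> - \<phi>)" using b less by simp
  ultimately show ?thesis by linarith
qed

lemma tau_less_iff: "ham_min < h \<Longrightarrow> tau h \<phi> < tau h \<psi> \<longleftrightarrow> \<phi> < \<psi>"
  using tau_strict_mono[of h \<phi> \<psi>] tau_strict_mono[of h \<psi> \<phi>] by (cases \<phi> \<psi> rule: linorder_cases) auto

lemma isCont_tau:
  assumes "ham_min < h"
  shows "isCont (tau h) \<phi>"
proof -
  obtain b B where "0 < b" and *: "\<forall>x y. \<phi> - 1 \<le> x \<longrightarrow> x \<le> y \<longrightarrow> y \<le> \<phi> + 1 \<longrightarrow>
      b * (y - x) \<le> tau h y - tau h x \<and> tau h y - tau h x \<le> B * (y - x)"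
    using tau_increments[OF assms, of "\<phi> - 1" "\<phi> + 1"] by (elim exE conjE)
  note B = \<open>0 < b\<close> *[rule_format]
  have "\<bar>tau h x - tau h \<phi>\<bar> \<le> B * \<bar>x - \<phi>\<bar>" if "\<bar>x - \<phi>\<bar> < 1" for x
  proof (cases "x \<le> \<phi>")
    case True
    then have "0 \<le> b * (\<phi> - x)" using B(1) by simp
    then show ?thesis using B(2)[of x \<phi>] True that by (auto simp: abs_if)
  next
    case False
    then have "0 \<le> b * (x - \<phi>)" using B(1) by simp
    then show ?thesis using B(2)[of \<phi> x] False that by (auto simp: abs_if)
  qed
  then have "\<forall>\<^sub>F x in at \<phi>. norm (tau h x - tau h \<phi>) \<le> B * \<bar>x - \<phi>\<bar>"
    unfolding eventually_at by (intro exI[of _ 1]) (auto simp: dist_real_def)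
  moreover have "((\<lambda>x. B * \<bar>x - \<phi>\<bar>) \<longlongrightarrow> B * \<bar>\<phi> - \<phi>\<bar>) (at \<phi>)" by (intro tendsto_intros)
  then have "((\<lambda>x. B * \<bar>x - \<phi>\<bar>) \<longlongrightarrow> 0) (at \<phi>)" by simp
  ultimately have "((\<lambda>x. tau h x - tau h \<phi>) \<longlongrightarrow> 0) (at \<phi>)" by (rule Lim_null_comparison)
  then show ?thesis unfolding isCont_def by (rule LIM_zero_cancel)
qed

lemma tau_derivative:
  assumes "ham_min < h" "pol h \<phi> \<noteq> 0"
  shows "(tau h has_real_derivative weight h \<phi>) (at \<phi>)"
proof -
  have "isCont (weight h) \<phi>"
    unfolding isCont_def by (intro tendsto_weight assms tendsto_intros)
  then have "((\<lambda>u. integral {\<phi> - 1..u} (weight h)) has_vector_derivative weight h \<phi>)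
      (at \<phi> within ({\<phi> - 1..\<phi> + 1} - {}))"
    by (intro integral_has_vector_derivative_continuous_at weight_integrable assms)
      (auto intro: continuous_at_imp_continuous_at_within)
  then have "((\<lambda>u. integral {\<phi> - 1..u} (weight h)) has_vector_derivative weight h \<phi>) (at \<phi>)"
    using at_within_interior[of \<phi> "{\<phi> - 1..\<phi> + 1}"] by simp
  then have "((\<lambda>u. integral {\<phi> - 1..u} (weight h) + tau h (\<phi> - 1)) has_vector_derivative weight h \<phi>) (at \<phi>)"
    by (auto intro!: derivative_eq_intros)
  then have "(tau h has_vector_derivative weight h \<phi>) (at \<phi>)"
  proof (rule has_vector_derivative_transform_within_open[of _ _ _ "{\<phi> - 1<..}"])
    fix u assume "u \<in> {\<phi> - 1<..}"
    then show "integral {\<phi> - 1..u} (weight h) + tau h (\<phi> - 1) = tau h u"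
      using tau_diff[OF assms(1), of "\<phi> - 1" u] by simp
  qed auto
  then show ?thesis by (simp add: has_real_derivative_iff_has_vector_derivative)
qed

lemma weight_cong: "cis \<phi> = cis \<psi> \<Longrightarrow> weight h \<phi> = weight h \<psi>"
  using rad_cis_cong[of \<phi> \<psi> h] pol_cis_cong[of \<phi> \<psi> h] by (simp add: weight_def)

lemma weight_uminus: "ham_min < h \<Longrightarrow> weight h (- \<phi>) = weight h \<phi>"
  by (simp add: weight_def rad_uminus pol_uminus rad_slope_def grad_def inner_complex_def)

lemma tau_periodic:
  assumes "ham_min < h"
  shows "tau h (\<phi> + 2 * pi) = tau h \<phi> + per h"
proof -
  have *: "tau h (\<psi> + 2 * pi) - tau h (\<phi> + 2 * pi) = tau h \<psi> - tau h \<phi>" if "\<phi> \<le> \<psi>" for \<phi> \<psi>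
  proof -
    have "weight h (x + 2 * pi) = weight h x" for x
      by (rule weight_cong) (simp add: cis.ctr)
    then show ?thesis
      using integral_shift_real_ivl[of "\<phi> + 2 * pi" "2 * pi" "\<psi> + 2 * pi" "weight h"]
        tau_diff[OF assms, of \<phi> \<psi>] tau_diff[OF assms, of "\<phi> + 2 * pi" "\<psi> + 2 * pi"] that by simp
  qed
  show ?thesis using *[of 0 \<phi>] *[of \<phi> 0] by (cases "0 \<le> \<phi>") (auto simp: per_def tau_0)
qed

lemma tau_uminus:
  assumes "ham_min < h"
  shows "tau h (- \<phi>) = - tau h \<phi>"
proof -
  have "weight h = (\<lambda>x. weight h (- x))" using weight_uminus[OF assms] by simp
  then have "integral {u..v} (weight h) = integral {- v..- u} (weight h)" for u v
    using Henstock_Kurzweil_Integration.integral_reflect_real[of v u "weight h"] by metis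
  from this[of 0 "- \<phi>"] this[of "- \<phi>" 0] show ?thesis by (simp add: tau_def)
qed

lemma per_pos: "ham_min < h \<Longrightarrow> 0 < per h"
  using tau_strict_mono[of h 0 "2 * pi"] by (simp add: per_def tau_0)

lemma tau_periodic_int:
  assumes "ham_min < h"
  shows "tau h (\<phi> + 2 * pi * of_int k) = tau h \<phi> + of_int k * per h"
proof -
  have nat: "tau h (\<phi> + 2 * pi * real n) = tau h \<phi> + real n * per h" for n \<phi>
  proof (induction n)
    case (Suc n)
    then show ?case using tau_periodic[OF assms, of "\<phi> + 2 * pi * real n"] by (simp add: algebra_simps)
  qed simp
  show ?thesis
  proof (cases "0 \<le> k")
    case True
    then show ?thesis using nat[of \<phi> "nat k"] by simp
  next
    case False
    then show ?thesis using nat[of "\<phi> + 2 * pi * of_int k" "nat (- k)"] by simp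
  qed
qed

lemma tau_pi: "ham_min < h \<Longrightarrow> tau h pi = per h / 2"
  using tau_uminus[of h pi] tau_periodic[of h "- pi"] by simp

lemma isCont_tau_level:
  assumes "ham_min < h"
  shows "isCont (\<lambda>h. tau h \<phi>) h"
proof -
  have "continuous_on {ham_min<..} (\<lambda>h. integral {p..q} (weight h))" for p q
  proof (rule continuous_on_sequentiallyI)
    fix u h assume "\<forall>n. u n \<in> {ham_min<..}" "h \<in> {ham_min<..}" "u \<longlonglongrightarrow> h"
    then show "(\<lambda>n. integral {p..q} (weight (u n))) \<longlonglongrightarrow> integral {p..q} (weight h)"
      using weight_integral_limit(2)[of h u p q] weight_integrable by auto
  qed
  then have "continuous_on {ham_min<..} (\<lambda>h. tau h \<phi>)"
    unfolding tau_def by (intro continuous_intros)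
  then show ?thesis using assms by (simp add: continuous_on_eq_continuous_at)
qed

text \<open>Monotonicity in the angle replaces the moving angle by a fixed one close to \<phi>,
  after which continuity in the level alone suffices.\<close>

lemma tendsto_tau:
  assumes h: "ham_min < h" and h': "(h' \<longlongrightarrow> h) F" and \<phi>': "(\<phi>' \<longlongrightarrow> \<phi>) F"
  shows "((\<lambda>x. tau (h' x) (\<phi>' x)) \<longlongrightarrow> tau h \<phi>) F"
proof (rule order_tendstoI)
  have ev: "\<forall>\<^sub>F x in F. ham_min < h' x" using order_tendstoD(1)[OF h' h] .
  have th: "((\<lambda>x. tau (h' x) p) \<longlongrightarrow> tau h p) F" for p
    by (rule isCont_tendsto_compose[OF isCont_tau_level[OF h] h'])
  have tl: "(tau h \<longlongrightarrow> tau h \<phi>) (at_left \<phi>)" "(tau h \<longlongrightarrow> tau h \<phi>) (at_right \<phi>)"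
    using isCont_tau[OF h, of \<phi>] by (auto simp: isCont_def intro: filterlim_mono at_le)
  fix b
  {
    assume "b < tau h \<phi>"
    then have "\<forall>\<^sub>F p in at_left \<phi>. b < tau h p" using order_tendstoD(1)[OF tl(1)] by blast
    moreover have "\<forall>\<^sub>F p in at_left \<phi>. p < \<phi>" by (auto simp: eventually_at_filter)
    ultimately have "\<forall>\<^sub>F p in at_left \<phi>. b < tau h p \<and> p < \<phi>" by (rule eventually_conj)
    then obtain p where p: "b < tau h p" "p < \<phi>"
      using eventually_happens[of _ "at_left \<phi>"] trivial_limit_at_left_real by blast
    show "\<forall>\<^sub>F x in F. b < tau (h' x) (\<phi>' x)"
      using order_tendstoD(1)[OF th p(1)] order_tendstoD(1)[OF \<phi>' p(2)] ev
    proof eventually_elim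
      case (elim x)
      then show ?case using tau_strict_mono[OF elim(3,2)] by simp
    qed
  next
    assume "tau h \<phi> < b"
    then have "\<forall>\<^sub>F p in at_right \<phi>. tau h p < b" using order_tendstoD(2)[OF tl(2)] by blast
    moreover have "\<forall>\<^sub>F p in at_right \<phi>. \<phi> < p" by (auto simp: eventually_at_filter)
    ultimately have "\<forall>\<^sub>F p in at_right \<phi>. tau h p < b \<and> \<phi> < p" by (rule eventually_conj)
    then obtain p where p: "tau h p < b" "\<phi> < p"
      using eventually_happens[of _ "at_right \<phi>"] trivial_limit_at_right_real by blast
    show "\<forall>\<^sub>F x in F. tau (h' x) (\<phi>' x) < b"
      using order_tendstoD(2)[OF th p(1)] order_tendstoD(2)[OF \<phi>' p(2)] ev
    proof eventually_elim
      case (elim x)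
      then show ?case using tau_strict_mono[OF elim(3,2)] by simp
    qed
  }
qed

section \<open>The polar angle as a function of time\<close>

definition phase :: "real \<Rightarrow> real \<Rightarrow> real" where "phase h t = (THE \<phi>. tau h \<phi> = t)"

lemma tau_inj: "ham_min < h \<Longrightarrow> tau h \<phi> = tau h \<psi> \<Longrightarrow> \<phi> = \<psi>"
  using tau_less_iff[of h \<phi> \<psi>] tau_less_iff[of h \<psi> \<phi>] by linarith

lemma phase_tau: "ham_min < h \<Longrightarrow> phase h (tau h \<phi>) = \<phi>"
  unfolding phase_def using tau_inj by blast

lemma tau_phase:
  assumes "ham_min < h"
  shows "tau h (phase h t) = t"
proof -
  obtain n :: nat where n: "\<bar>t\<bar> < real n * per h"
    using ex_less_of_nat_mult[OF per_pos[OF assms]] by blast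
  have "tau h (2 * pi * of_int (int n)) = real n * per h" "tau h (2 * pi * of_int (- int n)) = - real n * per h"
    using tau_periodic_int[OF assms, of 0 "int n"] tau_periodic_int[OF assms, of 0 "- int n"] by (simp_all add: tau_0)
  then have "\<exists>\<phi>\<ge>2 * pi * of_int (- int n). \<phi> \<le> 2 * pi * of_int (int n) \<and> tau h \<phi> = t"
    using n isCont_tau[OF assms]
    by (intro IVT') (auto simp: continuous_at_imp_continuous_on)
  then show ?thesis using phase_tau[OF assms] by auto
qed

lemma phase_less_iff: "ham_min < h \<Longrightarrow> phase h t < \<phi> \<longleftrightarrow> t < tau h \<phi>"
  "ham_min < h \<Longrightarrow> \<phi> < phase h t \<longleftrightarrow> tau h \<phi> < t"
  using tau_less_iff[of h "phase h t" \<phi>] tau_less_iff[of h \<phi> "phase h t"] tau_phase[of h t] by auto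

lemma phase_0: "ham_min < h \<Longrightarrow> phase h 0 = 0" using phase_tau[of h 0] by (simp add: tau_0)

lemma phase_half: "ham_min < h \<Longrightarrow> phase h (per h / 2) = pi" using phase_tau[of h pi] by (simp add: tau_pi)

lemma phase_uminus: "ham_min < h \<Longrightarrow> phase h (- t) = - phase h t"
  using tau_inj[of h "phase h (- t)" "- phase h t"] tau_phase[of h] tau_uminus[of h] by simp

lemma phase_periodic: "ham_min < h \<Longrightarrow> phase h (t + of_int k * per h) = phase h t + 2 * pi * of_int k"
  using tau_inj[of h "phase h (t + of_int k * per h)" "phase h t + 2 * pi * of_int k"] tau_phase[of h]
    tau_periodic_int[of h] by simp

text \<open>\<open>b < phase h t\<close> amounts to \<open>tau h b < t\<close>, an open condition on
  (h, t) because \<open>tau\<close> is continuous in the level.\<close>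

lemma tendsto_phase:
  assumes h: "ham_min < h" and h': "(h' \<longlongrightarrow> h) F" and t': "(t' \<longlongrightarrow> t) F"
  shows "((\<lambda>x. phase (h' x) (t' x)) \<longlongrightarrow> phase h t) F"
proof (rule order_tendstoI)
  have ev: "\<forall>\<^sub>F x in F. ham_min < h' x" using order_tendstoD(1)[OF h' h] .
  have diff: "((\<lambda>x. t' x - tau (h' x) p) \<longlongrightarrow> t - tau h p) F" for p
    by (intro tendsto_diff t' isCont_tendsto_compose[OF isCont_tau_level[OF h] h'])
  fix b
  {
    assume "b < phase h t"
    then have "0 < t - tau h b" using phase_less_iff[OF h] by simp
    from order_tendstoD(1)[OF diff this] ev show "\<forall>\<^sub>F x in F. b < phase (h' x) (t' x)"
      by eventually_elim (simp add: phase_less_iff)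
  next
    assume "phase h t < b"
    then have "t - tau h b < 0" using phase_less_iff[OF h] by simp
    from order_tendstoD(2)[OF diff this] ev show "\<forall>\<^sub>F x in F. phase (h' x) (t' x) < b"
      by eventually_elim (simp add: phase_less_iff)
  }
qed

subsection \<open>The orbits\<close>

text \<open>The orbit starts at the far real point of the level curve, where the modulus is largest,
  and reaches the near real point, where it is smallest, after half a period.\<close>

definition zeta :: "real \<Rightarrow> real \<Rightarrow> complex" where "zeta h t = pol h (phase h t)"

lemma ham_zeta: "ham_min < h \<Longrightarrow> ham (zeta h t) = h"
  by (simp add: zeta_def ham_pol)

lemma zeta_neq: "ham_min < h \<Longrightarrow> zeta h t \<noteq> of_real a"
  by (simp add: zeta_def pol_neq)

lemma Re_zeta: "ham_min < h \<Longrightarrow> Re (zeta h t) = prim (cmod (zeta h t)) - h"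
  using ham_zeta[of h t] by (simp add: ham_def)

lemma tendsto_zeta:
  assumes "ham_min < h" "(h' \<longlongrightarrow> h) F" "(t' \<longlongrightarrow> t) F"
  shows "((\<lambda>x. zeta (h' x) (t' x)) \<longlongrightarrow> zeta h t) F"
  unfolding zeta_def by (intro tendsto_pol tendsto_phase assms)

lemma isCont_zeta: "ham_min < h \<Longrightarrow> isCont (zeta h) t"
  unfolding isCont_def by (intro tendsto_zeta tendsto_intros)

lemma continuous_on_zeta: "ham_min < h \<Longrightarrow> continuous_on S (zeta h)"
  using isCont_zeta by (simp add: continuous_at_imp_continuous_on)

lemma zeta_uminus: "ham_min < h \<Longrightarrow> zeta h (- t) = cnj (zeta h t)"
  by (simp add: zeta_def phase_uminus pol_uminus)

lemma zeta_periodic: "ham_min < h \<Longrightarrow> zeta h (t + of_int k * per h) = zeta h t"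
  unfolding zeta_def by (rule pol_cis_cong) (simp add: phase_periodic cis_mult[symmetric])

lemma zeta_eq_iff:
  assumes "ham_min < h"
  shows "zeta h s = zeta h t \<longleftrightarrow> (\<exists>k::int. s = t + of_int k * per h)"
proof
  assume eq: "zeta h s = zeta h t"
  then have e: "of_real (rad h (phase h s)) * cis (phase h s) = complex_of_real (rad h (phase h t)) * cis (phase h t)"
    by (simp add: zeta_def pol_def)
  then have "cmod (of_real (rad h (phase h s)) * cis (phase h s)) = cmod (complex_of_real (rad h (phase h t)) * cis (phase h t))"
    by simp
  then have "rad h (phase h s) = rad h (phase h t)"
    using rad_pos[OF assms] by (simp add: norm_mult less_imp_le)
  with e have "cis (phase h s) = cis (phase h t)" using rad_pos[OF assms, of "phase h t"] by simp
  then have "exp (\<i> * phase h s) = exp (\<i> * phase h t)" by (simp add: cis_conv_exp)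
  then obtain n :: int where "\<i> * phase h s = \<i> * phase h t + (of_int (2 * n) * pi) * \<i>"
    using exp_eq by blast
  then have "Im (\<i> * phase h s) = Im (\<i> * phase h t + (of_int (2 * n) * pi) * \<i>)" by simp
  then have "phase h s = phase h t + 2 * pi * of_int n" by simp
  also have "\<dots> = phase h (t + of_int n * per h)" using phase_periodic[OF assms] by simp
  finally have "tau h (phase h s) = tau h (phase h (t + of_int n * per h))" by simp
  then show "\<exists>k::int. s = t + of_int k * per h" using tau_phase[OF assms] by auto
qed (use zeta_periodic[OF assms] in auto)

lemma zeta_surj:
  assumes "z \<noteq> of_real a"
  shows "\<exists>t. zeta (ham z) t = z"
proof -
  define \<phi> where "\<phi> = Arg (z - of_real a)"
  have "z = a + of_real (cmod (z - of_real a)) * cis \<phi>"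
    unfolding \<phi>_def using rcis_cmod_Arg[of "z - of_real a"] by (simp add: rcis_def)
  then have "pol (ham z) \<phi> = z" using assms by (intro pol_ham) auto
  then have "zeta (ham z) (tau (ham z) \<phi>) = z"
    using phase_tau[OF ham_gt_min[OF assms]] by (simp add: zeta_def)
  then show ?thesis by blast
qed

text \<open>\<open>pol\<close> is the inverse of the coordinate map \<open>z \<mapsto> (ham z, arg (z - a))\<close>, whose differential
  sends \<open>i grad z\<close> to a multiple of the second basis vector.\<close>

lemma pol_derivative:
  assumes h: "ham_min < h" and nz: "pol h \<phi> \<noteq> 0"
  shows "((\<lambda>\<phi>. pol h \<phi>) has_vector_derivative \<i> * grad (pol h \<phi>) * weight h \<phi>) (at \<phi>)"
proof -
  define z where "z = pol h \<phi>"
  define d where "d = z - of_real a"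
  define n where "n = grad z"
  have R: "0 < rad h \<phi>" using rad_pos[OF h] .
  have d_eq: "d = of_real (rad h \<phi>) * cis \<phi>" by (simp add: d_def z_def pol_def)
  have d0: "d \<noteq> 0" using R by (simp add: d_eq)
  have Q: "0 < d \<bullet> n" using rad_slope_pos[OF pol_neq[OF h], of \<phi>] by (simp add: rad_slope_def d_def n_def z_def)
  \<comment> \<open>The rotation by -\<phi> gives \<open>z\<close> the angle 0 and keeps it off the
    branch cut of the logarithm. \<open>N\<close> inverts the coordinate map \<open>M\<close>, and
    \<open>N'\<close> is the candidate for its differential.\<close>
  define M where "M w = Complex (ham w) (Im (ln ((w - of_real a) * cis (- \<phi>))))" for w
  define N where "N y = pol (Re y) (\<phi> + Im y)" for y
  define M' where "M' v = Complex (n \<bullet> v) (Im (v / d))" for v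
  define N' where "N' y = of_real (Re y / (d \<bullet> n)) * d + of_real (Im y * weight h \<phi>) * (\<i> * n)" for y
  have y0: "N (Complex h 0) = z" by (simp add: N_def z_def)
  have base: "(z - of_real a) * cis (- \<phi>) = of_real (rad h \<phi>)"
    using d_eq by (simp add: d_def cis_mult mult.assoc)
  have M: "(M has_derivative M') (at (N (Complex h 0)))"
  proof -
    have 1: "(ham has_derivative (\<lambda>v. n \<bullet> v)) (at z)"
      using ham_derivative nz by (simp add: n_def z_def)
    have "((\<lambda>w. ln ((w - of_real a) * cis (- \<phi>))) has_field_derivative
        (1 / ((z - of_real a) * cis (- \<phi>))) * cis (- \<phi>)) (at z)"
      using R by (auto intro!: derivative_eq_intros simp: base divide_inverse)
    moreover have "(1 / ((z - of_real a) * cis (- \<phi>))) * cis (- \<phi>) = 1 / d" by (simp add: d_def)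
    ultimately have 2: "((\<lambda>w. ln ((w - of_real a) * cis (- \<phi>))) has_derivative (\<lambda>v. v / d)) (at z)"
      by (simp add: has_field_derivative_def divide_inverse mult.commute mult_commute_abs)
    have "(M has_derivative (\<lambda>v. of_real (n \<bullet> v) + \<i> * of_real (Im (v / d)))) (at z)"
      unfolding M_def Complex_eq
      by (intro derivative_intros has_derivative_of_real bounded_linear.has_derivative[OF bounded_linear_Im] 1 2)
    moreover have "M' = (\<lambda>v. of_real (n \<bullet> v) + \<i> * of_real (Im (v / d)))"
      by (simp add: M'_def fun_eq_iff complex_eq_iff)
    ultimately show ?thesis unfolding y0 by simp
  qed
  \<comment> \<open>Only \<open>M\<close> is differentiated. For its inverse \<open>N\<close>
    continuity suffices, so no derivative of the implicitly defined \<open>rad\<close> is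
    needed.\<close>
  have "(N has_derivative N') (at (Complex h 0))"
  proof (rule has_derivative_inverse_basic[where f = M and g = N and f' = M', OF M])
    show "bounded_linear N'"
    proof -
      have "N' = (\<lambda>y. Re y *\<^sub>R (d / of_real (d \<bullet> n)) + Im y *\<^sub>R (of_real (weight h \<phi>) * (\<i> * n)))"
        by (simp add: N'_def fun_eq_iff scaleR_conv_of_real)
      then show ?thesis
        using bounded_linear_add[OF bounded_linear_compose[OF bounded_linear_scaleR_left bounded_linear_Re]
            bounded_linear_compose[OF bounded_linear_scaleR_left bounded_linear_Im]] by simp
    qed
    show "N' \<circ> M' = id"
    proof
      fix v
      have w: "weight h \<phi> = (cmod d)\<^sup>2 / (d \<bullet> n)"
        using R by (simp add: weight_def rad_slope_def d_eq n_def z_def pol_def norm_mult)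
      have im: "Im (v / d) = Im (v * cnj d) / (cmod d)\<^sup>2" 
        by (subst complex_div_cnj) (simp flip: of_real_power)
      have "Im (v / d) * weight h \<phi> = Im (v * cnj d) / (d \<bullet> n)"
        unfolding w im using d0 by simp
      then have "N' (M' v) = of_real ((n \<bullet> v) / (d \<bullet> n)) * d + of_real (Im (v * cnj d) / (d \<bullet> n)) * (\<i> * n)"
        by (simp add: N'_def M'_def)
      also have "\<dots> = (of_real (n \<bullet> v) * d + of_real (Im (v * cnj d)) * (\<i> * n)) / of_real (d \<bullet> n)"
        by (simp add: add_divide_distrib)
      \<comment> \<open>This decomposes \<open>v\<close> in the real basis \<open>d\<close>,
        \<open>\<i> * n\<close>: the inner product with \<open>n\<close> annihilates
        \<open>\<i> * n\<close>, and \<open>Im (v * cnj d)\<close> annihilates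
        \<open>d\<close>.\<close>
      also have "of_real (n \<bullet> v) * d + of_real (Im (v * cnj d)) * (\<i> * n) = of_real (d \<bullet> n) * v"
        by (simp add: complex_eq_iff inner_complex_def algebra_simps)
      finally show "(N' \<circ> M') v = id v" using Q by simp
    qed
    show "continuous (at (Complex h 0)) N"
      unfolding N_def isCont_def
      using tendsto_pol[OF h, of Re "at (Complex h 0)" "\<lambda>y. \<phi> + Im y" "\<phi> + 0"]
        tendsto_Re[OF tendsto_ident_at, of "Complex h 0" UNIV]
        tendsto_add[OF tendsto_const tendsto_Im[OF tendsto_ident_at, of "Complex h 0" UNIV], of \<phi>]
      by simp
    show "open ({y. ham_min < Re y} \<inter> {y. - pi < Im y} \<inter> {y. Im y < pi})"
      by (intro open_Int open_halfspace_Re_gt open_halfspace_Im_gt open_halfspace_Im_lt)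
    show "Complex h 0 \<in> {y. ham_min < Re y} \<inter> {y. - pi < Im y} \<inter> {y. Im y < pi}" using h by simp
    fix y assume y: "y \<in> {y. ham_min < Re y} \<inter> {y. - pi < Im y} \<inter> {y. Im y < pi}"
    let ?r = "rad (Re y) (\<phi> + Im y)"
    have r: "0 < ?r" using y by (intro rad_pos) auto
    have "(N y - of_real a) * cis (- \<phi>) = of_real ?r * cis (Im y)"
      by (simp add: N_def pol_def cis_mult mult.assoc)
    also have "of_real ?r = exp (complex_of_real (ln ?r))"
      using r exp_of_real[of "ln ?r", where ?'a = complex] by (simp only: exp_ln)
    also have "\<dots> * cis (Im y) = exp (of_real (ln ?r) + \<i> * of_real (Im y))"
      by (simp only: exp_add cis_conv_exp)
    finally have "ln ((N y - of_real a) * cis (- \<phi>)) = of_real (ln ?r) + \<i> * of_real (Im y)"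
      using y by simp
    then show "M (N y) = y" using y by (simp add: M_def N_def ham_pol complex_eq_iff)
  qed
  moreover have "((\<lambda>\<psi>. Complex h (\<psi> - \<phi>)) has_derivative (\<lambda>k. of_real k * \<i>)) (at \<phi>)"
    unfolding Complex_eq by (auto intro!: derivative_eq_intros)
  moreover have "Complex h (\<phi> - \<phi>) = Complex h 0" by simp
  ultimately have "((\<lambda>\<psi>. N (Complex h (\<psi> - \<phi>))) has_derivative (\<lambda>k. N' (of_real k * \<i>))) (at \<phi>)"
    using has_derivative_compose[of "\<lambda>\<psi>. Complex h (\<psi> - \<phi>)" _ \<phi> UNIV N N'] by metis
  then show ?thesis
    by (simp add: has_vector_derivative_def N_def N'_def n_def z_def scaleR_conv_of_real mult_ac)
qed

lemma zeta_derivative: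
  assumes "ham_min < h" "zeta h t \<noteq> 0"
  shows "(zeta h has_vector_derivative \<i> * grad (zeta h t)) (at t)"
proof -
  have nz: "pol h (phase h t) \<noteq> 0" using assms(2) by (simp add: zeta_def)
  have w: "0 < weight h (phase h t)" using weight_bounds(3)[OF assms(1)] .
  have "isCont (phase h) t" unfolding isCont_def by (intro tendsto_phase assms tendsto_intros)
  then have "(phase h has_real_derivative inverse (weight h (phase h t))) (at t)"
    using tau_derivative[OF assms(1) nz] w tau_phase[OF assms(1)]
    by (intro DERIV_inverse_function[where f = "tau h" and a = "t - 1" and b = "t + 1"]) auto
  then have "(phase h has_vector_derivative inverse (weight h (phase h t))) (at t)"
    by (simp add: has_real_derivative_iff_has_vector_derivative)
  from vector_diff_chain_at[OF this pol_derivative[OF assms(1) nz]]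
  have "(zeta h has_vector_derivative
      inverse (weight h (phase h t)) *\<^sub>R (\<i> * grad (zeta h t) * of_real (weight h (phase h t)))) (at t)"
    by (simp add: o_def zeta_def[abs_def])
  moreover have "inverse (weight h (phase h t)) *\<^sub>R (\<i> * grad (zeta h t) * of_real (weight h (phase h t)))
      = \<i> * grad (zeta h t)"
    using w by (simp add: scaleR_conv_of_real)
  ultimately show ?thesis by simp
qed

text \<open>The part of the field proportional to \<open>\<i> * z\<close> is tangent to circles
  about 0, so only the constant \<open>- \<i>\<close> changes the modulus.\<close>

lemma cmod_zeta_derivative:
  assumes "ham_min < h" "zeta h t \<noteq> 0"
  shows "((\<lambda>t. cmod (zeta h t)) has_real_derivative - Im (zeta h t) / cmod (zeta h t)) (at t)"
proof -
  have "((\<lambda>t. norm (zeta h t)) has_derivative (\<lambda>k. (k *\<^sub>R (\<i> * grad (zeta h t))) \<bullet> sgn (zeta h t))) (at t)"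
    using has_derivative_compose[OF zeta_derivative[OF assms, unfolded has_vector_derivative_def]
        has_derivative_norm[OF assms(2)]] .
  moreover have "(\<lambda>k. (k *\<^sub>R (\<i> * grad (zeta h t))) \<bullet> sgn (zeta h t))
      = (*) (- Im (zeta h t) / cmod (zeta h t))"
    using assms(2) by (auto simp: fun_eq_iff grad_def inner_complex_def sgn_div_norm field_simps)
  ultimately show ?thesis by (simp add: has_field_derivative_def)
qed

lemma Im_zeta_pos: "ham_min < h \<Longrightarrow> 0 < t \<Longrightarrow> t < per h / 2 \<Longrightarrow> 0 < Im (zeta h t)"
proof -
  assume h: "ham_min < h" and t: "0 < t" "t < per h / 2"
  then have "0 < phase h t" "phase h t < pi"
    using phase_less_iff[OF h, of t pi] phase_less_iff[OF h, of 0 t] by (auto simp: tau_pi tau_0)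
  then show ?thesis using rad_pos[OF h, of "phase h t"] by (simp add: zeta_def pol_def sin_gt_zero)
qed

lemma cmod_zeta_decreasing:
  assumes "ham_min < h" "0 \<le> s" "s < t" "t \<le> per h / 2"
  shows "cmod (zeta h t) < cmod (zeta h s)"
proof (rule DERIV_neg_imp_decreasing_open[OF assms(3)])
  fix x assume "s < x" "x < t"
  then have "0 < Im (zeta h x)" using Im_zeta_pos[of h x] assms by simp
  moreover then have "zeta h x \<noteq> 0" by auto
  ultimately show "\<exists>y. ((\<lambda>t. cmod (zeta h t)) has_real_derivative y) (at x) \<and> y < 0"
    using cmod_zeta_derivative[OF assms(1)] by fastforce
qed (intro continuous_intros continuous_on_zeta assms)

lemma zeta_0: "ham_min < h \<Longrightarrow> zeta h 0 = of_real (a + rad h 0)"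
  by (simp add: zeta_def pol_def phase_0)

lemma zeta_half: "ham_min < h \<Longrightarrow> zeta h (per h / 2) = of_real (a - rad h pi)"
  by (simp add: zeta_def pol_def phase_half)

text \<open>Two quantities are continuous with zero derivative off the zeros of \<open>z\<close>,
  hence constant: the level, and the difference between \<open>tau\<close> of the polar angle and
  the time. The polar angle comes from a continuous logarithm of \<open>z - a\<close>, which exists
  because the level stays above the minimum.\<close>

lemma orbit_equation:
  assumes J: "open J" "is_interval J" and cont: "continuous_on J z"
    and fin: "\<And>a b. a \<in> J \<Longrightarrow> b \<in> J \<Longrightarrow> finite {t\<in>{a..b}. z t = 0}"
    and ode: "\<And>t. t \<in> J \<Longrightarrow> z t \<noteq> 0 \<Longrightarrow> (z has_vector_derivative \<i> * grad (z t)) (at t)"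
    and t0: "t0 \<in> J" "z t0 \<noteq> of_real a"
  shows "\<exists>d. \<forall>t\<in>J. z t = zeta (ham (z t0)) (t + d)"
proof -
  define h where "h = ham (z t0)"
  have h: "ham_min < h" unfolding h_def using ham_gt_min t0 by blast
  have hz: "ham (z t) = h" if "t \<in> J" for t
    unfolding h_def
  proof (rule zero_derivative_constant[OF J(2) _ fin, where g = "\<lambda>t. ham (z t)"])
    show "continuous_on J (\<lambda>t. ham (z t))"
      by (rule continuous_on_compose2[OF continuous_on_ham[of UNIV] cont]) auto
    fix t assume t: "t \<in> J" "z t \<noteq> 0"
    from has_derivative_compose[OF ode[OF t, unfolded has_vector_derivative_def] ham_derivative[OF t(2)]]
    show "((\<lambda>t. ham (z t)) has_vector_derivative 0) (at t)"
      by (simp add: has_vector_derivative_def inner_complex_def algebra_simps)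
  qed (use that t0 in auto)
  have za: "z t \<noteq> of_real a" if "t \<in> J" for t
    using hz[OF that] h by (auto simp: ham_min_def)
  have "contractible J" using J(2) by (simp add: convex_imp_contractible is_interval_convex)
  moreover have "continuous_on J (\<lambda>t. z t - of_real a)" by (intro continuous_intros cont)
  moreover have "z t - of_real a \<noteq> 0" if "t \<in> J" for t using za[OF that] by simp
  ultimately obtain L where L: "continuous_on J L" "\<And>t. t \<in> J \<Longrightarrow> z t - of_real a = exp (L t)"
    using continuous_logarithm_on_contractible[of J "\<lambda>t. z t - of_real a"] by metis
  define \<phi> where "\<phi> t = Im (L t)" for t
  have zpol: "z t = pol h (\<phi> t)" if "t \<in> J" for t
  proof -
    have "z t = a + of_real (exp (Re (L t))) * cis (\<phi> t)"
      using L(2)[OF that] by (simp add: \<phi>_def exp_eq_polar eq_diff_eq diff_eq_eq add.commute)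
    from pol_ham[OF _ this] show ?thesis using hz[OF that] by simp
  qed
  have L': "(L has_vector_derivative \<i> * grad (z t) / (z t - of_real a)) (at t)"
    if t: "t \<in> J" "z t \<noteq> 0" for t
  proof -
    have "isCont L t" using L(1) J(1) t(1) by (simp add: continuous_on_eq_continuous_at)
    then have "((\<lambda>s. Im (L s - L t)) \<longlongrightarrow> Im (L t - L t)) (at t)"
      by (intro tendsto_intros) (simp add: isCont_def)
    then have "\<forall>\<^sub>F s in at t. - pi < Im (L s - L t)" "\<forall>\<^sub>F s in at t. Im (L s - L t) < pi"
      using order_tendstoD[of _ 0 "at t"] by force+
    then have ev: "\<forall>\<^sub>F s in nhds t. - pi < Im (L s - L t) \<and> Im (L s - L t) < pi \<and> s \<in> J"
      using eventually_nhds_in_open[OF J(1) t(1)]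
      by (simp add: eventually_nhds_conv_at eventually_conj_iff)
    \<comment> \<open>Near \<open>t\<close> the imaginary part of \<open>L s - L t\<close> stays
      between -\<pi> and \<pi>, so the principal logarithm of the quotient recovers the continuous
      logarithm \<open>L\<close>.\<close>
    define g where "g s = L t + ln ((z s - of_real a) / (z t - of_real a))" for s
    have "\<forall>\<^sub>F s in nhds t. L s = g s"
      using ev
    proof eventually_elim
      case (elim s)
      then have "(z s - of_real a) / (z t - of_real a) = exp (L s - L t)"
        using L(2) t(1) by (simp add: exp_diff)
      then show ?case using elim by (simp add: g_def)
    qed
    moreover have "(g has_vector_derivative \<i> * grad (z t) / (z t - of_real a)) (at t)"
    proof -
      have "((\<lambda>s. (z s - of_real a) / (z t - of_real a)) has_vector_derivative \<i> * grad (z t) / (z t - of_real a)) (at t)"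
        using bounded_linear.has_vector_derivative[OF bounded_linear_divide[of "z t - of_real a"]
          has_vector_derivative_diff[OF ode[OF t] has_vector_derivative_const[of "of_real a"]]] by simp
      moreover have "(ln has_field_derivative 1) (at ((z t - of_real a) / (z t - of_real a)))"
        using has_field_derivative_Ln[of 1] za[OF t(1)] by simp
      ultimately have "((ln \<circ> (\<lambda>s. (z s - of_real a) / (z t - of_real a))) has_vector_derivative \<i> * grad (z t) / (z t - of_real a) * 1) (at t)"
        by (rule field_vector_diff_chain_at)
      then show ?thesis unfolding g_def by (auto simp: o_def intro!: derivative_eq_intros)
    qed
    ultimately show ?thesis
      using has_vector_derivative_cong_ev[where x = t and S = UNIV and f = L and g = g] eventually_nhds_x_imp_x[of "\<lambda>s. L s = g s" t]
      by (simp add: eventually_mono)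
  qed
  define u where "u t = tau h (\<phi> t) - t" for t
  have const: "u s = u t" if "s \<in> J" "t \<in> J" for s t
  proof (rule zero_derivative_constant[OF J(2) _ fin, where g = u])
    have "continuous_on UNIV (tau h)" using isCont_tau[OF h] by (simp add: continuous_at_imp_continuous_on)
    moreover have "continuous_on J \<phi>" unfolding \<phi>_def by (intro continuous_intros L(1))
    ultimately have "continuous_on J (\<lambda>t. tau h (\<phi> t))" by (rule continuous_on_compose2) simp
    then show "continuous_on J u" unfolding u_def by (intro continuous_intros)
    fix t assume t: "t \<in> J" "z t \<noteq> 0"
    have "(\<phi> has_vector_derivative Im (\<i> * grad (z t) / (z t - of_real a))) (at t)"
      unfolding \<phi>_def using bounded_linear.has_vector_derivative[OF bounded_linear_Im L'[OF t]] .
    moreover have "Im (\<i> * grad (z t) / (z t - of_real a)) = inverse (weight h (\<phi> t))"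
    proof -
      let ?d = "z t - of_real a"
      have "cmod ?d = rad h (\<phi> t)"
        using zpol[OF t(1)] rad_pos[OF h, of "\<phi> t"] by (simp add: pol_def norm_mult)
      moreover have "Im (\<i> * grad (z t) / ?d) = Im (\<i> * grad (z t) * cnj ?d) / (cmod ?d)\<^sup>2"
        by (subst complex_div_cnj) (simp flip: of_real_power)
      moreover have "Im (\<i> * grad (z t) * cnj ?d) = rad_slope (z t)"
        by (simp add: rad_slope_def inner_complex_def algebra_simps)
      ultimately show ?thesis using zpol[OF t(1)] by (simp add: weight_def)
    qed
    ultimately have "(\<phi> has_real_derivative inverse (weight h (\<phi> t))) (at t)"
      by (simp add: has_real_derivative_iff_has_vector_derivative)
    moreover have "(tau h has_real_derivative weight h (\<phi> t)) (at (\<phi> t))"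
      using tau_derivative[OF h] t zpol by simp
    ultimately have "((\<lambda>t. tau h (\<phi> t)) has_real_derivative weight h (\<phi> t) * inverse (weight h (\<phi> t))) (at t)"
      using DERIV_chain2 by blast
    then have "(u has_real_derivative weight h (\<phi> t) * inverse (weight h (\<phi> t)) - 1) (at t)"
      unfolding u_def by (auto intro!: derivative_eq_intros)
    then show "(u has_vector_derivative 0) (at t)"
      using weight_bounds(3)[OF h, of "\<phi> t"] by (simp add: has_real_derivative_iff_has_vector_derivative)
  qed (use that in auto)
  have "z t = zeta h (t + u t0)" if "t \<in> J" for t
  proof -
    have "t + u t0 = tau h (\<phi> t)" using const[OF that t0(1)] by (simp add: u_def)
    then show ?thesis using zpol[OF that] phase_tau[OF h] by (simp add: zeta_def)
  qed
  then show ?thesis unfolding h_def by blast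
qed

end

subsection \<open>The flow and the net winding\<close>

lemma is_flow_continuous:
  assumes "is_flow f \<Phi>"
  shows "continuous_on UNIV (\<lambda>t. \<Phi> t z)" "continuous_on UNIV (\<lambda>z. \<Phi> t z)"
proof -
  have c: "continuous_on UNIV (\<lambda>(t, z). \<Phi> t z)" using assms by (simp add: is_flow_def)
  have "continuous_on UNIV (\<lambda>t. (t, z))" "continuous_on UNIV (\<lambda>z. (t, z))"
    by (auto intro!: continuous_intros)
  from this[THEN continuous_on_compose2[OF c]]
  show "continuous_on UNIV (\<lambda>t. \<Phi> t z)" "continuous_on UNIV (\<lambda>z. \<Phi> t z)" by auto
qed

context attractive_curvature
begin

text \<open>Apart from the equilibrium \<open>a\<close>, every point lies on the orbit
  \<open>zeta\<close> of its own level. Its phase is determined up to multiples of the period, so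
  the choice does not matter.\<close>

definition std_flow :: "real \<Rightarrow> complex \<Rightarrow> complex" where
  "std_flow t z = (if z = of_real a then of_real a
     else zeta (ham z) (t + (SOME d. zeta (ham z) d = z)))"

lemma std_flow_fixed: "std_flow t (of_real a) = of_real a"
  by (simp add: std_flow_def)

lemma std_flow_eq:
  assumes "z \<noteq> of_real a" "zeta (ham z) d = z"
  shows "std_flow t z = zeta (ham z) (t + d)"
proof -
  define d' where "d' = (SOME d. zeta (ham z) d = z)"
  have "zeta (ham z) d' = z" unfolding d'_def by (rule someI[of _ d]) (rule assms(2))
  then obtain k :: int where "d' = d + of_int k * per (ham z)"
    using zeta_eq_iff[OF ham_gt_min[OF assms(1)], of d' d] assms(2) by auto
  then have "zeta (ham z) (t + d') = zeta (ham z) (t + d)"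
    using zeta_periodic[OF ham_gt_min[OF assms(1)], of "t + d" k] by (simp add: add.assoc)
  then show ?thesis using assms(1) by (simp add: std_flow_def d'_def)
qed

lemma std_flow_zeta:
  assumes "ham_min < h"
  shows "std_flow t (zeta h d) = zeta h (t + d)"
  using std_flow_eq[OF zeta_neq[OF assms], of d d t] ham_zeta[OF assms, of d] by simp

lemma std_flow_0: "std_flow 0 z = z"
proof (cases "z = of_real a")
  case False
  then obtain d where "zeta (ham z) d = z" using zeta_surj by blast
  then show ?thesis using std_flow_eq[OF False, of d 0] by simp
qed (simp add: std_flow_fixed)

lemma ham_std_flow: "ham (std_flow t z) = ham z"
  by (cases "z = of_real a") (simp_all add: std_flow_def ham_zeta ham_gt_min)

lemma std_flow_add: "std_flow (s + t) z = std_flow s (std_flow t z)"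
proof (cases "z = of_real a")
  case False
  then obtain d where d: "zeta (ham z) d = z" using zeta_surj by blast
  have "std_flow s (std_flow t z) = std_flow s (zeta (ham z) (t + d))"
    using std_flow_eq[OF False d] by simp
  also have "\<dots> = zeta (ham z) (s + (t + d))" by (rule std_flow_zeta[OF ham_gt_min[OF False]])
  also have "\<dots> = std_flow (s + t) z" using std_flow_eq[OF False d] by (simp add: add.assoc)
  finally show ?thesis by simp
qed (simp add: std_flow_fixed)

text \<open>For \<open>m\<close> serves the minimum of \<open>ham\<close> on the circle of radius
  \<open>e\<close> about \<open>a\<close>, since \<open>ham\<close> increases along rays. As the
  flow preserves levels, this gives its continuity at the equilibrium.\<close>

lemma sublevel_small:
  assumes "0 < e"
  shows "\<exists>m>ham_min. \<forall>z. ham z < m \<longrightarrow> dist z (of_real a) < e"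
proof -
  have "sphere (complex_of_real a) e \<noteq> {}" using assms by auto
  then obtain y where y: "y \<in> sphere (of_real a) e" "\<And>z. z \<in> sphere (of_real a) e \<Longrightarrow> ham y \<le> ham z"
    using continuous_attains_inf[OF compact_sphere _ continuous_on_ham] by metis
  have "y \<noteq> of_real a" using y(1) assms by auto
  moreover have "dist z (of_real a) < e" if "ham z < ham y" for z
  proof (rule ccontr)
    assume far: "\<not> dist z (of_real a) < e"
    define \<phi> where "\<phi> = Arg (z - of_real a)"
    let ?r = "cmod (z - of_real a)"
    have z: "z = a + of_real ?r * cis \<phi>"
      unfolding \<phi>_def using rcis_cmod_Arg[of "z - of_real a"] by (simp add: rcis_def)
    have "a + of_real e * cis \<phi> \<in> sphere (of_real a) e" using assms by (simp add: dist_norm norm_mult)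
    then have "ham y \<le> ham (a + of_real e * cis \<phi>)" by (rule y(2))
    also have "\<dots> \<le> ham (a + of_real ?r * cis \<phi>)"
      using ham_ray_increasing[of e ?r \<phi>] assms far by (cases "e = ?r") (auto simp: dist_norm)
    also have "\<dots> = ham z" using z by simp
    finally show False using that by simp
  qed
  ultimately show ?thesis using ham_gt_min by blast
qed

lemma tendsto_std_flow: "((\<lambda>p. std_flow (fst p) (snd p)) \<longlongrightarrow> std_flow t z) (at (t, z))"
proof (cases "z = of_real a")
  case True
  have hz: "((\<lambda>p. ham (snd p)) \<longlongrightarrow> ham z) (at (t, z))"
    by (rule isCont_tendsto_compose[OF isCont_ham]) (rule tendsto_eq_intros refl | simp)+
  show ?thesis
  proof (rule tendstoI)
    fix e :: real assume "0 < e"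
    then obtain m where m: "ham_min < m" "\<And>z. ham z < m \<Longrightarrow> dist z (of_real a) < e"
      using sublevel_small by blast
    then have "\<forall>\<^sub>F p in at (t, z). ham (snd p) < m"
      using order_tendstoD(2)[OF hz] True by (simp add: ham_min_def)
    then show "\<forall>\<^sub>F p in at (t, z). dist (std_flow (fst p) (snd p)) (std_flow t z) < e"
      by (rule eventually_mono) (use m(2) ham_std_flow True std_flow_fixed in auto)
  qed
next
  case False
  define \<phi>0 where "\<phi>0 = Arg (z - of_real a)"
  \<comment> \<open>A polar angle about \<open>a\<close> that is valid for all \<open>w\<close> but
    needs to be continuous only at \<open>z\<close>, which the rotation by -\<phi>0 moves to the
    positive axis.\<close>
  define \<phi> where "\<phi> w = \<phi>0 + Im (ln ((w - of_real a) * cis (- \<phi>0)))" for w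
  have polar: "w - of_real a = of_real (cmod (w - of_real a)) * cis (\<phi> w)" if "w \<noteq> of_real a" for w
  proof -
    have "(w - of_real a) * cis (- \<phi>0) \<noteq> 0" using that by simp
    from exp_Ln[OF this] have "(w - of_real a) * cis (- \<phi>0) =
        of_real (exp (Re (ln ((w - of_real a) * cis (- \<phi>0))))) * cis (Im (ln ((w - of_real a) * cis (- \<phi>0))))"
      by (metis exp_eq_polar)
    also have "exp (Re (ln ((w - of_real a) * cis (- \<phi>0)))) = cmod (w - of_real a)"
      using that by (simp add: norm_mult)
    finally have "(w - of_real a) * cis (- \<phi>0) * cis \<phi>0 =
        of_real (cmod (w - of_real a)) * cis (Im (ln ((w - of_real a) * cis (- \<phi>0)))) * cis \<phi>0" by simp
    then show ?thesis by (simp add: \<phi>_def mult.assoc cis_mult add.commute)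
  qed
  have zp: "zeta (ham w) (tau (ham w) (\<phi> w)) = w" if "w \<noteq> of_real a" for w
  proof -
    have "w = a + of_real (cmod (w - of_real a)) * cis (\<phi> w)"
      using polar[OF that] by (metis add.commute diff_add_cancel)
    from pol_ham[OF _ this] show ?thesis
      using that phase_tau[OF ham_gt_min[OF that]] by (simp add: zeta_def)
  qed
  have flow: "std_flow t w = zeta (ham w) (t + tau (ham w) (\<phi> w))" if "w \<noteq> of_real a" for t w
    using std_flow_eq[OF that zp[OF that]] .
  have h: "ham_min < ham z" using ham_gt_min[OF False] .
  have ts: "((\<lambda>p. snd p) \<longlongrightarrow> z) (at (t, z))" "((\<lambda>p. fst p) \<longlongrightarrow> t) (at (t, z))"
    by (rule tendsto_eq_intros refl | simp)+
  have hz: "((\<lambda>p. ham (snd p)) \<longlongrightarrow> ham z) (at (t, z))"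
    by (rule isCont_tendsto_compose[OF isCont_ham ts(1)])
  have base: "(z - of_real a) * cis (- \<phi>0) = of_real (cmod (z - of_real a))"
    using rcis_cmod_Arg[of "z - of_real a"]
    by (metis \<phi>0_def add.right_inverse cis_mult cis_zero mult.assoc mult.right_neutral rcis_def)
  have pos: "0 < cmod (z - of_real a)" using False by simp
  have ln: "isCont ln ((z - of_real a) * cis (- \<phi>0))"
    unfolding base using pos by (intro continuous_at_Ln) simp
  have \<phi>z: "((\<lambda>p. \<phi> (snd p)) \<longlongrightarrow> \<phi> z) (at (t, z))"
    unfolding \<phi>_def by (intro tendsto_intros isCont_tendsto_compose[OF ln] ts)
  have "((\<lambda>p. zeta (ham (snd p)) (fst p + tau (ham (snd p)) (\<phi> (snd p))))
      \<longlongrightarrow> zeta (ham z) (t + tau (ham z) (\<phi> z))) (at (t, z))"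
    by (intro tendsto_zeta tendsto_tau tendsto_add ts h hz \<phi>z)
  moreover have "\<forall>\<^sub>F p in at (t, z). snd p \<noteq> of_real a"
    using tendsto_imp_eventually_ne[OF ts(1) False] .
  then have "\<forall>\<^sub>F p in at (t, z). zeta (ham (snd p)) (fst p + tau (ham (snd p)) (\<phi> (snd p)))
      = std_flow (fst p) (snd p)"
    by (rule eventually_mono) (simp add: flow)
  ultimately show ?thesis using flow[OF False, of t] by (simp add: tendsto_cong)
qed

lemma is_flow_std_flow: "is_flow f std_flow"
  unfolding is_flow_def
proof (intro conjI allI impI)
  show "continuous_on UNIV (\<lambda>(t, z). std_flow t z)"
    using tendsto_std_flow by (auto simp: continuous_on case_prod_unfold)
  show "std_flow 0 z = z" for z by (rule std_flow_0)
  show "std_flow (s + t) z = std_flow s (std_flow t z)" for s t z by (rule std_flow_add)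
  fix t z assume nz: "std_flow t z \<noteq> 0"
  have "((\<lambda>u. std_flow u z) has_vector_derivative \<i> * grad (std_flow t z)) (at t)"
  proof (cases "z = of_real a")
    case True
    moreover have "grad (of_real a) = 0" using f_a a_pos by (simp add: grad_def mult.commute flip: of_real_mult)
    ultimately show ?thesis by (simp add: std_flow_fixed)
  next
    case False
    then obtain d where d: "zeta (ham z) d = z" using zeta_surj by blast
    have eq: "std_flow u z = zeta (ham z) (u + d)" for u by (rule std_flow_eq[OF False d])
    have "((\<lambda>u. u + d) has_vector_derivative 1) (at t)" by (auto intro!: derivative_eq_intros)
    from vector_diff_chain_at[OF this zeta_derivative[OF ham_gt_min[OF False], of "t + d"]] nz
    show ?thesis by (simp add: eq o_def)
  qed
  then show "((\<lambda>u. std_flow u z) has_vector_derivative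
      \<i> * std_flow t z * complex_of_real (f (cmod (std_flow t z))) - \<i>) (at t)"
    by (simp add: grad_def algebra_simps)
qed

section \<open>Uniqueness of the flow\<close>

lemma is_flow_grad:
  assumes "is_flow f \<Phi>" "\<Phi> t z \<noteq> 0"
  shows "((\<lambda>t. \<Phi> t z) has_vector_derivative \<i> * grad (\<Phi> t z)) (at t)"
proof -
  have "((\<lambda>t. \<Phi> t z) has_vector_derivative \<i> * \<Phi> t z * of_real (f (cmod (\<Phi> t z))) - \<i>) (at t)"
    using assms unfolding is_flow_def by blast
  then show ?thesis by (simp add: grad_def right_diff_distrib mult_ac)
qed

text \<open>The set of times with unchanged level is closed. It is open because at such a time the
  orbit is off the origin, whose level is 0, so the equation holds nearby and preserves the
  level.\<close>

lemma is_flow_avoids_zero: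
  assumes \<Phi>: "is_flow f \<Phi>" and z: "ham z \<noteq> 0"
  shows "ham (\<Phi> t z) = ham z"
proof -
  have c: "continuous_on UNIV (\<lambda>t. \<Phi> t z)"
    by (rule is_flow_continuous(1)[OF \<Phi>])
  have hc: "continuous_on UNIV (\<lambda>t. ham (\<Phi> t z))"
    by (rule continuous_on_compose2[OF continuous_on_ham[of UNIV] c]) auto
  let ?T = "{t. ham (\<Phi> t z) = ham z}"
  have "closed ?T" using closed_Collect_eq[OF hc continuous_on_const] by simp
  moreover have "open ?T"
    unfolding open_contains_ball
  proof
    fix t assume t: "t \<in> ?T"
    then have nz: "\<Phi> t z \<noteq> 0" using z ham_0 by auto
    have "open {t. \<Phi> t z \<noteq> 0}" using open_Collect_neq[OF c continuous_on_const] .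
    then obtain e where e: "0 < e" "ball t e \<subseteq> {t. \<Phi> t z \<noteq> 0}"
      using nz by (auto simp: open_contains_ball)
    have "s \<in> ?T" if "s \<in> ball t e" for s
    proof -
      have "ham (\<Phi> s z) = ham (\<Phi> t z)"
    proof (rule zero_derivative_constant[of "ball t e" "\<lambda>t. ham (\<Phi> t z)" "\<lambda>_. False"])
      show "is_interval (ball t e)" by (simp add: is_interval_convex_1)
      show "continuous_on (ball t e) (\<lambda>t. ham (\<Phi> t z))" using hc continuous_on_subset by blast
      fix u assume "u \<in> ball t e"
      then have nz: "\<Phi> u z \<noteq> 0" using e by auto
      have "((\<lambda>t. \<Phi> t z) has_vector_derivative \<i> * grad (\<Phi> u z)) (at u)"
        by (rule is_flow_grad[OF \<Phi> nz])
      from has_derivative_compose[OF this[unfolded has_vector_derivative_def] ham_derivative[OF nz]]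
      show "((\<lambda>t. ham (\<Phi> t z)) has_vector_derivative 0) (at u)"
        by (simp add: has_vector_derivative_def inner_complex_def algebra_simps)
      qed (use that e in auto)
      then show ?thesis using t by simp
    qed
    then have "ball t e \<subseteq> ?T" by blast
    then show "\<exists>e>0. ball t e \<subseteq> ?T" using e(1) by blast
  qed
  moreover have "0 \<in> ?T" using \<Phi> by (simp add: is_flow_def)
  ultimately have "?T = UNIV" using clopen[of ?T] by blast
  then show ?thesis by blast
qed

text \<open>An abstract flow obeys the equation only off 0, and at level 0 its zeros are not known
  to be isolated. Therefore \<open>orbit_equation\<close> handles the other levels, and a point of
  level 0 is approached by points \<open>w n\<close> of positive level, using continuity in the
  initial value.\<close>

lemma is_flow_unique:
  assumes \<Phi>: "is_flow f \<Phi>"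
  shows "\<Phi> = std_flow"
proof (intro ext)
  fix t z
  have c: "continuous_on UNIV (\<lambda>t. \<Phi> t z)" for z
    by (rule is_flow_continuous(1)[OF \<Phi>])
  have *: "\<Phi> t z = std_flow t z" if "ham z \<noteq> 0" for t z
  proof (cases "z = of_real a")
    case True
    then have "\<Phi> t z = of_real a"
      using is_flow_avoids_zero[OF \<Phi> that, of t] ham_gt_min[of "\<Phi> t z"] by (auto simp: ham_min_def)
    then show ?thesis using True by (simp add: std_flow_fixed)
  next
    case False
    have nz: "\<Phi> t z \<noteq> 0" for t using is_flow_avoids_zero[OF \<Phi> that, of t] that ham_0 by auto
    have z0: "\<Phi> 0 z = z" using \<Phi> by (simp add: is_flow_def)
    have "\<exists>d. \<forall>t\<in>UNIV. \<Phi> t z = zeta (ham (\<Phi> 0 z)) (t + d)"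
    proof (rule orbit_equation)
      fix t assume "\<Phi> t z \<noteq> 0"
      then show "((\<lambda>t. \<Phi> t z) has_vector_derivative \<i> * grad (\<Phi> t z)) (at t)"
        by (rule is_flow_grad[OF \<Phi>])
    qed (use c nz z0 False in auto)
    then obtain d where d: "\<And>t. \<Phi> t z = zeta (ham z) (t + d)" using z0 by auto
    then have "zeta (ham z) d = z" using d[of 0] z0 by simp
    then show ?thesis using std_flow_eq[OF False] d by simp
  qed
  show "\<Phi> t z = std_flow t z"
  proof (cases "ham z = 0")
    case True
    define \<phi> where "\<phi> = Arg (z - of_real a)"
    let ?r = "cmod (z - of_real a)"
    have z: "z = a + of_real ?r * cis \<phi>"
      unfolding \<phi>_def using rcis_cmod_Arg[of "z - of_real a"] by (simp add: rcis_def)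
    define w where "w n = a + of_real (?r + 1 / real (Suc n)) * cis \<phi>" for n
    have "ham z < ham (w n)" for n
      unfolding w_def by (subst z) (rule ham_ray_increasing, simp_all)
    then have eq: "\<Phi> t (w n) = std_flow t (w n)" for n using * True by (metis less_irrefl)
    have "(\<lambda>n. w n) \<longlonglongrightarrow> a + of_real (?r + 0) * cis \<phi>"
      unfolding w_def by (intro tendsto_intros LIMSEQ_Suc[OF lim_1_over_n])
    then have w: "w \<longlonglongrightarrow> z" using z by simp
    have lim: "(\<lambda>n. \<Psi> t (w n)) \<longlonglongrightarrow> \<Psi> t z" if "is_flow f \<Psi>" for \<Psi>
    proof -
      have "continuous_on UNIV (\<lambda>z. \<Psi> t z)"
        by (rule is_flow_continuous(2)[OF that])
      then have "isCont (\<lambda>z. \<Psi> t z) z" by (simp add: continuous_on_eq_continuous_at)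
      then show ?thesis by (rule isCont_tendsto_compose[OF _ w])
    qed
    show ?thesis
      using LIMSEQ_unique[OF lim[OF \<Phi>]] lim[OF is_flow_std_flow] eq by simp
  qed (rule *)
qed

lemma flow_eq: "flow f = std_flow"
  unfolding flow_def by (rule the_equality[where P = "is_flow f", OF is_flow_std_flow is_flow_unique])

end

text \<open>If z solves the equation for \<open>f\<close>, then the point reflection -z(-t) of the
  time-reversed orbit solves the one for \<open>- f\<close>.\<close>

lemma is_flow_uminus:
  assumes "is_flow f \<Phi>"
  shows "is_flow (\<lambda>s. - f s) (\<lambda>t z. - \<Phi> (- t) (- z))"
  unfolding is_flow_def
proof (intro conjI allI impI)
  have "continuous_on UNIV (\<lambda>(t, z). \<Phi> t z)" using assms by (simp add: is_flow_def)
  moreover have "continuous_on UNIV (\<lambda>p::real \<times> complex. (- fst p, - snd p))" by (intro continuous_intros)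
  ultimately have "continuous_on UNIV (\<lambda>p. case (- fst p, - snd p) of (t, z) \<Rightarrow> \<Phi> t z)"
    by (rule continuous_on_compose2) simp
  from continuous_on_minus[OF this] show "continuous_on UNIV (\<lambda>(t, z). - \<Phi> (- t) (- z))" by (simp add: case_prod_unfold)
  show "- \<Phi> (- 0) (- z) = z" for z using assms by (simp add: is_flow_def)
  have add: "\<Phi> (s + t) z = \<Phi> s (\<Phi> t z)" for s t z using assms by (simp add: is_flow_def)
  show "- \<Phi> (- (s + t)) (- z) = - \<Phi> (- s) (- (- \<Phi> (- t) (- z)))" for s t z
    using add[of "- s" "- t" "- z"] by simp
  fix t z assume "- \<Phi> (- t) (- z) \<noteq> 0"
  then have "((\<lambda>u. \<Phi> u (- z)) has_vector_derivative
     \<i> * \<Phi> (- t) (- z) * of_real (f (cmod (\<Phi> (- t) (- z)))) - \<i>) (at (- t))"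
    using assms unfolding is_flow_def by (metis neg_0_equal_iff_equal)
  moreover have "(uminus has_vector_derivative (- 1)) (at t)"
    by (auto intro!: derivative_eq_intros)
  ultimately have "((\<lambda>u. \<Phi> u (- z)) \<circ> uminus has_vector_derivative
     (- 1) *\<^sub>R (\<i> * \<Phi> (- t) (- z) * of_real (f (cmod (\<Phi> (- t) (- z)))) - \<i>)) (at t)"
    by (intro vector_diff_chain_at)
  from has_vector_derivative_minus[OF this]
  show "((\<lambda>u. - \<Phi> (- u) (- z)) has_vector_derivative
      \<i> * - \<Phi> (- t) (- z) * of_real (- f (cmod (- \<Phi> (- t) (- z)))) - \<i>) (at t)"
    by (simp add: o_def)
qed

lemma (in attractive_curvature) flow_uminus_eq: "flow (\<lambda>s. - f s) = (\<lambda>t z. - std_flow (- t) (- z))"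
  unfolding flow_def
proof (rule the_equality)
  show "is_flow (\<lambda>s. - f s) (\<lambda>t z. - std_flow (- t) (- z))"
    using is_flow_uminus[OF is_flow_std_flow] .
  fix \<Phi> assume "is_flow (\<lambda>s. - f s) \<Phi>"
  from is_flow_unique[OF is_flow_uminus[OF this, simplified]]
  have "- \<Phi> (- t) (- z) = std_flow t z" for t z by metis
  then have "\<Phi> t z = - std_flow (- t) (- z)" for t z by (metis minus_minus)
  then show "\<Phi> = (\<lambda>t z. - std_flow (- t) (- z))" by blast
qed

lemma minimal_period_unique: "minimal_period g S \<Longrightarrow> minimal_period g T \<Longrightarrow> S = T"
  unfolding minimal_period_def by (meson linorder_neqE_linordered_idom)

text \<open>The given polar form and the continuous logarithm provided by the winding number differ
  by a continuous function with values in 2\<pi>i times the integers, hence by a constant. So the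
  two angle increments agree.\<close>

lemma winding_number_polar:
  assumes \<rho>: "continuous_on {0..1} \<rho>" "\<And>u. u \<in> {0..1} \<Longrightarrow> 0 < \<rho> u" "\<rho> 1 = \<rho> 0"
    and \<phi>: "continuous_on {0..1} \<phi>" "\<phi> 1 - \<phi> 0 = 2 * pi * of_int k"
    and p: "\<And>u. u \<in> {0..1} \<Longrightarrow> p u = w + of_real (\<rho> u) * cis (\<phi> u)"
  shows "w \<notin> path_image p" "winding_number p w = of_int k"
proof -
  show w: "w \<notin> path_image p"
  proof
    assume "w \<in> path_image p"
    then obtain u where "u \<in> {0..1}" "p u = w" unfolding path_image_def by auto
    with p[OF this(1)] \<rho>(2)[OF this(1)] show False by simp
  qed
  have "continuous_on {0..1} (\<lambda>u. w + of_real (\<rho> u) * cis (\<phi> u))"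
    by (intro continuous_intros \<rho> \<phi> continuous_on_compose2[of UNIV cis]) auto
  then have "path p" unfolding path_def using p continuous_on_cong[of "{0..1}" "{0..1}" p] by auto
  then obtain q where q: "path q" "pathfinish q - pathstart q = 2 * of_real pi * \<i> * winding_number p w"
     "\<And>t. t \<in> {0..1} \<Longrightarrow> p t = w + exp (q t)"
    using winding_number_as_continuous_log[OF _ w] by blast
  define l where "l u = (q u - (of_real (ln (\<rho> u)) + \<i> * of_real (\<phi> u))) / (2 * of_real pi * \<i>)" for u
  have int: "\<exists>n::int. l u = of_int n" if "u \<in> {0..1}" for u
  proof -
    have "exp (complex_of_real (ln (\<rho> u))) = of_real (\<rho> u)"
      using \<rho>(2)[OF that] by (simp add: exp_of_real)
    then have "exp (q u) = exp (of_real (ln (\<rho> u)) + \<i> * of_real (\<phi> u))"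
      using q(3)[OF that] p[OF that] by (simp add: exp_add cis_conv_exp)
    then obtain n :: int where "q u = of_real (ln (\<rho> u)) + \<i> * of_real (\<phi> u) + (of_int (2 * n) * pi) * \<i>"
      using exp_eq by blast
    then have "l u = of_int n" by (simp add: l_def field_simps)
    then show ?thesis by blast
  qed
  have "l constant_on {0..1}"
  proof (rule continuous_discrete_range_constant)
    show "continuous_on {0..1} l"
      unfolding l_def using q(1) \<rho>(2) by (intro continuous_intros \<rho> \<phi>) (auto simp: path_def less_imp_neq[symmetric])
    fix x :: real assume x: "x \<in> {0..1}"
    have "1 \<le> norm (l y - l x)" if y: "y \<in> {0..1}" "l y \<noteq> l x" for y
    proof -
      obtain m n :: int where "l y = of_int m" "l x = of_int n" using int[OF x] int[OF y(1)] by blast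
      then show ?thesis using y(2) by (simp flip: of_int_diff)
    qed
    then show "\<exists>e>0. \<forall>y. y \<in> {0..1} \<and> l y \<noteq> l x \<longrightarrow> e \<le> norm (l y - l x)" by (intro exI[of _ 1]) auto
  qed simp
  then have "l 0 = l 1" unfolding constant_on_def by force
  then have "q 1 - q 0 = \<i> * of_real (\<phi> 1 - \<phi> 0)"
    using \<rho>(3) by (simp add: l_def field_simps)
  then show "winding_number p w = of_int k"
    using q(2) \<phi>(2) by (simp add: pathfinish_def pathstart_def)
qed

context attractive_curvature
begin

section \<open>Evaluation of the net winding\<close>

lemma zeta_minimal_period:
  assumes "ham_min < h"
  shows "minimal_period (\<lambda>t. zeta h (t + c)) (per h)"
  unfolding minimal_period_def
proof (intro conjI allI impI notI)
  show "zeta h (t + per h + c) = zeta h (t + c)" for t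
    using zeta_periodic[OF assms, of "t + c" 1] by (simp add: add_ac)
  fix S assume S: "0 < S \<and> S < per h" "\<forall>t. zeta h (t + S + c) = zeta h (t + c)"
  then have "zeta h (S + c) = zeta h c" using S(2)[rule_format, of 0] by simp
  then obtain k :: int where k: "S + c = c + of_int k * per h"
    using zeta_eq_iff[OF assms] by blast
  then have "0 < of_int k * per h" "of_int k * per h < 1 * per h" using S by auto
  then have "0 < k" "k < 1"
    using per_pos[OF assms] by (simp_all add: zero_less_mult_iff mult_less_cancel_right)
  then show False by simp
qed (rule per_pos[OF assms])

text \<open>Seen from \<open>a\<close>, the points \<open>s\<close> and 0 lie in direction \<pi>,
  with \<open>s\<close> closer. So the level of \<open>s\<close> is below that of 0, and
  \<open>s\<close> is the near real point of its level curve.\<close>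

lemma inner_level:
  assumes "0 < s" "s < a"
  shows "ham_min < ham (of_real s)" "ham (of_real s) < 0" "zeta (ham (of_real s)) (per (ham (of_real s)) / 2) = of_real s"
proof -
  let ?h = "ham (of_real s)"
  have s: "of_real s = a + of_real (a - s) * cis pi" by (simp add: complex_eq_iff)
  show h: "ham_min < ?h" using assms by (intro ham_gt_min) auto
  have "ham (a + of_real (a - s) * cis pi) < ham (a + of_real a * cis pi)"
    using assms by (intro ham_ray_increasing) auto
  then show "?h < 0" unfolding s[symmetric] using ham_0 by simp
  have "rad ?h pi = a - s"
    by (rule rad_eqI[OF h]) (use assms in simp, simp only: s[symmetric])
  then show "zeta ?h (per ?h / 2) = of_real s" by (simp add: zeta_half[OF h])
qed

lemma zeta_polar: "zeta h t = of_real a + of_real (rad h (phase h t)) * cis (phase h t)"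
  by (simp add: zeta_def pol_def)

lemma continuous_on_phase: "ham_min < h \<Longrightarrow> continuous_on S (phase h)"
  unfolding continuous_on by (intro ballI tendsto_phase tendsto_intros)

lemma continuous_on_rad_phase: "ham_min < h \<Longrightarrow> continuous_on S (\<lambda>t. rad h (phase h t))"
  unfolding continuous_on by (intro ballI tendsto_rad tendsto_phase tendsto_intros)

text \<open>For \<open>- f\<close> the orbit of \<open>- s\<close> is the image of the orbit of
  \<open>s\<close> under \<open>w \<mapsto> - cnj w\<close>, which runs clockwise about
  \<open>- a\<close>. The sign from the orientation cancels the sign of \<open>- f\<close>, so both
  net windings agree.\<close>

lemma
  assumes "0 < s" "s < a"
  defines "h \<equiv> ham (of_real s)"
  shows net_winding_pos: "net_winding f (of_real s) =
      integral {0..per h} (\<lambda>t. f (cmod (zeta h (t + per h / 2)))) / (2 * pi)"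
    and net_winding_neg: "net_winding (\<lambda>s. - f s) (of_real (- s)) =
      integral {0..per h} (\<lambda>t. f (cmod (zeta h (t + per h / 2)))) / (2 * pi)"
proof -
  let ?T = "per h"
  have h: "ham_min < h" and zs: "zeta h (?T / 2) = of_real s"
    using inner_level[OF assms(1,2)] by (auto simp: h_def)
  note T = per_pos[OF h]
  have fl: "flow f t (of_real s) = zeta h (t + ?T / 2)" for t
    using std_flow_zeta[OF h, of t "?T / 2"] by (simp add: flow_eq zs)
  have fl': "flow (\<lambda>s. - f s) t (- of_real s) = - cnj (zeta h (t + ?T / 2))" for t
  proof -
    have "flow (\<lambda>s. - f s) t (- of_real s) = - zeta h (- t + ?T / 2)"
      using std_flow_zeta[OF h, of "- t" "?T / 2"] by (simp add: flow_uminus_eq zs)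
    also have "zeta h (- t + ?T / 2) = zeta h (- (t + ?T / 2) + of_int 1 * ?T)" by (simp add: algebra_simps)
    also have "\<dots> = cnj (zeta h (t + ?T / 2))" unfolding zeta_periodic[OF h] zeta_uminus[OF h] ..
    finally show ?thesis .
  qed
  have mp: "minimal_period (\<lambda>t. zeta h (t + ?T / 2)) ?T" by (rule zeta_minimal_period[OF h])
  have "flow_period f (of_real s) = ?T"
    unfolding flow_period_def fl using mp minimal_period_unique by blast
  then have loop: "orbit_loop f (of_real s) = (\<lambda>u. zeta h (?T * u + ?T / 2))"
    by (simp add: orbit_loop_def fl)
  have mp': "minimal_period (\<lambda>t. - cnj (zeta h (t + ?T / 2))) ?T"
    using mp by (simp add: minimal_period_def)
  have per': "flow_period (\<lambda>s. - f s) (- of_real s) = ?T"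
    unfolding flow_period_def fl' using mp' minimal_period_unique by blast
  then have loop': "orbit_loop (\<lambda>s. - f s) (- of_real s) = (\<lambda>u. - cnj (zeta h (?T * u + ?T / 2)))"
    by (simp add: orbit_loop_def fl')
  let ?g = "\<lambda>u. zeta h (?T * u + ?T / 2)"
  have ph: "phase h (?T * 1 + ?T / 2) = phase h (?T * 0 + ?T / 2) + 2 * pi"
    using phase_periodic[OF h, of "?T / 2" 1] by (simp add: add.commute)
  then have rd: "rad h (phase h (?T * 1 + ?T / 2)) = rad h (phase h (?T * 0 + ?T / 2))"
    by (intro rad_cis_cong) (simp add: cis_mult[symmetric])
  have cont: "continuous_on {0..1} (\<lambda>u. rad h (phase h (?T * u + ?T / 2)))"
    "continuous_on {0..1} (\<lambda>u. phase h (?T * u + ?T / 2))"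
    by (rule continuous_on_compose2[OF continuous_on_rad_phase[OF h, of UNIV]]
        continuous_on_compose2[OF continuous_on_phase[OF h, of UNIV]]; force intro: continuous_intros)+
  have wn: "of_real a \<notin> path_image ?g" "winding_number ?g (of_real a) = of_int 1"
    by (rule winding_number_polar[OF cont(1) rad_pos[OF h] rd cont(2), of 1]; use ph zeta_polar in simp)+
  have cont': "continuous_on {0..1} (\<lambda>u. pi - phase h (?T * u + ?T / 2))"
    by (intro continuous_intros cont)
  have polar': "- cnj (zeta h t) = - of_real a + of_real (rad h (phase h t)) * cis (pi - phase h t)" for t
    by (simp add: zeta_polar complex_eq_iff)
  have wn': "- of_real a \<notin> path_image (\<lambda>u. - cnj (?g u))"
     "winding_number (\<lambda>u. - cnj (?g u)) (- of_real a) = of_int (- 1)"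
    by (rule winding_number_polar[OF cont(1) rad_pos[OF h] rd cont', of "- 1"]; use ph polar' in simp)+
  have path: "path ?g" unfolding path_def
    by (rule continuous_on_compose2[OF continuous_on_zeta[OF h, of UNIV]]) (intro continuous_intros, simp)
  have inj: "x = y \<or> x = 0 \<and> y = 1 \<or> x = 1 \<and> y = 0"
    if xy: "x \<in> {0..1}" "y \<in> {0..1}" "?g x = ?g y" for x y :: real
  proof -
    obtain k :: int where "?T * x + ?T / 2 = ?T * y + ?T / 2 + of_int k * ?T"
      using xy(3) zeta_eq_iff[OF h] by blast
    then have "?T * (x - y - of_int k) = 0" by (simp add: algebra_simps)
    then have "x - y = of_int k" using T by simp
    moreover then have "k \<in> {-1, 0, 1}" using xy by auto
    ultimately show ?thesis using xy by auto
  qed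
  have simp: "simple_path ?g"
    unfolding simple_path_def loop_free_def using path inj by auto
  have closed: "pathfinish ?g = pathstart ?g" "pathfinish (\<lambda>u. - cnj (?g u)) = pathstart (\<lambda>u. - cnj (?g u))"
    using zeta_periodic[OF h, of "?T / 2" 1] by (auto simp: pathfinish_def pathstart_def add.commute)
  \<comment> \<open>On the inside of a simple closed path the winding number is constantly 1 or
    constantly -1, so its value at the single inside point \<open>a\<close> settles the orientation.
    In the mirrored case the value -1 at \<open>- a\<close> refutes the counter-clockwise
    one.\<close>
  have inside: "w \<in> inside (path_image p)"
    if "path p" "pathfinish p = pathstart p" "w \<notin> path_image p" "winding_number p w \<noteq> 0" for p w
    using winding_number_zero_in_outside[OF that(1,2), of w] that(3,4) inside_Un_outside[of "path_image p"] by blast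
  have "loop_counterclockwise ?g"
    using simple_closed_path_winding_number_inside[OF simp]
    by (metis inside[OF path closed(1) wn(1)] loop_counterclockwise_def of_int_1 one_neq_neg_one wn(2) zero_neq_one)
  then show "net_winding f (of_real s) = integral {0..per h} (\<lambda>t. f (cmod (zeta h (t + per h / 2)))) / (2 * pi)"
    using \<open>flow_period f (of_real s) = ?T\<close> by (simp add: net_winding_def loop fl)
  have path': "path (\<lambda>u. - cnj (?g u))" using path unfolding path_def by (intro continuous_intros)
  have "- of_real a \<in> inside (path_image (\<lambda>u. - cnj (?g u)))"
    by (rule inside[OF path' closed(2) wn'(1)]) (use wn' in simp)
  then have "\<not> loop_counterclockwise (\<lambda>u. - cnj (?g u))"
    using wn'(2) by (force simp: loop_counterclockwise_def)
  then show "net_winding (\<lambda>s. - f s) (of_real (- s)) =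
      integral {0..per h} (\<lambda>t. f (cmod (zeta h (t + per h / 2)))) / (2 * pi)"
    using per' by (simp add: net_winding_def loop' fl')
qed

end

subsection \<open>Solutions and their representatives\<close>

text \<open>A representative together with an explicit tangent angle replaces
  \<open>curvature\<close>, which refers to a chosen one. As in \<open>is_solution\<close>, nothing
  is prescribed where the curve passes through 0.\<close>

definition sol_path :: "(real \<Rightarrow> real) \<Rightarrow> real set \<Rightarrow> (real \<Rightarrow> complex) \<Rightarrow> (real \<Rightarrow> real) \<Rightarrow> bool" where
  "sol_path f J c \<theta> \<longleftrightarrow> (J, c) \<in> arc_paths \<and> is_tangent_angle (J, c) \<theta> \<and>
     (\<forall>t\<in>J. c t \<noteq> 0 \<longrightarrow> (\<theta> has_real_derivative f (cmod (c t))) (at t))"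

lemma sol_pathI:
  assumes "open J" "is_interval J" "0 \<in> J" "smooth_on J c" "smooth_on J \<theta>"
    and "\<And>t. t \<in> J \<Longrightarrow> (c has_vector_derivative cis (\<theta> t)) (at t)"
    and "\<And>t. t \<in> J \<Longrightarrow> c t \<noteq> 0 \<Longrightarrow> (\<theta> has_real_derivative f (cmod (c t))) (at t)"
  shows "sol_path f J c \<theta>"
proof -
  have "vector_derivative c (at t) = cis (\<theta> t)" if "t \<in> J" for t
    using vector_derivative_at[OF assms(6)[OF that]] .
  then show ?thesis
    using assms unfolding sol_path_def arc_paths_def is_tangent_angle_def by auto
qed

lemma sol_pathD:
  assumes "sol_path f J c \<theta>"
  shows "(J, c) \<in> arc_paths" "open J" "is_interval J" "0 \<in> J" "smooth_on J c" "smooth_on J \<theta>"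
    and "t \<in> J \<Longrightarrow> (c has_vector_derivative cis (\<theta> t)) (at t)"
    and "t \<in> J \<Longrightarrow> c t \<noteq> 0 \<Longrightarrow> (\<theta> has_real_derivative f (cmod (c t))) (at t)"
  using assms tangent_angle_derivative[of J c \<theta> t]
  unfolding sol_path_def arc_paths_def is_tangent_angle_def by auto

lemma class_eq_of_mem:
  assumes "C \<in> oriented_curves" "p \<in> C"
  shows "p \<in> arc_paths" "C = path_equiv `` {p}"
proof -
  obtain q where q: "q \<in> arc_paths" "C = path_equiv `` {q}"
    using assms(1) unfolding oriented_curves_def by (rule quotientE)
  then have "(q, p) \<in> path_equiv" using assms(2) by auto
  then show "p \<in> arc_paths" "C = path_equiv `` {p}"
    using equiv_class_eq[OF equiv_path_equiv] equiv_type[OF equiv_path_equiv] q by auto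
qed

lemma class_of_path:
  assumes "p \<in> arc_paths"
  shows "p \<in> path_equiv `` {p}" "path_equiv `` {p} \<in> oriented_curves"
  using assms equiv_class_self[OF equiv_path_equiv] quotientI unfolding oriented_curves_def by auto

lemma oriented_curve_rep:
  assumes "C \<in> oriented_curves"
  obtains J c where "(J, c) \<in> C"
proof -
  obtain p where "p \<in> arc_paths" "C = path_equiv `` {p}"
    using assms unfolding oriented_curves_def by (rule quotientE)
  then have "(fst p, snd p) \<in> C" using class_of_path(1) by auto
  then show thesis by (rule that)
qed

lemma curve_trace_class:
  assumes "(J, c) \<in> arc_paths"
  shows "curve_trace (path_equiv `` {(J, c)}) = c ` J"
proof -
  have "c' ` J' = c ` J" if "((J, c), (J', c')) \<in> path_equiv" for J' c'
  proof -
    from that obtain \<alpha> where "J' = (\<lambda>t. \<alpha> + t) ` J" "\<forall>t\<in>J'. c' t = c (t - \<alpha>)"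
      by (auto simp: path_equiv_def)
    then have "c' ` J' = (\<lambda>t. c (t - \<alpha>)) ` (\<lambda>t. \<alpha> + t) ` J" by (intro image_cong) auto
    then show ?thesis by (simp add: image_image)
  qed
  then have "(case p of (J', c') \<Rightarrow> c' ` J') = c ` J" if "p \<in> path_equiv `` {(J, c)}" for p
    using that by (cases p) simp
  then show ?thesis
    using class_of_path(1)[OF assms] unfolding curve_trace_def by (metis (no_types, lifting) SUP_cong SUP_const empty_iff)
qed

lemma curve_trace_rep: "C \<in> oriented_curves \<Longrightarrow> (J, c) \<in> C \<Longrightarrow> curve_trace C = c ` J"
  using class_eq_of_mem[of C "(J, c)"] curve_trace_class by metis

lemma solution_sol_path:
  assumes "is_solution f C" "(J, c) \<in> C"
  shows "\<exists>\<theta>. sol_path f J c \<theta>"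
proof -
  have arc: "(J, c) \<in> arc_paths"
    using class_eq_of_mem(1) assms by (auto simp: is_solution_def)
  then obtain \<theta> where \<theta>: "is_tangent_angle (J, c) \<theta>" using tangent_angle_exists by blast
  have "(\<theta> has_real_derivative f (cmod (c t))) (at t)" if "t \<in> J" "c t \<noteq> 0" for t
    using tangent_angle_curvature[OF arc \<theta> that(1)] assms that unfolding is_solution_def by auto
  with arc \<theta> show ?thesis unfolding sol_path_def by blast
qed

lemma sol_path_shift:
  assumes "sol_path f J c \<theta>" "J' = (\<lambda>t. \<alpha> + t) ` J" "0 \<in> J'" "\<And>t. t \<in> J' \<Longrightarrow> c' t = c (t - \<alpha>)"
  shows "sol_path f J' c' (\<lambda>t. \<theta> (t - \<alpha>))"
proof -
  note s = sol_pathD[OF assms(1)]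
  have J': "J' = {t. t - \<alpha> \<in> J}" using assms(2) by force
  have op: "open J'" unfolding assms(2) using open_translation[OF s(2)] .
  have der: "((\<lambda>t. c (t - \<alpha>)) has_vector_derivative cis (\<theta> (t - \<alpha>))) (at t)"
    "c' t \<noteq> 0 \<Longrightarrow> ((\<lambda>t. \<theta> (t - \<alpha>)) has_real_derivative f (cmod (c' t))) (at t)" if t: "t \<in> J'" for t
  proof -
    have d: "((\<lambda>t. t - \<alpha>) has_vector_derivative 1) (at t)" by (auto intro!: derivative_eq_intros)
    show "((\<lambda>t. c (t - \<alpha>)) has_vector_derivative cis (\<theta> (t - \<alpha>))) (at t)"
      using vector_diff_chain_at[OF d s(7)[of "t - \<alpha>"]] t by (simp add: J' o_def)
    assume "c' t \<noteq> 0"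
    then show "((\<lambda>t. \<theta> (t - \<alpha>)) has_real_derivative f (cmod (c' t))) (at t)"
      using DERIV_shift[of \<theta> "f (cmod (c' t))" t "- \<alpha>"] s(8)[of "t - \<alpha>"] t assms(4)[OF t] by (simp add: J')
  qed
  show ?thesis
  proof (rule sol_pathI[OF op])
    show "is_interval J'" unfolding assms(2) using s(3) by simp
    show "smooth_on J' c'"
      using smooth_on_cong[OF smooth_on_shift[OF s(5), of \<alpha>] _ assms(4)] op by (simp add: J')
    show "smooth_on J' (\<lambda>t. \<theta> (t - \<alpha>))" using smooth_on_shift[OF s(6), of \<alpha>] by (simp add: J')
    show "(c' has_vector_derivative cis (\<theta> (t - \<alpha>))) (at t)" if "t \<in> J'" for t
      by (rule has_vector_derivative_transform_within_open[OF der(1)[OF that] op that]) (simp add: assms(4))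
  qed (use assms(3) der(2) in auto)
qed

lemma sol_path_solution:
  assumes "sol_path f J c \<theta>"
  shows "is_solution f (path_equiv `` {(J, c)})"
proof -
  have arc: "(J, c) \<in> arc_paths" using sol_pathD(1)[OF assms] .
  have "curvature (J', c') t = f (cmod (c' t))"
    if e: "((J, c), (J', c')) \<in> path_equiv" and t: "t \<in> J'" "c' t \<noteq> 0" for J' c' t
  proof -
    obtain \<alpha> where "J' = (\<lambda>t. \<alpha> + t) ` J" "\<forall>t\<in>J'. c' t = c (t - \<alpha>)" "(J', c') \<in> arc_paths"
      using e by (auto simp: path_equiv_def)
    then have s: "sol_path f J' c' (\<lambda>t. \<theta> (t - \<alpha>))"
      using assms by (intro sol_path_shift) (auto simp: arc_paths_def)
    then have "is_tangent_angle (J', c') (\<lambda>t. \<theta> (t - \<alpha>))" by (simp add: sol_path_def)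
    from DERIV_unique[OF tangent_angle_curvature[OF sol_pathD(1)[OF s] this t(1)] sol_pathD(8)[OF s t]]
    show ?thesis .
  qed
  then show ?thesis
    using class_of_path(2)[OF arc] unfolding is_solution_def by auto
qed

text \<open>This is how maximality is exploited: continuing a representative to a larger interval
  adds no points.\<close>

lemma maximal_solution_trace:
  assumes "maximal_solution f C" "(J, c) \<in> C" "sol_path f J' g \<theta>" "c ` J \<subseteq> g ` J'"
  shows "c ` J = g ` J'"
proof -
  have C: "curve_trace C = c ` J"
    using assms(1,2) by (intro curve_trace_rep) (auto simp: maximal_solution_def is_solution_def)
  have "curve_trace (path_equiv `` {(J', g)}) = g ` J'"
    by (rule curve_trace_class[OF sol_pathD(1)[OF assms(3)]])
  then show ?thesis
    using assms(1,4) sol_path_solution[OF assms(3)] C unfolding maximal_solution_def by metis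
qed

lemma sol_path_rotate:
  assumes "sol_path f J c \<theta>"
  shows "sol_path f J (\<lambda>t. cis \<alpha> * c t) (\<lambda>t. \<theta> t + \<alpha>)"
proof (rule sol_pathI)
  note s = sol_pathD[OF assms]
  show "open J" "is_interval J" "0 \<in> J" using s by auto
  show "smooth_on J (\<lambda>t. cis \<alpha> * c t)" by (rule smooth_on_linear[OF s(5) bounded_linear_mult_right])
  obtain k where k: "smooth_on J k" "\<forall>t\<in>J. (\<theta> has_vector_derivative k t) (at t)"
    using smooth_on_derivative[OF s(6)] by blast
  have "((\<lambda>t. \<theta> t + \<alpha>) has_vector_derivative k t) (at t)" if "t \<in> J" for t
    using k(2) that by (auto intro!: derivative_eq_intros)
  then show "smooth_on J (\<lambda>t. \<theta> t + \<alpha>)" by (rule smooth_on_antiderivative[OF k(1)])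
  show "((\<lambda>t. cis \<alpha> * c t) has_vector_derivative cis (\<theta> t + \<alpha>)) (at t)" if "t \<in> J" for t
    using bounded_linear.has_vector_derivative[OF bounded_linear_mult_right s(7)[OF that], of "cis \<alpha>"]
    by (simp add: cis_mult add.commute)
  show "((\<lambda>t. \<theta> t + \<alpha>) has_real_derivative f (cmod (cis \<alpha> * c t))) (at t)"
    if "t \<in> J" "cis \<alpha> * c t \<noteq> 0" for t
    using s(8)[OF that(1)] that(2) by (auto simp: norm_mult intro!: derivative_eq_intros)
qed

text \<open>The algebra generated by these functions is closed under differentiation, because \<open>c\<close> and
  \<open>\<theta>\<close> satisfy a smooth autonomous system away from the origin.\<close>

lemma smooth_bootstrap:
  fixes f :: "real \<Rightarrow> real"
  assumes f: "smooth_on {0<..} f"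
    and c: "\<And>t. t \<in> S \<Longrightarrow> (c has_vector_derivative cis (\<theta> t)) (at t)" "\<And>t. t \<in> S \<Longrightarrow> c t \<noteq> 0"
    and \<theta>: "\<And>t. t \<in> S \<Longrightarrow> (\<theta> has_real_derivative f (cmod (c t))) (at t)"
  shows "smooth_on S c" "smooth_on S \<theta>"
proof -
  obtain D where D: "D 0 = f" "\<And>n s. 0 < s \<Longrightarrow> (D n has_vector_derivative D (Suc n) s) (at s)"
    using f unfolding smooth_on_def by auto
  define e where "e t = cis (\<theta> t)" for t
  define \<nu> where "\<nu> t = complex_of_real (inverse (cmod (c t)))" for t
  define F where "F n t = complex_of_real (D n (cmod (c t)))" for n t
  \<comment> \<open>Differentiating the modulus of \<open>c\<close> produces the conjugates and the
    factor \<nu>, and the chain rule brings in all derivatives \<open>F n\<close> of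
    \<open>f\<close>.\<close>
  define \<Gamma> where "\<Gamma> = {c, \<lambda>t. cnj (c t), e, \<lambda>t. cnj (e t), \<nu>} \<union> range F"
  have gens: "c \<in> fun_algebra \<Gamma>" "(\<lambda>t. cnj (c t)) \<in> fun_algebra \<Gamma>" "e \<in> fun_algebra \<Gamma>"
    "(\<lambda>t. cnj (e t)) \<in> fun_algebra \<Gamma>" "\<nu> \<in> fun_algebra \<Gamma>" "\<And>n. F n \<in> fun_algebra \<Gamma>"
    by (auto intro!: fun_algebra.gen simp: \<Gamma>_def)
  note alg = gens fun_algebra.add fun_algebra.mult fun_algebra.const
  define \<rho>' where "\<rho>' t = (1/2) * ((cnj (c t) * e t + c t * cnj (e t)) * \<nu> t)" for t
  have \<rho>': "\<rho>' \<in> fun_algebra \<Gamma>" unfolding \<rho>'_def by (intro alg)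
  have r: "((\<lambda>t. cmod (c t)) has_real_derivative Re (\<rho>' t)) (at t)" "\<rho>' t = of_real (Re (\<rho>' t))"
    if t: "t \<in> S" for t
  proof -
    have "((\<lambda>t. norm (c t)) has_derivative (\<lambda>k. (k *\<^sub>R cis (\<theta> t)) \<bullet> sgn (c t))) (at t)"
      using has_derivative_compose[OF c(1)[OF t, unfolded has_vector_derivative_def]
          has_derivative_norm[OF c(2)[OF t]]] .
    moreover have "(\<lambda>k. (k *\<^sub>R cis (\<theta> t)) \<bullet> sgn (c t)) = (*) (Re (\<rho>' t))"
      using c(2)[OF t] by (auto simp: fun_eq_iff \<rho>'_def e_def \<nu>_def inner_complex_def sgn_div_norm field_simps)
    ultimately show "((\<lambda>t. cmod (c t)) has_real_derivative Re (\<rho>' t)) (at t)"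
      by (simp add: has_field_derivative_def)
    show "\<rho>' t = of_real (Re (\<rho>' t))"
      by (simp add: complex_eq_iff \<rho>'_def \<nu>_def)
  qed
  have of_real: "((\<lambda>t. complex_of_real (g t)) has_vector_derivative of_real g') (at t)"
    if "(g has_real_derivative g') (at t)" for g g' t
    using bounded_linear.has_vector_derivative[OF bounded_linear_of_real, of g g' "at t"] that
    by (simp add: has_real_derivative_iff_has_vector_derivative)
  have dF: "(F n has_vector_derivative F (Suc n) t * \<rho>' t) (at t)" if t: "t \<in> S" for n t
  proof -
    have "(D n has_real_derivative D (Suc n) (cmod (c t))) (at (cmod (c t)))"
      using D(2)[of "cmod (c t)" n] c(2)[OF t] by (simp add: has_real_derivative_iff_has_vector_derivative)
    from of_real[OF DERIV_chain2[OF this r(1)[OF t]]] show ?thesis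
      using r(2)[OF t] by (simp add: F_def[abs_def])
  qed
  have d\<nu>: "(\<nu> has_vector_derivative (- 1) * (\<nu> t * (\<nu> t * \<rho>' t))) (at t)" if t: "t \<in> S" for t
  proof -
    have "((\<lambda>t. inverse (cmod (c t))) has_real_derivative
        - (inverse (cmod (c t)) * Re (\<rho>' t) * inverse (cmod (c t)))) (at t)"
      using DERIV_inverse'[OF r(1)[OF t]] c(2)[OF t] by simp
    from of_real[OF this] show ?thesis
      using r(2)[OF t] by (simp add: \<nu>_def[abs_def] mult_ac)
  qed
  have de: "(e has_vector_derivative \<i> * (F 0 t * e t)) (at t)" if t: "t \<in> S" for t
    using cis_real_derivative[OF \<theta>[OF t]] by (simp add: e_def[abs_def] F_def D(1) mult.assoc)
  have dcnje: "((\<lambda>t. cnj (e t)) has_vector_derivative (- \<i>) * (F 0 t * cnj (e t))) (at t)" if t: "t \<in> S" for t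
    using has_vector_derivative_cnj[OF de[OF t]] by (simp add: F_def)
  have sm: "smooth_on S g" if "g \<in> fun_algebra \<Gamma>" for g
  proof (rule smooth_on_fun_algebra[OF that])
    fix g assume "g \<in> \<Gamma>"
    then consider "g = c" | "g = (\<lambda>t. cnj (c t))" | "g = e" | "g = (\<lambda>t. cnj (e t))" | "g = \<nu>"
      | n where "g = F n" by (auto simp: \<Gamma>_def)
    then show "\<exists>g'\<in>fun_algebra \<Gamma>. \<forall>t\<in>S. (g has_vector_derivative g' t) (at t)"
    proof cases
      case 1
      show ?thesis unfolding 1 by (rule bexI[of _ e]) (use c(1) gens in \<open>auto simp: e_def\<close>)
    next
      case 2
      show ?thesis unfolding 2
        by (rule bexI[of _ "\<lambda>t. cnj (e t)"]) (use c(1) gens in \<open>auto simp: e_def intro!: has_vector_derivative_cnj\<close>)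
    next
      case 3
      show ?thesis unfolding 3
        by (rule bexI[of _ "\<lambda>t. \<i> * (F 0 t * e t)"]) (use de in blast, intro alg)
    next
      case 4
      show ?thesis unfolding 4
        by (rule bexI[of _ "\<lambda>t. (- \<i>) * (F 0 t * cnj (e t))"]) (use dcnje in blast, intro alg)
    next
      case 5
      show ?thesis unfolding 5
        by (rule bexI[of _ "\<lambda>t. (- 1) * (\<nu> t * (\<nu> t * \<rho>' t))"]) (use d\<nu> in blast, intro alg \<rho>')
    next
      case 6
      show ?thesis unfolding 6
        by (rule bexI[of _ "\<lambda>t. F (Suc n) t * \<rho>' t"]) (use dF in blast, intro alg \<rho>')
    qed
  qed
  show "smooth_on S c" by (intro sm gens)
  have "smooth_on S (\<lambda>t. Re (F 0 t))"
    by (rule smooth_on_linear[OF sm bounded_linear_Re]) (rule gens)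
  then show "smooth_on S \<theta>"
    by (rule smooth_on_antiderivative)
      (use \<theta> in \<open>simp add: F_def D(1) has_real_derivative_iff_has_vector_derivative\<close>)
qed

lemma sol_path_bootstrap:
  assumes "smooth_on {0<..} f" "open J" "is_interval J" "0 \<in> J"
    and "\<And>t. t \<in> J \<Longrightarrow> (c has_vector_derivative cis (\<theta> t)) (at t)" "\<And>t. t \<in> J \<Longrightarrow> c t \<noteq> 0"
    and "\<And>t. t \<in> J \<Longrightarrow> (\<theta> has_real_derivative f (cmod (c t))) (at t)"
  shows "sol_path f J c \<theta>"
  using smooth_bootstrap[OF assms(1,5-7)] assms by (intro sol_pathI) auto

subsection \<open>Reduction of solutions to orbits\<close>

text \<open>\<open>frame c \<theta>\<close> is the position vector in the moving frame of the curve, up to a reflection.\<close>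

definition frame :: "(real \<Rightarrow> complex) \<Rightarrow> (real \<Rightarrow> real) \<Rightarrow> real \<Rightarrow> complex" where
  "frame c \<theta> t = - \<i> * cnj (c t) * cis (\<theta> t)"

lemma cmod_frame: "cmod (frame c \<theta> t) = cmod (c t)"
  by (simp add: frame_def norm_mult)

lemma frame_inverse: "c t = - \<i> * cnj (frame c \<theta> t) * cis (\<theta> t)"
proof -
  have "cnj (cis (\<theta> t)) * cis (\<theta> t) = 1" by (simp add: cis_cnj cis_mult)
  then have "c t * (cnj (cis (\<theta> t)) * cis (\<theta> t)) = c t" by simp
  then show ?thesis by (simp add: frame_def algebra_simps)
qed

lemma frame_eq_0: "frame c \<theta> t = 0 \<longleftrightarrow> c t = 0"
  using cmod_frame[of c \<theta> t] by (metis norm_eq_zero)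

lemma cnj_mult_tangent: "cnj (c t) * cis (\<theta> t) = \<i> * frame c \<theta> t"
  by (simp add: frame_def flip: mult.assoc)

lemma finite_zeros_sol_path:
  assumes "sol_path f J c \<theta>" "p \<in> J" "q \<in> J"
  shows "finite {t\<in>{p..q}. c t = 0}"
proof (rule finite_zeros_regular)
  fix t assume "t \<in> {p..q}"
  then have "t \<in> J" using mem_is_interval_1_I[OF sol_pathD(3)[OF assms(1)] assms(2,3)] by auto
  then show "(c has_vector_derivative cis (\<theta> t)) (at t)" by (rule sol_pathD(7)[OF assms(1)])
qed simp

context attractive_curvature
begin

text \<open>The term with \<open>f\<close> comes from the rotation of the tangent, the constant from
  the unit speed. The unreflected frame would satisfy the time-reversed equation.\<close>

lemma frame_ode:
  assumes "(c has_vector_derivative cis (\<theta> t)) (at t)" "(\<theta> has_real_derivative f (cmod (c t))) (at t)"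
  shows "(frame c \<theta> has_vector_derivative \<i> * grad (frame c \<theta> t)) (at t)"
proof -
  have "((\<lambda>t. cnj (c t) * cis (\<theta> t)) has_vector_derivative
      (cnj (c t) * (\<i> * of_real (f (cmod (c t))) * cis (\<theta> t)) + cnj (cis (\<theta> t)) * cis (\<theta> t))) (at t)"
    by (intro has_vector_derivative_mult has_vector_derivative_cnj assms(1) cis_real_derivative[OF assms(2)])
  from bounded_linear.has_vector_derivative[OF bounded_linear_mult_right[of "- \<i>"] this]
  have "(frame c \<theta> has_vector_derivative
      - \<i> * (cnj (c t) * (\<i> * of_real (f (cmod (c t))) * cis (\<theta> t)) + cnj (cis (\<theta> t)) * cis (\<theta> t))) (at t)"
    by (simp add: frame_def[abs_def] mult.assoc)
  moreover have "cnj (cis (\<theta> t)) * cis (\<theta> t) = 1" by (simp add: cis_cnj cis_mult)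
  ultimately show ?thesis
    unfolding grad_def cmod_frame by (simp add: frame_def algebra_simps)
qed

lemma curve_of_frame:
  assumes "(z has_vector_derivative \<i> * grad (z t)) (at t)" "(\<theta> has_real_derivative f (cmod (z t))) (at t)"
  shows "((\<lambda>t. - \<i> * cnj (z t) * cis (\<theta> t)) has_vector_derivative cis (\<theta> t)) (at t)"
proof -
  have "((\<lambda>t. cnj (z t) * cis (\<theta> t)) has_vector_derivative
      (cnj (z t) * (\<i> * of_real (f (cmod (z t))) * cis (\<theta> t)) + cnj (\<i> * grad (z t)) * cis (\<theta> t))) (at t)"
    by (intro has_vector_derivative_mult has_vector_derivative_cnj assms(1) cis_real_derivative[OF assms(2)])
  from bounded_linear.has_vector_derivative[OF bounded_linear_mult_right[of "- \<i>"] this]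
  show ?thesis by (simp add: mult.assoc grad_def algebra_simps)
qed

lemma continuous_on_frame:
  assumes "continuous_on S c" "continuous_on S \<theta>"
  shows "continuous_on S (frame c \<theta>)"
proof -
  have "continuous_on S (\<lambda>t. cis (\<theta> t))"
    by (rule continuous_on_compose2[OF _ assms(2), of UNIV cis]) (auto intro: continuous_intros)
  then show ?thesis unfolding frame_def[abs_def] by (intro continuous_intros assms)
qed

text \<open>A curve of unit speed has only finitely many zeros in a compact interval, so
  \<open>orbit_equation\<close> applies as soon as the frame leaves the equilibrium at one
  parameter.\<close>

lemma frame_cases:
  assumes "sol_path f J c \<theta>"
  obtains (fixed) "\<And>t. t \<in> J \<Longrightarrow> frame c \<theta> t = of_real a"
    | (orbit) h d where "ham_min < h" "\<And>t. t \<in> J \<Longrightarrow> frame c \<theta> t = zeta h (t + d)"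
proof (cases "\<forall>t\<in>J. frame c \<theta> t = of_real a")
  case True
  then show ?thesis using fixed by blast
next
  case False
  then obtain t0 where t0: "t0 \<in> J" "frame c \<theta> t0 \<noteq> of_real a" by blast
  note s = sol_pathD[OF assms]
  have "\<exists>d. \<forall>t\<in>J. frame c \<theta> t = zeta (ham (frame c \<theta> t0)) (t + d)"
  proof (rule orbit_equation[where z = "frame c \<theta>", OF s(2,3) _ _ _ t0])
    show "continuous_on J (frame c \<theta>)"
      by (intro continuous_on_frame smooth_on_continuous s)
    show "finite {t \<in> {p..q}. frame c \<theta> t = 0}" if "p \<in> J" "q \<in> J" for p q
      using finite_zeros_sol_path[OF assms that] by (simp add: frame_eq_0)
    show "(frame c \<theta> has_vector_derivative \<i> * grad (frame c \<theta> t)) (at t)"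
      if "t \<in> J" "frame c \<theta> t \<noteq> 0" for t
      using that by (intro frame_ode s(7,8)) (auto simp: frame_eq_0)
  qed
  then show ?thesis using orbit[OF ham_gt_min[OF t0(2)]] by blast
qed

end

subsection \<open>The curve of a given level\<close>

text \<open>\<open>\<kappa>\<close> is the curvature \<open>f(r)\<close> along the curve; when the curve runs through \<open>0\<close> its value there is
  determined by continuity.\<close>

locale pre_rosette = attractive_curvature +
  fixes h :: real and \<kappa> \<theta> :: "real \<Rightarrow> real"
  assumes h: "ham_min < h"
    and \<kappa>_cont: "continuous_on UNIV \<kappa>"
    and \<kappa>_eq: "zeta h t \<noteq> 0 \<Longrightarrow> \<kappa> t = f (cmod (zeta h t))"
    and \<theta>_derivative: "(\<theta> has_real_derivative \<kappa> t) (at t)"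
    and \<theta>_0: "\<theta> 0 = pi / 2"
begin

definition turn :: real where "turn = \<theta> (per h) - \<theta> 0"

definition cur :: "real \<Rightarrow> complex" where "cur t = - \<i> * cnj (zeta h t) * cis (\<theta> t)"

lemma cmod_cur: "cmod (cur t) = cmod (zeta h t)"
  by (simp add: cur_def norm_mult)

lemma cur_eq_0: "cur t = 0 \<longleftrightarrow> zeta h t = 0"
  using cmod_cur[of t] by (metis norm_eq_zero)

lemma frame_cur: "frame cur \<theta> t = zeta h t"
proof -
  have "cnj (cis (\<theta> t)) * cis (\<theta> t) = 1" by (simp add: cis_cnj cis_mult)
  then have "zeta h t * (cnj (cis (\<theta> t)) * cis (\<theta> t)) = zeta h t" by simp
  then show ?thesis by (simp add: frame_def cur_def algebra_simps)
qed

lemma continuous_on_\<theta>: "continuous_on S \<theta>"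
  using \<theta>_derivative DERIV_isCont continuous_at_imp_continuous_on by blast

lemma continuous_on_cis_\<theta>: "continuous_on S (\<lambda>t. cis (\<theta> t))"
  by (rule continuous_on_compose2[OF _ continuous_on_\<theta>, of UNIV cis]) (auto intro: continuous_intros)

lemma continuous_on_cur: "continuous_on S cur"
  unfolding cur_def[abs_def] by (intro continuous_intros continuous_on_zeta h continuous_on_cis_\<theta>)

lemma finite_zeros_zeta: "finite {t\<in>{p..q}. zeta h t = 0}"
proof (cases "\<exists>t0. zeta h t0 = 0")
  case True
  then obtain t0 where t0: "zeta h t0 = 0" by blast
  note T = per_pos[OF h]
  have "{t\<in>{p..q}. zeta h t = 0} \<subseteq> (\<lambda>k::int. t0 + of_int k * per h) ` {\<lfloor>(p - t0) / per h\<rfloor>..\<lceil>(q - t0) / per h\<rceil>}"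
  proof clarify
    fix t assume t: "t \<in> {p..q}" "zeta h t = 0"
    then obtain k :: int where k: "t = t0 + of_int k * per h"
      using zeta_eq_iff[OF h, of t t0] t0 by auto
    then have "of_int k = (t - t0) / per h" using T by simp
    then have "(p - t0) / per h \<le> of_int k" "of_int k \<le> (q - t0) / per h"
      using t(1) T by (simp_all add: divide_right_mono)
    then have "k \<in> {\<lfloor>(p - t0) / per h\<rfloor>..\<lceil>(q - t0) / per h\<rceil>}"
      by (simp add: floor_le_iff le_ceiling_iff)
    then show "t \<in> (\<lambda>k::int. t0 + of_int k * per h) ` {\<lfloor>(p - t0) / per h\<rfloor>..\<lceil>(q - t0) / per h\<rceil>}"
      using k by blast
  qed
  then show ?thesis by (rule finite_subset) simp
qed simp

text \<open>At the zeros of \<open>zeta\<close> the frame need not be differentiable. There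
  \<open>cur\<close> is compared with a primitive of \<open>cis \<theta>\<close>, from which it
  differs by a continuous function with zero derivative off a locally finite set.\<close>

lemma cur_derivative: "(cur has_vector_derivative cis (\<theta> t)) (at t)"
proof -
  have off: "(cur has_vector_derivative cis (\<theta> t)) (at t)" if nz: "zeta h t \<noteq> 0" for t
  proof -
    have k: "(\<theta> has_real_derivative f (cmod (zeta h t))) (at t)"
      using \<theta>_derivative[of t] \<kappa>_eq[OF nz] by simp
    show ?thesis
      using curve_of_frame[of "zeta h" t \<theta>, OF zeta_derivative[OF h nz] k] by (simp add: cur_def[abs_def])
  qed
  obtain A where A: "\<And>t. (A has_vector_derivative cis (\<theta> t)) (at t)"
    using antiderivative_on_interval[of UNIV "\<lambda>t. cis (\<theta> t)"] continuous_on_cis_\<theta> by auto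
  have "cur s - A s = cur 0 - A 0" for s
  proof (rule zero_derivative_constant[of UNIV "\<lambda>t. cur t - A t" "\<lambda>t. zeta h t = 0"])
    have "continuous_on UNIV A"
      using A has_vector_derivative_continuous continuous_at_imp_continuous_on by blast
    then show "continuous_on UNIV (\<lambda>t. cur t - A t)" by (intro continuous_intros continuous_on_cur)
    show "((\<lambda>t. cur t - A t) has_vector_derivative 0) (at t)" if "zeta h t \<noteq> 0" for t
      using has_vector_derivative_diff[OF off[OF that] A[of t]] by simp
  qed (use finite_zeros_zeta in auto)
  then have "cur = (\<lambda>s. A s + (cur 0 - A 0))" by (auto simp: fun_eq_iff algebra_simps)
  then show ?thesis
    using has_vector_derivative_add[OF A[of t] has_vector_derivative_const[of "cur 0 - A 0"]] by simp
qed

section \<open>Reflection and rotation symmetry of the rosette\<close>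

lemma \<theta>_uminus: "\<theta> (- t) = pi - \<theta> t"
proof -
  define g where "g t = \<theta> t + \<theta> (- t)" for t
  have "g t = g 0"
  proof (rule zero_derivative_constant[of UNIV g "\<lambda>t. zeta h t = 0"])
    show "continuous_on UNIV g"
      unfolding g_def
      by (intro continuous_intros continuous_on_\<theta> continuous_on_compose2[OF continuous_on_\<theta>[of UNIV]]) auto
    fix t assume nz: "zeta h t \<noteq> 0"
    have "((\<lambda>t. \<theta> (- t)) has_real_derivative - \<kappa> (- t)) (at t)"
      using DERIV_mirror[of \<theta> "\<kappa> (- t)" t] \<theta>_derivative[of "- t"] by simp
    then have "(g has_real_derivative \<kappa> t + (- \<kappa> (- t))) (at t)"
      unfolding g_def by (intro DERIV_add \<theta>_derivative)
    moreover have "\<kappa> (- t) = \<kappa> t" using \<kappa>_eq[of t] \<kappa>_eq[of "- t"] nz by (simp add: zeta_uminus[OF h])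
    ultimately show "(g has_vector_derivative 0) (at t)"
      by (simp add: has_real_derivative_iff_has_vector_derivative)
  qed (use finite_zeros_zeta in auto)
  then show ?thesis by (simp add: g_def \<theta>_0)
qed

lemma \<theta>_periodic: "\<theta> (t + per h) = \<theta> t + turn"
proof -
  define g where "g t = \<theta> (t + per h) - \<theta> t" for t
  have z: "zeta h (t + per h) = zeta h t" for t using zeta_periodic[OF h, of t 1] by simp
  have "g t = g 0"
  proof (rule zero_derivative_constant[of UNIV g "\<lambda>t. zeta h t = 0"])
    show "continuous_on UNIV g"
      unfolding g_def
      by (intro continuous_intros continuous_on_\<theta> continuous_on_compose2[OF continuous_on_\<theta>[of UNIV]]) auto
    fix t assume nz: "zeta h t \<noteq> 0"
    have "((\<lambda>t. \<theta> (t + per h)) has_real_derivative \<kappa> (t + per h)) (at t)"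
      using DERIV_shift[of \<theta> "\<kappa> (t + per h)" t "per h"] \<theta>_derivative[of "t + per h"] by simp
    then have "(g has_real_derivative \<kappa> (t + per h) - \<kappa> t) (at t)"
      unfolding g_def by (intro DERIV_diff \<theta>_derivative)
    moreover have "\<kappa> (t + per h) = \<kappa> t" using \<kappa>_eq[of t] \<kappa>_eq[of "t + per h"] nz z by simp
    ultimately show "(g has_vector_derivative 0) (at t)"
      by (simp add: has_real_derivative_iff_has_vector_derivative)
  qed (use finite_zeros_zeta in auto)
  then show ?thesis by (simp add: g_def turn_def)
qed

lemma \<theta>_periodic_int: "\<theta> (t + of_int k * per h) = \<theta> t + of_int k * turn"
proof -
  have nat: "\<theta> (t + real n * per h) = \<theta> t + real n * turn" for n t
  proof (induction n)
    case (Suc n)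
    then show ?case using \<theta>_periodic[of "t + real n * per h"] by (simp add: algebra_simps)
  qed simp
  show ?thesis
  proof (cases "0 \<le> k")
    case True
    then show ?thesis using nat[of t "nat k"] by simp
  next
    case False
    then show ?thesis using nat[of "t + of_int k * per h" "nat (- k)"] by simp
  qed
qed

lemma cur_uminus: "cur (- t) = cnj (cur t)"
proof -
  have "cis (\<theta> (- t)) = - cnj (cis (\<theta> t))" by (simp add: \<theta>_uminus complex_eq_iff)
  then show ?thesis by (simp add: cur_def zeta_uminus[OF h])
qed

lemma cur_periodic_int: "cur (t + of_int k * per h) = cis (of_int k * turn) * cur t"
  unfolding cur_def zeta_periodic[OF h] \<theta>_periodic_int by (simp add: cis_mult[symmetric])

lemma \<theta>_half: "\<theta> (per h / 2) = pi / 2 + turn / 2"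
  using \<theta>_uminus[of "per h / 2"] \<theta>_periodic[of "- (per h / 2)"] by simp

lemma zeta_half_nonzero: "0 < t \<Longrightarrow> t < per h / 2 \<Longrightarrow> zeta h t \<noteq> 0"
  using Im_zeta_pos[OF h, of t] by auto

lemma turn_pos: "0 < turn"
proof -
  have "\<theta> 0 < \<theta> (per h / 2)"
  proof (rule DERIV_pos_imp_increasing_open[where f = \<theta> and a = 0 and b = "per h / 2"])
    fix x assume "0 < x" "x < per h / 2"
    then have nz: "zeta h x \<noteq> 0" by (rule zeta_half_nonzero)
    then show "\<exists>y. (\<theta> has_real_derivative y) (at x) \<and> 0 < y"
      using \<theta>_derivative[of x] \<kappa>_eq[OF nz] f_pos[of "cmod (zeta h x)"] by auto
  qed (use per_pos[OF h] continuous_on_\<theta> in auto)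
  then show ?thesis using \<theta>_half \<theta>_0 by simp
qed

lemma reduce_period: obtains k :: int and u where "t = u + of_int k * per h" "\<bar>u\<bar> \<le> per h / 2"
proof
  let ?k = "round (t / per h)"
  note T = per_pos[OF h]
  show "t = (t - of_int ?k * per h) + of_int ?k * per h" by simp
  have "\<bar>of_int ?k - t / per h\<bar> \<le> 1/2" by (rule of_int_round_abs_le)
  then have "\<bar>of_int ?k - t / per h\<bar> * per h \<le> 1/2 * per h" using T by (intro mult_right_mono) auto
  moreover have "\<bar>of_int ?k - t / per h\<bar> * per h = \<bar>(of_int ?k - t / per h) * per h\<bar>" using T by (simp add: abs_mult)
  moreover have "(of_int ?k - t / per h) * per h = - (t - of_int ?k * per h)"
    using T by (simp add: algebra_simps)
  then have "\<bar>(of_int ?k - t / per h) * per h\<bar> = \<bar>t - of_int ?k * per h\<bar>" by (simp only: abs_minus_cancel)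
  ultimately show "\<bar>t - of_int ?k * per h\<bar> \<le> per h / 2" by simp
qed

lemma cmod_zeta_abs: "cmod (zeta h \<bar>u\<bar>) = cmod (zeta h u)"
  using zeta_uminus[OF h, of u] by (simp add: abs_if)

lemma cmod_zeta_max: "cmod (zeta h t) = cmod (zeta h 0) \<Longrightarrow> \<exists>k::int. t = of_int k * per h"
proof -
  assume eq: "cmod (zeta h t) = cmod (zeta h 0)"
  obtain k :: int and u where u: "t = u + of_int k * per h" "\<bar>u\<bar> \<le> per h / 2" by (rule reduce_period)
  then have "cmod (zeta h \<bar>u\<bar>) = cmod (zeta h 0)" using eq zeta_periodic[OF h] by (simp add: cmod_zeta_abs)
  then have "u = 0" using cmod_zeta_decreasing[OF h, of 0 "\<bar>u\<bar>"] u(2) by force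
  then show ?thesis using u by auto
qed

lemma cmod_zeta_min: "cmod (zeta h (per h / 2)) \<le> cmod (zeta h t)"
proof -
  obtain k :: int and u where u: "t = u + of_int k * per h" "\<bar>u\<bar> \<le> per h / 2" by (rule reduce_period)
  have "cmod (zeta h (per h / 2)) \<le> cmod (zeta h \<bar>u\<bar>)"
  proof (cases "\<bar>u\<bar> = per h / 2")
    case False
    then show ?thesis using cmod_zeta_decreasing[OF h, of "\<bar>u\<bar>" "per h / 2"] u(2) by simp
  qed (simp only: order.refl)
  then show ?thesis using u(1) zeta_periodic[OF h] by (simp add: cmod_zeta_abs)
qed

text \<open>Both angles have derivative \<open>f\<close> of the same modulus off the zeros, so they
  differ by a constant \<alpha>. Frame and angle together determine the position.\<close>

lemma rigid:
  assumes "sol_path f J c \<psi>" "\<And>t. t \<in> J \<Longrightarrow> frame c \<psi> t = zeta h (t + d)"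
  shows "\<exists>\<alpha>. \<forall>t\<in>J. c t = cis \<alpha> * cur (t + d) \<and> \<psi> t = \<theta> (t + d) + \<alpha>"
proof -
  note s = sol_pathD[OF assms(1)]
  define \<alpha> where "\<alpha> = \<psi> 0 - \<theta> (0 + d)"
  have "\<psi> t - \<theta> (t + d) = \<alpha>" if t: "t \<in> J" for t
    unfolding \<alpha>_def
  proof (rule zero_derivative_constant[of J "\<lambda>t. \<psi> t - \<theta> (t + d)" "\<lambda>t. c t = 0"])
    show "continuous_on J (\<lambda>t. \<psi> t - \<theta> (t + d))"
      by (intro continuous_intros smooth_on_continuous s continuous_on_compose2[OF continuous_on_\<theta>[of UNIV]]) auto
    fix t assume t: "t \<in> J" "c t \<noteq> 0"
    have "cmod (c t) = cmod (zeta h (t + d))" using assms(2)[OF t(1)] cmod_frame[of c \<psi> t] by simp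
    moreover then have "zeta h (t + d) \<noteq> 0" using t(2) by (metis norm_eq_zero)
    ultimately have "\<kappa> (t + d) = f (cmod (c t))" using \<kappa>_eq[of "t + d"] by simp
    then have "((\<lambda>t. \<theta> (t + d)) has_real_derivative f (cmod (c t))) (at t)"
      using DERIV_shift[of \<theta> "\<kappa> (t + d)" t d] \<theta>_derivative[of "t + d"] by simp
    from DERIV_diff[OF s(8)[OF t] this]
    show "((\<lambda>t. \<psi> t - \<theta> (t + d)) has_vector_derivative 0) (at t)"
      by (simp add: has_real_derivative_iff_has_vector_derivative)
  qed (use s that finite_zeros_sol_path[OF assms(1)] in auto)
  then have \<psi>: "\<psi> t = \<theta> (t + d) + \<alpha>" if "t \<in> J" for t using that by force
  have "c t = cis \<alpha> * cur (t + d)" if "t \<in> J" for t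
    using frame_inverse[of c t \<psi>] assms(2)[OF that] \<psi>[OF that] by (simp add: cur_def cis_mult[symmetric])
  with \<psi> show ?thesis by blast
qed

end

text \<open>On levels other than 0 the assumption can be derived. On level 0 the smoothness of
  \<open>cur\<close> at the origin has to be inherited from a given solution that passes through
  it.\<close>

locale rosette = pre_rosette +
  assumes sol: "sol_path f UNIV cur \<theta>"
begin

lemma sol_rotated: "sol_path f UNIV (\<lambda>t. cis \<alpha> * cur (t + d)) (\<lambda>t. \<theta> (t + d) + \<alpha>)"
proof -
  have "UNIV = (\<lambda>t. - d + t) ` UNIV" by simp
  from sol_path_shift[OF sol this, of "\<lambda>t. cur (t + d)"]
  have "sol_path f UNIV (\<lambda>t. cur (t + d)) (\<lambda>t. \<theta> (t + d))" by simp
  then show ?thesis by (rule sol_path_rotate)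
qed

end

context attractive_curvature
begin

lemma pre_rosette_exists:
  assumes "ham_min < h" "continuous_on UNIV \<kappa>" "\<And>t. zeta h t \<noteq> 0 \<Longrightarrow> \<kappa> t = f (cmod (zeta h t))"
  shows "\<exists>\<theta>. pre_rosette f a h \<kappa> \<theta>"
proof -
  obtain g where "\<And>t. (g has_vector_derivative \<kappa> t) (at t)"
    using antiderivative_on_interval[of UNIV \<kappa>] assms(2) by auto
  then have g: "((\<lambda>t. g t - g 0 + pi / 2) has_real_derivative \<kappa> t) (at t)" for t
    by (auto simp: has_real_derivative_iff_has_vector_derivative intro!: derivative_eq_intros)
  have "pre_rosette f a h \<kappa> (\<lambda>t. g t - g 0 + pi / 2)"
    using assms g by unfold_locales auto
  then show ?thesis by blast
qed

lemma rosette_exists: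
  assumes "ham_min < h" "h \<noteq> 0"
  shows "\<exists>\<kappa> \<theta>. rosette f a h \<kappa> \<theta>"
proof -
  have nz: "zeta h t \<noteq> 0" for t using ham_zeta[OF assms(1), of t] assms(2) ham_0 by auto
  define \<kappa> where "\<kappa> t = f (cmod (zeta h t))" for t
  have "isCont \<kappa> t" for t
    unfolding \<kappa>_def using nz
    by (intro isCont_o2[OF _ isCont_f] continuous_intros isCont_zeta[OF assms(1)]) auto
  then have "continuous_on UNIV \<kappa>" by (simp add: continuous_at_imp_continuous_on)
  then obtain \<theta> where "pre_rosette f a h \<kappa> \<theta>"
    using pre_rosette_exists[OF assms(1), of \<kappa>] \<kappa>_def by blast
  then interpret pre_rosette f a h \<kappa> \<theta> .
  have "sol_path f UNIV cur \<theta>"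
    by (rule sol_path_bootstrap[OF f_smooth])
      (use cur_derivative \<theta>_derivative nz in \<open>auto simp: cur_eq_0 cmod_cur \<kappa>_def\<close>)
  then have "rosette f a h \<kappa> \<theta>" by unfold_locales
  then show ?thesis by blast
qed

text \<open>The smooth angle of the given solution provides a curvature at its zero
  \<open>t1\<close>. All zeros of \<open>zeta h\<close> arise from \<open>t1 + d\<close> by
  multiples of the period, so both this value and the smoothness near \<open>t1\<close> carry over
  to each of them.\<close>

lemma rosette_exists_through_0:
  assumes sol: "sol_path f J c \<psi>" and fr: "\<And>t. t \<in> J \<Longrightarrow> frame c \<psi> t = zeta h (t + d)"
    and h: "ham_min < h" and t1: "t1 \<in> J" "c t1 = 0"
  shows "\<exists>\<kappa> \<theta>. rosette f a h \<kappa> \<theta>"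
proof -
  note s = sol_pathD[OF sol]
  note T = per_pos[OF h]
  obtain k where k: "smooth_on J k" "\<forall>t\<in>J. (\<psi> has_real_derivative k t) (at t)"
    using smooth_on_real_derivative[OF s(6)] by blast
  have k_eq: "k t = f (cmod (zeta h (t + d)))" if "t \<in> J" "zeta h (t + d) \<noteq> 0" for t
  proof -
    have "cmod (c t) = cmod (zeta h (t + d))" using fr[OF that(1)] cmod_frame[of c \<psi> t] by simp
    moreover then have "c t \<noteq> 0" using that(2) by auto
    ultimately show ?thesis using DERIV_unique[OF k(2)[rule_format, OF that(1)] s(8)[OF that(1)]] by simp
  qed
  have z1: "zeta h (t1 + d) = 0" using fr[OF t1(1)] t1(2) by (simp add: frame_def)
  obtain e where e: "0 < e" "ball t1 e \<subseteq> J" using s(2) t1(1) open_contains_ball by blast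
  \<comment> \<open>Radius \<open>e\<close> keeps the argument inside \<open>J\<close>, and radius
    \<open>per h\<close> leaves room for no second zero.\<close>
  define \<epsilon> where "\<epsilon> = min e (per h)"
  have \<epsilon>: "0 < \<epsilon>" "\<epsilon> \<le> e" "\<epsilon> \<le> per h" using e T by (auto simp: \<epsilon>_def)
  define \<kappa> where "\<kappa> t = (if zeta h t = 0 then k t1 else f (cmod (zeta h t)))" for t
  have near: "\<exists>j::int. \<forall>x\<in>ball t \<epsilon>. x - d - of_int j * per h \<in> J \<and> \<kappa> x = k (x - d - of_int j * per h)"
    if "zeta h t = 0" for t
  proof -
    obtain j :: int where j: "t = t1 + d + of_int j * per h"
      using zeta_eq_iff[OF h, of t "t1 + d"] z1 \<open>zeta h t = 0\<close> by auto
    have "x - d - of_int j * per h \<in> J \<and> \<kappa> x = k (x - d - of_int j * per h)" if x: "x \<in> ball t \<epsilon>" for x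
    proof
      let ?y = "x - d - of_int j * per h"
      have y: "\<bar>?y - t1\<bar> < \<epsilon>" using x j by (simp add: dist_real_def)
      then have "?y \<in> ball t1 e" using \<epsilon> by (simp add: dist_real_def)
      then show yJ: "?y \<in> J" using e(2) by blast
      have zy: "zeta h (?y + d) = zeta h x" using zeta_periodic[OF h, of "?y + d" j] by simp
      show "\<kappa> x = k ?y"
      proof (cases "zeta h x = 0")
        case True
        then obtain i :: int where i: "?y + d = t1 + d + of_int i * per h"
          using zeta_eq_iff[OF h, of "?y + d" "t1 + d"] z1 zy by auto
        then have "?y - t1 = of_int i * per h" by linarith
        then have "\<bar>?y - t1\<bar> = \<bar>of_int i\<bar> * per h" using T by (simp only: abs_mult abs_of_pos)
        then have "\<bar>of_int i\<bar> * per h < 1 * per h" using y \<epsilon>(3) by linarith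
        moreover have "1 * per h \<le> \<bar>of_int i\<bar> * per h" if "1 \<le> \<bar>real_of_int i\<bar>"
          using that T by (intro mult_right_mono) auto
        ultimately have "\<bar>real_of_int i\<bar> < 1" by linarith
        then have "i = 0" by linarith
        then have "?y = t1" using i by simp
        then show ?thesis using True by (simp add: \<kappa>_def)
      next
        case False
        then show ?thesis using k_eq[OF yJ] zy by (simp add: \<kappa>_def)
      qed
    qed
    then show ?thesis by blast
  qed
  have "isCont \<kappa> t" for t
  proof (cases "zeta h t = 0")
    case True
    then obtain j :: int where j: "\<forall>x\<in>ball t \<epsilon>. x - d - of_int j * per h \<in> J \<and> \<kappa> x = k (x - d - of_int j * per h)"
      using near by blast
    have "continuous_on (ball t \<epsilon>) (\<lambda>x. k (x - d - of_int j * per h))"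
      by (rule continuous_on_compose2[OF smooth_on_continuous[OF k(1)]]) (use j in \<open>auto intro!: continuous_intros\<close>)
    then have "continuous_on (ball t \<epsilon>) \<kappa>" using j continuous_on_cong[of "ball t \<epsilon>" "ball t \<epsilon>" \<kappa>] by auto
    then show ?thesis using \<epsilon>(1) by (simp add: continuous_on_eq_continuous_at)
  next
    case False
    have "open {t. zeta h t \<noteq> 0}"
      using open_Collect_neq[OF continuous_on_zeta[OF h] continuous_on_const] by simp
    then have "\<forall>\<^sub>F x in nhds t. x \<in> {t. zeta h t \<noteq> 0}"
      by (rule eventually_nhds_in_open) (use False in simp)
    then have "\<forall>\<^sub>F x in nhds t. \<kappa> x = f (cmod (zeta h x))"
      by (rule eventually_mono) (simp add: \<kappa>_def)
    moreover have "isCont (\<lambda>x. f (cmod (zeta h x))) t"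
      using False by (intro isCont_o2[OF _ isCont_f] continuous_intros isCont_zeta[OF h]) auto
    ultimately show ?thesis by (simp add: isCont_cong)
  qed
  then have "continuous_on UNIV \<kappa>" by (simp add: continuous_at_imp_continuous_on)
  then obtain \<theta> where "pre_rosette f a h \<kappa> \<theta>"
    using pre_rosette_exists[OF h, of \<kappa>] \<kappa>_def by auto
  then interpret pre_rosette f a h \<kappa> \<theta> .
  obtain \<alpha> where \<alpha>: "\<forall>t\<in>J. c t = cis \<alpha> * cur (t + d) \<and> \<psi> t = \<theta> (t + d) + \<alpha>"
    using rigid[OF sol fr] by blast
  have smooth: "\<exists>U. open U \<and> t \<in> U \<and> smooth_on U cur \<and> smooth_on U \<theta>" for t
  proof (cases "zeta h t = 0")
    case False
    let ?U = "{t. zeta h t \<noteq> 0}"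
    have "open ?U" using open_Collect_neq[OF continuous_on_zeta[OF h] continuous_on_const] by simp
    moreover have "(\<theta> has_real_derivative f (cmod (cur t))) (at t)" "cur t \<noteq> 0" if "t \<in> ?U" for t
      using \<theta>_derivative[of t] \<kappa>_eq[of t] that by (simp_all add: cmod_cur cur_eq_0)
    then have "smooth_on ?U cur" "smooth_on ?U \<theta>"
      using smooth_bootstrap[OF f_smooth, of ?U cur \<theta>] cur_derivative by blast+
    ultimately show ?thesis using False by blast
  next
    case True
    then obtain j :: int where j: "\<forall>x\<in>ball t \<epsilon>. x - d - of_int j * per h \<in> J \<and> \<kappa> x = k (x - d - of_int j * per h)"
      using near by blast
    let ?b = "d + of_int j * per h"
    have sub: "ball t \<epsilon> \<subseteq> {x. x - ?b \<in> J}" using j by (auto simp: algebra_simps)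
    have shift: "smooth_on (ball t \<epsilon>) (\<lambda>x. c (x - ?b))" "smooth_on (ball t \<epsilon>) (\<lambda>x. k (x - ?b))"
      using smooth_on_subset[OF smooth_on_shift[OF s(5)] sub] smooth_on_subset[OF smooth_on_shift[OF k(1)] sub] by auto
    have "smooth_on (ball t \<epsilon>) (\<lambda>x. cis (of_int j * turn - \<alpha>) * c (x - ?b))"
      by (rule smooth_on_linear[OF shift(1) bounded_linear_mult_right])
    \<comment> \<open>Near its zero with number \<open>j\<close> the rosette is a rotated and
      shifted copy of \<open>c\<close>.\<close>
    moreover have "cur x = cis (of_int j * turn - \<alpha>) * c (x - ?b)" if "x \<in> ball t \<epsilon>" for x
    proof -
      have "x - ?b \<in> J" using sub that by blast
      then have c: "c (x - ?b) = cis \<alpha> * cur (x - of_int j * per h)" using \<alpha> by simp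
      have "cur x = cis (of_int j * turn) * cur (x - of_int j * per h)"
        using cur_periodic_int[of "x - of_int j * per h" j] by simp
      also have "\<dots> = cis (of_int j * turn - \<alpha>) * (cis \<alpha> * cur (x - of_int j * per h))"
        by (simp add: cis_mult flip: mult.assoc)
      finally show ?thesis unfolding c .
    qed
    ultimately have "smooth_on (ball t \<epsilon>) cur" by (rule smooth_on_cong[OF _ open_ball])
    moreover have "smooth_on (ball t \<epsilon>) \<theta>"
    proof (rule smooth_on_antiderivative[OF shift(2)])
      fix x assume "x \<in> ball t \<epsilon>"
      then have "\<kappa> x = k (x - ?b)" using j by (simp add: algebra_simps)
      then show "(\<theta> has_vector_derivative k (x - ?b)) (at x)"
        using \<theta>_derivative[of x] by (simp add: has_real_derivative_iff_has_vector_derivative)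
    qed
    ultimately show ?thesis using \<epsilon>(1) by (intro exI[of _ "ball t \<epsilon>"]) auto
  qed
  have "sol_path f UNIV cur \<theta>"
  proof (rule sol_pathI)
    have "\<exists>U. open U \<and> t \<in> U \<and> smooth_on U cur" "\<exists>U. open U \<and> t \<in> U \<and> smooth_on U \<theta>" for t
      using smooth[of t] by auto
    then show "smooth_on UNIV cur" "smooth_on UNIV \<theta>" by (intro smooth_on_local; simp)+
    show "(\<theta> has_real_derivative f (cmod (cur t))) (at t)" if "cur t \<noteq> 0" for t
      using \<theta>_derivative[of t] \<kappa>_eq[of t] that by (simp add: cur_eq_0 cmod_cur)
  qed (use cur_derivative in auto)
  then have "rosette f a h \<kappa> \<theta>" by unfold_locales
  then show ?thesis by blast
qed

end

subsection \<open>Closed rosettes\<close>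

text \<open>Without isolated points the complements of single points would be relatively open and
  dense in \<open>S\<close>. For countable \<open>S\<close>, Baire's theorem would make their empty
  intersection dense.\<close>

lemma compact_countable_isolated:
  fixes S :: "'a::{real_normed_vector,heine_borel} set"
  assumes "closed S" "countable S" "S \<noteq> {}"
  shows "\<exists>x\<in>S. \<not> x islimpt S"
proof (rule ccontr)
  assume "\<not> ?thesis"
  then have lim: "x islimpt S" if "x \<in> S" for x using that by blast
  have "S \<subseteq> closure (\<Inter>((\<lambda>y. S - {y}) ` S))"
  proof (rule Baire[OF assms(1)])
    show "countable ((\<lambda>y. S - {y}) ` S)" using assms(2) by simp
    fix T assume "T \<in> (\<lambda>y. S - {y}) ` S"
    then obtain y where y: "y \<in> S" "T = S - {y}" by blast
    have "openin (top_of_set S) T"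
      unfolding y(2) by (rule openin_delete) simp
    moreover have "S \<subseteq> closure T"
    proof
      fix x assume "x \<in> S"
      then have "x islimpt (S - {y})" using lim[of x] islimpt_insert[of x y "S - {y}"] y(1)
        by (simp add: insert_absorb)
      then show "x \<in> closure T" by (simp add: closure_def y(2))
    qed
    ultimately show "openin (top_of_set S) T \<and> S \<subseteq> closure T" by blast
  qed
  moreover have "\<Inter>((\<lambda>y. S - {y}) ` S) = {}" using assms(3) by auto
  ultimately show False using assms(3) by simp
qed

text \<open>Equal values at \<open>x\<close> and \<open>y\<close> force an extremum strictly between
  them, while a continuous injective function on a neighbourhood is strictly monotone.\<close>

lemma locally_injective_imp_inj:
  fixes L :: "real \<Rightarrow> real"
  assumes cont: "continuous_on UNIV L"
    and loc: "\<And>m. \<exists>\<eta>>0. inj_on L {m - \<eta>..m + \<eta>}"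
  shows "inj L"
proof (rule linorder_injI)
  fix x y :: real assume xy: "x < y"
  show "L x \<noteq> L y"
  proof
    assume eq: "L x = L y"
    have c: "continuous_on {x..y} L" using cont continuous_on_subset by blast
    obtain M where M: "M \<in> {x..y}" "\<And>v. v \<in> {x..y} \<Longrightarrow> L v \<le> L M"
      using continuous_attains_sup[OF compact_Icc _ c] xy by force
    obtain m where m: "m \<in> {x..y}" "\<And>v. v \<in> {x..y} \<Longrightarrow> L m \<le> L v"
      using continuous_attains_inf[OF compact_Icc _ c] xy by force
    have "\<exists>u. x < u \<and> u < y \<and> ((\<forall>v\<in>{x..y}. L v \<le> L u) \<or> (\<forall>v\<in>{x..y}. L u \<le> L v))"
    proof (cases "M = x \<or> M = y")
      case False
      then show ?thesis using M by (intro exI[of _ M]) auto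
    next
      case True
      then have LM: "L M = L x" using eq by auto
      show ?thesis
      proof (cases "m = x \<or> m = y")
        case False
        then show ?thesis using m by (intro exI[of _ m]) auto
      next
        case True
        then have "L m = L x" using eq by auto
        \<comment> \<open>Maximum and minimum both occur at end points, where \<open>L\<close> takes
          the same value, so \<open>L\<close> is constant on the interval and any interior point is
          an extremum.\<close>
        let ?u = "(x + y) / 2"
        have u: "x < ?u" "?u < y" "?u \<in> {x..y}" using xy by auto
        have "L v \<le> L ?u" if "v \<in> {x..y}" for v
          using M(2)[OF that] m(2)[OF u(3)] LM \<open>L m = L x\<close> by linarith
        with u show ?thesis by blast
      qed
    qed
    then obtain u where u: "x < u" "u < y" "(\<forall>v\<in>{x..y}. L v \<le> L u) \<or> (\<forall>v\<in>{x..y}. L u \<le> L v)" by blast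
    obtain \<eta> where \<eta>: "0 < \<eta>" "inj_on L {u - \<eta>..u + \<eta>}" using loc by blast
    define \<epsilon> where "\<epsilon> = min \<eta> (min (u - x) (y - u))"
    have \<epsilon>: "0 < \<epsilon>" "\<epsilon> \<le> \<eta>" "\<epsilon> \<le> u - x" "\<epsilon> \<le> y - u" using \<eta> u by (auto simp: \<epsilon>_def)
    have "inj_on L {u - \<epsilon>..u + \<epsilon>}" using \<eta>(2) by (rule inj_on_subset) (use \<epsilon> in auto)
    moreover have "continuous_on {u - \<epsilon>..u + \<epsilon>} L" using cont continuous_on_subset by blast
    ultimately have "L (u - \<epsilon>) < L u \<and> L u < L (u + \<epsilon>) \<or> L (u + \<epsilon>) < L u \<and> L u < L (u - \<epsilon>)"
      using \<epsilon> by (intro continuous_inj_imp_mono) auto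
    moreover have "u - \<epsilon> \<in> {x..y}" "u + \<epsilon> \<in> {x..y}" using \<epsilon> u by auto
    ultimately show False using u(3) by (metis not_less)
  qed
qed

context rosette
begin

lemma zeta_0_pos: "0 < cmod (zeta h 0)" "cur 0 = of_real (cmod (zeta h 0))"
proof -
  have "0 < a + rad h 0" using a_pos rad_pos[OF h, of 0] by simp
  moreover have "cmod (of_real (a + rad h 0)) = a + rad h 0" using calculation by (simp only: norm_of_real abs_of_pos)
  ultimately show "0 < cmod (zeta h 0)" "cur 0 = of_real (cmod (zeta h 0))"
    unfolding zeta_0[OF h] by (simp_all add: zeta_0[OF h] cur_def \<theta>_0 complex_eq_iff del: of_real_add)
qed

text \<open>The points of maximal modulus form an orbit of the rotation by \<open>turn\<close>; a compact orbit is
  closed and countable, hence finite.\<close>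

lemma compact_imp_closes:
  assumes "compact (range cur)"
  shows "\<exists>n::nat. 0 < n \<and> cis (real n * turn) = 1"
proof (rule ccontr)
  assume no: "\<not> ?thesis"
  define p where "p k = cis (of_int k * turn) * cur 0" for k :: int
  let ?b = "cmod (zeta h 0)"
  have p0: "cur 0 \<noteq> 0" using zeta_0_pos by simp
  have pk: "p k = cur (of_int k * per h)" for k using cur_periodic_int[of 0 k] by (simp add: p_def)
  have S: "range cur \<inter> sphere 0 ?b = range p"
  proof (intro equalityI subsetI)
    fix w assume "w \<in> range cur \<inter> sphere 0 ?b"
    then obtain t where t: "w = cur t" "cmod (zeta h t) = cmod (zeta h 0)" by (auto simp: cmod_cur)
    then obtain k :: int where "t = of_int k * per h" using cmod_zeta_max by blast
    then show "w \<in> range p" using t(1) pk by auto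
  next
    fix w assume "w \<in> range p"
    then obtain k where k: "w = p k" by blast
    have "cmod (p k) = ?b" by (simp add: p_def norm_mult cmod_cur)
    then show "w \<in> range cur \<inter> sphere 0 ?b" using pk[of k] k by simp
  qed
  have "compact (range p)" using assms S compact_Int_closed[of "range cur" "sphere 0 ?b"] by simp
  have inj: "inj p"
  proof (rule linorder_injI)
    fix k l :: int assume "k < l"
    show "p k \<noteq> p l"
    proof
      assume "p k = p l"
      then have "cis (of_int k * turn) = cis (of_int l * turn)" using p0 by (simp add: p_def)
      then have "cis (of_int l * turn - of_int k * turn) = 1" by (simp add: cis_divide[symmetric])
      then have "cis (real (nat (l - k)) * turn) = 1" using \<open>k < l\<close> by (simp add: algebra_simps)
      then show False using no \<open>k < l\<close> by (metis zero_less_nat_eq diff_gt_0_iff_gt)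
    qed
  qed
  then have inf: "infinite (range p)" using finite_imageD infinite_UNIV_int by blast
  obtain x where x: "x islimpt range p" "x \<in> range p"
    using Heine_Borel_imp_Bolzano_Weierstrass[OF \<open>compact (range p)\<close> inf] by blast
  then obtain k where k: "x = p k" by blast
  \<comment> \<open>The orbit is homogeneous: the rotation that moves \<open>p k\<close> to
    \<open>p l\<close> maps it to itself, so one limit point makes every point a limit
    point.\<close>
  have all: "p l islimpt range p" for l
  proof -
    let ?r = "\<lambda>w. cis (of_int (l - k) * turn) * w"
    obtain g where g: "\<And>i. g i \<in> range p - {x}" "g \<longlonglongrightarrow> x" using x(1) islimpt_sequential by blast
    have r: "?r (p i) = p (i + (l - k))" for i
      by (simp add: p_def cis_mult algebra_simps flip: mult.assoc)
    have "?r (g i) \<in> range p - {p l}" for i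
    proof -
      obtain j where j: "g i = p j" "j \<noteq> k" using g(1)[of i] k by blast
      then show ?thesis using r[of j] inj by (auto dest: injD)
    qed
    moreover have "(\<lambda>i. ?r (g i)) \<longlonglongrightarrow> ?r x" by (intro tendsto_intros g(2))
    moreover have "?r x = p l" using r[of k] k by simp
    ultimately have "(\<forall>i. ?r (g i) \<in> range p - {p l}) \<and> (\<lambda>i. ?r (g i)) \<longlonglongrightarrow> p l" by (simp only: simp_thms)
    then show ?thesis unfolding islimpt_sequential by (rule exI[of _ "\<lambda>i. ?r (g i)"])
  qed
  show False
    using compact_countable_isolated[OF compact_imp_closed[OF \<open>compact (range p)\<close>]] all by blast
qed

text \<open>The projection \<open>q\<close> to the tangent at \<open>m\<close> increases as long as
  the tangent has turned by less than a right angle.\<close>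

lemma locally_injective: "\<exists>\<eta>>0. inj_on cur {m - \<eta>..m + \<eta>}"
proof -
  have "isCont \<theta> m" using \<theta>_derivative DERIV_isCont by blast
  then obtain d where d: "0 < d" "\<And>x. \<bar>x - m\<bar> < d \<Longrightarrow> \<bar>\<theta> x - \<theta> m\<bar> < pi / 2"
    unfolding continuous_at_eps_delta dist_real_def using pi_half_gt_zero by blast
  define q where "q x = Re (cis (- \<theta> m) * cur x)" for x
  have q: "q x < q y" if "m - d/2 \<le> x" "x < y" "y \<le> m + d/2" for x y
  proof (rule DERIV_pos_imp_increasing[OF that(2)])
    fix z assume "x \<le> z" "z \<le> y"
    then have "\<bar>\<theta> z - \<theta> m\<bar> < pi / 2" using that d by (intro d(2)) auto
    then have "0 < cos (\<theta> z - \<theta> m)" by (intro cos_gt_zero_pi) linarith+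
    moreover have "(q has_vector_derivative Re (cis (- \<theta> m) * cis (\<theta> z))) (at z)"
      unfolding q_def
      by (intro bounded_linear.has_vector_derivative[OF bounded_linear_Re]
          bounded_linear.has_vector_derivative[OF bounded_linear_mult_right] cur_derivative)
    ultimately show "\<exists>y. (q has_real_derivative y) (at z) \<and> 0 < y"
      by (auto simp: cis_mult has_real_derivative_iff_has_vector_derivative)
  qed
  have "inj_on cur {m - d/2..m + d/2}"
  proof (rule linorder_inj_onI)
    fix x y assume "x < y" "x \<in> {m - d/2..m + d/2}" "y \<in> {m - d/2..m + d/2}"
    then have "q x < q y" by (intro q) auto
    then show "cur x \<noteq> cur y" by (auto simp: q_def)
  qed auto
  then show ?thesis using d(1) by (intro exI[of _ "d/2"]) auto
qed

lemma cur_convex_periodic: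
  assumes "real m * turn = 2 * pi"
  shows "cur (t + of_int k * (real m * per h)) = cur t"
proof -
  have "of_int (k * int m) * turn = of_int k * (real m * turn)" by simp
  also have "\<dots> = 2 * pi * of_int k" unfolding assms by simp
  also have "cis \<dots> = 1" by (simp add: complex_eq_iff)
  finally show ?thesis using cur_periodic_int[of t "k * int m"] by (simp add: mult.assoc)
qed

text \<open>Total rotation \<open>2\<pi>\<close> makes the curve convex: on an arc turning by at most \<open>\<pi>\<close> the projection
  to the middle tangent increases.\<close>

lemma convex_injective:
  assumes m: "0 < m" "real m * turn = 2 * pi" and nz: "\<And>t. zeta h t \<noteq> 0"
    and eq: "cur s = cur t"
  shows "\<exists>k::int. s = t + of_int k * (real m * per h)"
proof -
  let ?P = "real m * per h"
  have P: "0 < ?P" using m per_pos[OF h] by simp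
  have mono: "\<theta> x < \<theta> y" if "x < y" for x y
  proof (rule DERIV_pos_imp_increasing[OF that])
    show "\<exists>y. (\<theta> has_real_derivative y) (at x) \<and> 0 < y" for x
      using \<theta>_derivative[of x] \<kappa>_eq[OF nz] f_pos[of "cmod (zeta h x)"] nz by auto
  qed
  have arc: "cur x \<noteq> cur y" if "x < y" "\<theta> y - \<theta> x \<le> pi" for x y
  proof
    assume "cur x = cur y"
    define \<mu> where "\<mu> = (\<theta> x + \<theta> y) / 2"
    define q where "q x = Re (cis (- \<mu>) * cur x)" for x
    have "q x < q y"
    proof (rule DERIV_pos_imp_increasing_open[OF that(1)])
      fix z assume "x < z" "z < y"
      then have "\<theta> x < \<theta> z" "\<theta> z < \<theta> y" by (auto intro: mono)
      then have "0 < cos (\<theta> z - \<mu>)" using that(2) by (intro cos_gt_zero_pi) (auto simp: \<mu>_def field_simps)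
      moreover have "(q has_vector_derivative Re (cis (- \<mu>) * cis (\<theta> z))) (at z)"
        unfolding q_def
        by (intro bounded_linear.has_vector_derivative[OF bounded_linear_Re]
            bounded_linear.has_vector_derivative[OF bounded_linear_mult_right] cur_derivative)
      ultimately show "\<exists>y. (q has_real_derivative y) (at z) \<and> 0 < y"
        by (auto simp: cis_mult has_real_derivative_iff_has_vector_derivative)
    next
      show "continuous_on {x..y} q" unfolding q_def by (intro continuous_intros continuous_on_cur)
    qed
    then show False using \<open>cur x = cur y\<close> by (simp add: q_def)
  qed
  note per_cur = cur_convex_periodic[OF m(2)]
  define k where "k = \<lfloor>(s - t) / ?P\<rfloor>"
  define u where "u = s - of_int k * ?P"
  have "of_int k \<le> (s - t) / ?P" "(s - t) / ?P < of_int k + 1" by (auto simp: k_def)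
  then have "of_int k * ?P \<le> s - t" "s - t < (of_int k + 1) * ?P"
    using P by (simp_all only: pos_le_divide_eq pos_divide_less_eq)
  then have u: "t \<le> u" "u < t + ?P" by (auto simp: u_def algebra_simps)
  have cu: "cur u = cur t" using per_cur[of u k] eq by (simp add: u_def)
  have "u = t"
  proof (rule ccontr)
    assume "u \<noteq> t"
    then have tu: "t < u" using u by simp
    have "\<theta> (t + ?P) = \<theta> t + 2 * pi" using \<theta>_periodic_int[of t "int m"] m(2) by simp
    \<comment> \<open>The arcs from \<open>t\<close> to \<open>u\<close> and from \<open>u\<close>
      to \<open>t + ?P\<close> turn by 2\<pi> altogether, so one of them turns by at most
      \<pi>.\<close>
    then consider "\<theta> u - \<theta> t \<le> pi" | "\<theta> (t + ?P) - \<theta> u \<le> pi" by linarith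
    then show False
    proof cases
      case 1
      then show ?thesis using arc[OF tu] cu by simp
    next
      case 2
      then show ?thesis using arc[OF u(2)] cu per_cur[of t 1] by simp
    qed
  qed
  then have "s = t + of_int k * ?P" by (simp add: u_def)
  then show ?thesis by blast
qed

lemma range_cur_periodic:
  assumes "0 < P" "\<And>t k. cur (t + of_int k * P) = cur t"
  shows "range cur = (\<lambda>u. cur (P * u)) ` {0..1}"
proof (intro equalityI subsetI)
  fix w assume "w \<in> range cur"
  then obtain t where t: "w = cur t" by blast
  let ?k = "\<lfloor>t / P\<rfloor>"
  let ?u = "t / P - of_int ?k"
  have "cur (P * ?u) = cur (P * ?u + of_int ?k * P)" by (simp only: assms(2))
  also have "P * ?u + of_int ?k * P = t" using assms(1) by (simp add: algebra_simps)
  finally have "w = cur (P * ?u)" using t by simp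
  moreover have "?u \<in> {0..1}" by (simp add: le_floor_iff less_imp_le) linarith
  ultimately show "w \<in> (\<lambda>u. cur (P * u)) ` {0..1}" by blast
qed auto

lemma convex_homeomorphic:
  assumes m: "0 < m" "real m * turn = 2 * pi" and nz: "\<And>t. zeta h t \<noteq> 0"
  shows "range cur homeomorphic sphere (0::complex) 1"
proof -
  let ?P = "real m * per h"
  have P: "0 < ?P" using m per_pos[OF h] by simp
  note per_cur = cur_convex_periodic[OF m(2)]
  define g where "g u = cur (?P * u)" for u
  have "path g" unfolding path_def g_def
    by (rule continuous_on_compose2[OF continuous_on_cur[of UNIV]]) (intro continuous_intros, simp)
  moreover have "x = y \<or> x = 0 \<and> y = 1 \<or> x = 1 \<and> y = 0"
    if xy: "x \<in> {0..1}" "y \<in> {0..1}" "g x = g y" for x y :: real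
  proof -
    obtain k :: int where "?P * x = ?P * y + of_int k * ?P"
      using convex_injective[OF m nz, of "?P * x" "?P * y"] xy(3) by (auto simp: g_def)
    then have "?P * (x - y - of_int k) = 0" by (simp add: algebra_simps)
    then have "x - y = of_int k" using P by (metis diff_eq_eq add_0 less_irrefl mult_eq_0_iff)
    moreover then have "k \<in> {-1, 0, 1}" using xy by auto
    ultimately show ?thesis using xy by auto
  qed
  ultimately have "simple_path g" unfolding simple_path_def loop_free_def by auto
  moreover have "pathfinish g = pathstart g"
    using per_cur[of 0 1] by (simp add: pathfinish_def pathstart_def g_def)
  ultimately have "path_image g homeomorphic sphere (0::complex) 1"
    by (rule homeomorphic_simple_path_image_circle) simp
  moreover have "path_image g = range cur"
    unfolding path_image_def g_def using range_cur_periodic[OF P per_cur] by simp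
  ultimately show ?thesis by simp
qed

end

locale closed_rosette = rosette +
  fixes n :: nat
  assumes n_pos: "0 < n"
    and closes: "cis (real n * turn) = 1"
    and least: "0 < m \<Longrightarrow> cis (real m * turn) = 1 \<Longrightarrow> n \<le> m"
begin

definition len :: real where "len = real n * per h"

lemma len_pos: "0 < len" using n_pos per_pos[OF h] by (simp add: len_def)

lemma cis_int_closes: "cis (of_int k * (real n * turn)) = 1"
proof -
  have "cis (of_int k * (real n * turn)) = cis (real n * turn) powi k"
    by (simp add: cis_power_int)
  then show ?thesis by (simp add: closes)
qed

lemma cis_turn_dvd:
  assumes "cis (of_int k * turn) = 1"
  shows "int n dvd k"
proof -
  let ?r = "k mod int n"
  have r: "0 \<le> ?r" "?r < int n" using n_pos by auto
  have "real_of_int k = of_int (k div int n * int n + ?r)" by (simp only: div_mult_mod_eq)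
  then have "real_of_int k = of_int (k div int n) * real n + of_int ?r"
    by (simp only: of_int_add of_int_mult of_int_of_nat_eq)
  then have "of_int ?r * turn = of_int k * turn - of_int (k div int n) * (real n * turn)"
    by (simp only: distrib_right mult.assoc add_diff_cancel_left')
  then have "cis (of_int ?r * turn) = 1"
    using assms cis_int_closes by (simp add: cis_divide[symmetric])
  then have "cis (real (nat ?r) * turn) = 1" using r by simp
  then have "\<not> 0 < nat ?r" using least[of "nat ?r"] r by linarith
  then show ?thesis using r by (simp add: dvd_eq_mod_eq_0)
qed

lemma cur_len: "cur (t + of_int k * len) = cur t"
  using cur_periodic_int[of t "k * int n"] cis_int_closes[of k] by (simp add: len_def mult.assoc)

text \<open>A period must return the point \<open>cur 0\<close> of maximal modulus to itself, so it
  is a multiple of \<open>per h\<close> whose rotation is trivial; minimality of \<open>n\<close>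
  bounds it from below.\<close>

lemma minimal_period_cur: "minimal_period (\<lambda>t. cis \<alpha> * cur (t + d)) len"
  unfolding minimal_period_def
proof (intro conjI allI impI notI)
  show "0 < len" by (rule len_pos)
  show "cis \<alpha> * cur (t + len + d) = cis \<alpha> * cur (t + d)" for t
    using cur_len[of "t + d" 1] by (simp add: add_ac)
  fix S assume S: "0 < S \<and> S < len" "\<forall>t. cis \<alpha> * cur (t + S + d) = cis \<alpha> * cur (t + d)"
  have "cur S = cur 0" using S(2)[rule_format, of "- d"] by simp
  then have "cmod (zeta h S) = cmod (zeta h 0)" using cmod_cur by metis
  then obtain k :: int where k: "S = of_int k * per h" using cmod_zeta_max by blast
  have "cis (of_int k * turn) * cur 0 = cur 0" using cur_periodic_int[of 0 k] k \<open>cur S = cur 0\<close> by simp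
  moreover have "cur 0 \<noteq> 0" using zeta_0_pos by simp
  ultimately have "cis (of_int k * turn) = 1" by simp
  then have "int n dvd k" by (rule cis_turn_dvd)
  moreover have "0 < k" using S(1) k per_pos[OF h] by (simp add: zero_less_mult_iff)
  ultimately have "int n \<le> k" by (simp add: zdvd_imp_le)
  then have "real n * per h \<le> of_int k * per h" using per_pos[OF h] by (intro mult_right_mono) auto
  then show False using S(1) k by (simp add: len_def)
qed

text \<open>The trace being a circle, \<open>cur\<close> lifts to a locally injective, hence injective, map \<open>L\<close> of the
  line. If \<open>L s\<close> and \<open>L t\<close> differ by \<open>2\<pi>k\<close>, then a point over the one with parameter \<open>0\<close> again has
  maximal modulus, which identifies \<open>2\<pi>k\<close> as the increment of \<open>L\<close> over a multiple of \<open>len\<close>.\<close>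

lemma circle_imp_injective:
  assumes hom: "range cur homeomorphic sphere (0::complex) 1" and eq: "cur s = cur t"
  shows "\<exists>k::int. s = t + of_int k * len"
proof -
  obtain \<phi> \<psi> where hm: "homeomorphism (range cur) (sphere (0::complex) 1) \<phi> \<psi>"
    using hom homeomorphic_def by blast
  have \<phi>: "continuous_on (range cur) \<phi>" "\<And>t. \<psi> (\<phi> (cur t)) = cur t"
    and "\<phi> ` range cur = sphere 0 1"
    using hm unfolding homeomorphism_def by auto
  then have "\<phi> (cur t) \<in> sphere 0 1" for t by blast
  then have \<phi>1: "cmod (\<phi> (cur t)) = 1" for t by simp
  have "continuous_on UNIV (\<lambda>t. \<phi> (cur t))"
    by (rule continuous_on_compose2[OF \<phi>(1) continuous_on_cur]) simp
  moreover have "contractible (UNIV :: real set)" by (simp add: convex_imp_contractible)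
  moreover have "\<phi> (cur t) \<noteq> 0" for t using \<phi>1[of t] by auto
  ultimately obtain g where g: "continuous_on UNIV g" "\<And>t. \<phi> (cur t) = exp (g t)"
    using continuous_logarithm_on_contractible[of UNIV "\<lambda>t. \<phi> (cur t)"] by auto
  define L where "L t = Im (g t)" for t
  have Lcont: "continuous_on UNIV L" unfolding L_def by (intro continuous_intros g(1))
  have gL: "\<phi> (cur t) = cis (L t)" for t
  proof -
    have "exp (Re (g t)) = 1" using \<phi>1[of t] unfolding g(2) by simp
    then show ?thesis unfolding g(2) by (simp add: L_def exp_eq_polar)
  qed
  have L_cur: "cur x = cur y" if "cis (L x) = cis (L y)" for x y
    using that \<phi>(2)[of x] \<phi>(2)[of y] gL[of x] gL[of y] by simp
  have "inj L"
  proof (rule locally_injective_imp_inj[OF Lcont])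
    fix m
    obtain \<eta> where \<eta>: "0 < \<eta>" "inj_on cur {m - \<eta>..m + \<eta>}" using locally_injective by blast
    have "inj_on L {m - \<eta>..m + \<eta>}"
    proof (rule inj_onI)
      fix x y assume "x \<in> {m - \<eta>..m + \<eta>}" "y \<in> {m - \<eta>..m + \<eta>}" "L x = L y"
      moreover then have "cur x = cur y" by (intro L_cur) simp
      ultimately show "x = y" using inj_onD[OF \<eta>(2)] by blast
    qed
    with \<eta>(1) show "\<exists>\<eta>>0. inj_on L {m - \<eta>..m + \<eta>}" by blast
  qed
  have cis_eqD: "\<exists>k::int. y = x + 2 * pi * of_int k" if "cis x = cis y" for x y
  proof -
    have "exp (\<i> * y) = exp (\<i> * x)" using that by (simp add: cis_conv_exp)
    then obtain n :: int where "\<i> * y = \<i> * x + (of_int (2 * n) * pi) * \<i>" using exp_eq by blast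
    then have "Im (\<i> * y) = Im (\<i> * x + (of_int (2 * n) * pi) * \<i>)" by simp
    then show ?thesis by (intro exI[of _ n]) simp
  qed
  \<comment> \<open>Both values lie over the same point of the circle, so the increment is a
    continuous function with values in 2\<pi> times the integers.\<close>
  have "L (t + len) - L t = L (0 + len) - L 0" for t
  proof -
    have c: "continuous_on UNIV (\<lambda>t. (L (t + len) - L t) / (2 * pi))"
      by (intro continuous_intros Lcont continuous_on_compose2[OF Lcont]) auto
    have int: "\<exists>k::int. (L (t + len) - L t) / (2 * pi) = of_int k" for t
    proof -
      have "cis (L t) = cis (L (t + len))" using gL[of t] gL[of "t + len"] cur_len[of t 1] by simp
      from cis_eqD[OF this] show ?thesis by (auto simp: field_simps)
    qed
    have "(\<lambda>t. (L (t + len) - L t) / (2 * pi)) constant_on UNIV"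
    proof (rule continuous_discrete_range_constant[OF _ c])
      fix x :: real
      have "1 \<le> norm ((L (y + len) - L y) / (2 * pi) - (L (x + len) - L x) / (2 * pi))"
        if "(L (y + len) - L y) / (2 * pi) \<noteq> (L (x + len) - L x) / (2 * pi)" for y
      proof -
        obtain i j :: int where "(L (y + len) - L y) / (2 * pi) = of_int i" "(L (x + len) - L x) / (2 * pi) = of_int j"
          using int[of x] int[of y] by blast
        then show ?thesis using that by (simp flip: of_int_diff)
      qed
      then show "\<exists>e>0. \<forall>y. y \<in> UNIV \<and> (L (y + len) - L y) / (2 * pi) \<noteq> (L (x + len) - L x) / (2 * pi) \<longrightarrow>
          e \<le> norm ((L (y + len) - L y) / (2 * pi) - (L (x + len) - L x) / (2 * pi))"
        by (intro exI[of _ 1]) auto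
    qed simp
    then obtain e where "\<And>t. (L (t + len) - L t) / (2 * pi) = e" unfolding constant_on_def by blast
    then have "(L (t + len) - L t) / (2 * pi) = (L (0 + len) - L 0) / (2 * pi)" by metis
    then show ?thesis by simp
  qed
  then obtain D where D: "\<And>t. L (t + len) = L t + D" by (metis add.commute diff_add_cancel)
  have Dint: "L (t + of_int k * len) = L t + of_int k * D" for t and k :: int
  proof -
    have nat: "L (t + real i * len) = L t + real i * D" for i t
    proof (induction i)
      case (Suc i)
      then show ?case using D[of "t + real i * len"] by (simp add: algebra_simps)
    qed simp
    show ?thesis
    proof (cases "0 \<le> k")
      case True
      then show ?thesis using nat[of t "nat k"] by simp
    next
      case False
      then show ?thesis using nat[of "t + of_int k * len" "nat (- k)"] by simp
    qed
  qed
  have "D \<noteq> 0"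
  proof
    assume "D = 0"
    then have "L (0 + len) = L 0" using D[of 0] by simp
    from injD[OF \<open>inj L\<close> this] show False using len_pos by simp
  qed
  \<comment> \<open>Since \<open>D \<noteq> 0\<close>, the values at multiples of \<open>len\<close>
    are unbounded in both directions.\<close>
  have surj: "\<exists>v. L v = y" for y
  proof -
    obtain i :: nat where i: "\<bar>y - L 0\<bar> < real i * \<bar>D\<bar>" using ex_less_of_nat_mult[of "\<bar>D\<bar>"] \<open>D \<noteq> 0\<close> by auto
    have e: "L (of_int (int i) * len) = L 0 + real i * D" "L (of_int (- int i) * len) = L 0 - real i * D"
      using Dint[of 0 "int i"] Dint[of 0 "- int i"] by simp_all
    have "connected (range L)" by (intro connected_continuous_image Lcont connected_UNIV)
    then have iv: "is_interval (range L)" by (simp only: is_interval_connected_1)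
    show ?thesis
    proof (cases "0 < D")
      case True
      then have "L (of_int (- int i) * len) \<le> y" "y \<le> L (of_int (int i) * len)"
        unfolding e using i by (auto simp: abs_if split: if_splits)
      from mem_is_interval_1_I[OF iv rangeI rangeI this] show ?thesis by auto
    next
      case False
      then have "L (of_int (int i) * len) \<le> y" "y \<le> L (of_int (- int i) * len)"
        unfolding e using i \<open>D \<noteq> 0\<close> by (auto simp: abs_if split: if_splits)
      from mem_is_interval_1_I[OF iv rangeI rangeI this] show ?thesis by auto
    qed
  qed
  have "cis (L t) = cis (L s)" using gL[of s] gL[of t] eq by simp
  from cis_eqD[OF this] obtain k :: int where k: "L s = L t + 2 * pi * of_int k" by blast
  obtain v where v: "L v = L 0 + 2 * pi * of_int k" using surj by blast
  have "cis (L v) = cis (L 0)" unfolding v by (simp add: complex_eq_iff cos_add sin_add)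
  then have "cur v = cur 0" by (rule L_cur)
  then have "cmod (zeta h v) = cmod (zeta h 0)" using cmod_cur by metis
  then obtain j :: int where j: "v = of_int j * per h" using cmod_zeta_max by blast
  have "cis (of_int j * turn) * cur 0 = cur 0" using cur_periodic_int[of 0 j] j \<open>cur v = cur 0\<close> by simp
  moreover have "cur 0 \<noteq> 0" using zeta_0_pos by simp
  ultimately have "int n dvd j" by (intro cis_turn_dvd) simp
  then obtain l where "j = int n * l" by blast
  then have "v = 0 + of_int l * len" using j by (simp add: len_def)
  then have "L v = L 0 + of_int l * D" using Dint[of 0 l] by simp
  then have "L s = L (t + of_int l * len)" using v k Dint[of t l] by simp
  from injD[OF \<open>inj L\<close> this] show ?thesis by blast
qed

end

subsection \<open>Simple closed rosettes\<close>

locale simple_rosette = closed_rosette +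
  assumes f'_nonzero: "0 < s \<Longrightarrow> deriv f s \<noteq> 0"
    and inj: "cur s = cur t \<Longrightarrow> \<exists>k::int. s = t + of_int k * len"
begin

lemma not_congruent:
  assumes "0 < s - t" "s - t < len"
  shows "cur s \<noteq> cur t"
proof
  assume "cur s = cur t"
  from inj[OF this] obtain k :: int where "s = t + of_int k * len" by blast
  then have "s - t = of_int k * len" by simp
  then have "0 < of_int k * len" "of_int k * len < 1 * len" using assms by auto
  then have "0 < k" "k < 1" using len_pos by (simp_all add: zero_less_mult_iff mult_less_cancel_right)
  then show False by simp
qed

lemma Im_derivative: "((\<lambda>t. Im (w * cur t)) has_real_derivative Im (w * cis (\<theta> t))) (at t)"
  unfolding has_real_derivative_iff_has_vector_derivative
  by (intro bounded_linear.has_vector_derivative[OF bounded_linear_Im]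
      bounded_linear.has_vector_derivative[OF bounded_linear_mult_right] cur_derivative)

lemma continuous_on_Im: "continuous_on S (\<lambda>t. Im (w * cur t))"
  by (intro continuous_intros continuous_on_cur)

text \<open>The initial slope makes \<open>e\<close> positive immediately after 0, and a later
  non-positive value would force a zero.\<close>

lemma constant_sign:
  fixes e :: "real \<Rightarrow> real"
  assumes "e 0 = 0" "(e has_real_derivative d) (at 0)" "0 < d" "continuous_on UNIV e"
    and nz: "\<And>t. 0 < t \<Longrightarrow> t < b \<Longrightarrow> e t \<noteq> 0" and t: "0 < t" "t < b"
  shows "0 < e t"
proof (rule ccontr)
  assume "\<not> 0 < e t"
  obtain \<delta> where \<delta>: "0 < \<delta>" "\<forall>h>0. h < \<delta> \<longrightarrow> e 0 < e (0 + h)"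
    using DERIV_pos_inc_right[OF assms(2,3)] by blast
  define s where "s = min (\<delta>/2) (t/2)"
  have s: "0 < s" "s < t" "s < \<delta>" using \<delta>(1) t by (auto simp: s_def)
  then have "0 < e s" using \<delta>(2) assms(1) by simp
  moreover have "continuous_on {s..t} e" using assms(4) continuous_on_subset by blast
  ultimately obtain x where "s \<le> x" "x \<le> t" "e x = 0"
    using IVT2'[of e t 0 s] \<open>\<not> 0 < e t\<close> s by force
  then show False using nz[of x] s t by simp
qed

text \<open>The real axis is an axis of symmetry, so a point \<open>cur t\<close> on it coincides
  with \<open>cur (- t)\<close>. For 0 < t < \<open>len / 2\<close> that would be a double
  point.\<close>

lemma Im_cur_pos:
  assumes "0 < t" "t < len / 2"
  shows "0 < Im (cur t)"
proof -
  have "0 < (\<lambda>t. Im (1 * cur t)) t"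
  proof (rule constant_sign[OF _ Im_derivative _ continuous_on_Im _ assms])
    show "Im (1 * cur 0) = 0" using zeta_0_pos(2) by simp
    fix t assume t: "0 < t" "t < len / 2"
    show "Im (1 * cur t) \<noteq> 0"
    proof
      assume "Im (1 * cur t) = 0"
      then have "cur t = cur (- t)" by (simp add: cur_uminus complex_eq_iff)
      then show False using not_congruent[of t "- t"] t by simp
    qed
  qed (simp add: \<theta>_0)
  then show ?thesis by simp
qed

text \<open>The four vertex argument: for \<open>n = 1\<close> the function \<open>\<kappa> Im c + cos \<theta>\<close> vanishes at both ends of
  the half period, while its derivative \<open>f'(r) r' Im c\<close> has no zero inside.\<close>

lemma n_ge_2: "2 \<le> n"
proof (rule ccontr)
  assume "\<not> 2 \<le> n"
  then have n: "n = 1" using n_pos by simp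
  have len: "len = per h" unfolding len_def using n by simp
  note T = per_pos[OF h]
  \<comment> \<open>\<open>M\<close> is \<kappa> times the ordinate of the centre of curvature. In
    its derivative the terms with \<kappa> sin \<theta> cancel, and only the derivative of \<kappa>
    times \<open>Im (cur t)\<close> is left.\<close>
  define M where "M t = \<kappa> t * Im (cur t) + cos (\<theta> t)" for t
  have "cur (per h / 2) = cur (- (per h / 2))" using cur_len[of "- (per h / 2)" 1] by (simp add: len)
  then have "Im (cur (per h / 2)) = 0" by (simp add: cur_uminus complex_eq_iff)
  moreover have "sin (turn / 2) = 0"
  proof -
    have "cos turn = 1" using closes by (simp add: n complex_eq_iff)
    then show ?thesis using cos_double_sin[of "turn / 2"] by simp
  qed
  ultimately have "M (per h / 2) = 0" by (simp add: M_def \<theta>_half cos_add)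
  moreover have "M 0 = 0" using zeta_0_pos(2) by (simp add: M_def \<theta>_0)
  ultimately have eq: "M 0 = M (per h / 2)" by simp
  have der: "(M has_real_derivative deriv f (cmod (zeta h t)) * (- Im (zeta h t) / cmod (zeta h t)) * Im (cur t)) (at t)"
    if t: "0 < t" "t < per h / 2" for t
  proof -
    have nz: "zeta h t \<noteq> 0" using zeta_half_nonzero t by blast
    have "((\<lambda>t. f (cmod (zeta h t))) has_real_derivative
        deriv f (cmod (zeta h t)) * (- Im (zeta h t) / cmod (zeta h t))) (at t)"
      using nz by (intro DERIV_chain2[OF f_has_derivative] cmod_zeta_derivative h) auto
    then have k: "(\<kappa> has_real_derivative
        deriv f (cmod (zeta h t)) * (- Im (zeta h t) / cmod (zeta h t))) (at t)"
      by (rule has_field_derivative_transform_within_open[where S = "{0<..<per h / 2}"])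
        (use t zeta_half_nonzero \<kappa>_eq in auto)
    have i: "((\<lambda>t. Im (cur t)) has_real_derivative sin (\<theta> t)) (at t)" using Im_derivative[of 1 t] by simp
    have c: "((\<lambda>t. cos (\<theta> t)) has_real_derivative - sin (\<theta> t) * \<kappa> t) (at t)"
      using \<theta>_derivative[of t] by (auto intro!: derivative_eq_intros)
    show ?thesis unfolding M_def
      using DERIV_add[OF DERIV_mult[OF k i] c] by (simp add: mult.commute)
  qed
  have "continuous_on {0..per h / 2} M"
    unfolding M_def
    by (intro continuous_intros continuous_on_cur continuous_on_\<theta> continuous_on_subset[OF \<kappa>_cont]) auto
  moreover have "M differentiable (at t)" if "0 < t" "t < per h / 2" for t
    using der[OF that] unfolding real_differentiable_def by blast
  ultimately obtain t where t: "0 < t" "t < per h / 2" "(M has_real_derivative 0) (at t)"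
    using Rolle[where f = M and a = 0 and b = "per h / 2", OF _ eq] T by auto
  have "0 < Im (zeta h t)" by (rule Im_zeta_pos[OF h t(1,2)])
  moreover have "0 < Im (cur t)" by (rule Im_cur_pos) (use t len in auto)
  moreover have "deriv f (cmod (zeta h t)) \<noteq> 0" using f'_nonzero zeta_half_nonzero[OF t(1,2)] by simp
  ultimately show False using DERIV_unique[OF der[OF t(1,2)] t(3)] by auto
qed

lemma len_ge: "2 * per h \<le> len"
  using n_ge_2 per_pos[OF h] unfolding len_def by (intro mult_right_mono) auto

text \<open>A second axis of symmetry passes through 0 and the point at half the period. The map
  \<open>w \<mapsto> cis turn * cnj w\<close> is the reflection in the line with direction
  \<open>turn / 2\<close>.\<close>

lemma cur_half_reflection: "cur (per h / 2 - u) = cis turn * cnj (cur (per h / 2 + u))"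
proof -
  have "per h / 2 - u = - (per h / 2 + u) + of_int 1 * per h" by simp
  then have "cur (per h / 2 - u) = cis (of_int 1 * turn) * cur (- (per h / 2 + u))"
    by (metis cur_periodic_int)
  then show ?thesis by (simp only: cur_uminus of_int_1 mult_1)
qed

text \<open>At level 0 the curve returns to the origin one period later, before it closes. At a
  positive level it passes its nearest point \<open>?m\<close> in the retrograde direction, yet one
  half period later it must lie on the opposite side of the axis through \<open>?m\<close>; in
  between it would cross this axis at a double point.\<close>

lemma level_neg: "h < 0"
proof (rule ccontr)
  assume "\<not> h < 0"
  note T = per_pos[OF h]
  let ?m = "cur (per h / 2)"
  have half: "zeta h (per h / 2) = of_real (a - rad h pi)" by (rule zeta_half[OF h])
  have rad: "rad h pi = a" if "h = 0"
    by (rule rad_eqI[OF h a_pos]) (simp add: that ham_0)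
  show False
  proof (cases "h = 0")
    case True
    have "zeta h (per h / 2) = 0" using half rad[OF True] by simp
    then have "cur (per h / 2) = 0" by (simp only: cur_eq_0)
    moreover have "cur (per h / 2 + of_int 1 * per h) = cis (of_int 1 * turn) * cur (per h / 2)"
      by (rule cur_periodic_int)
    ultimately have "cur (per h / 2 + per h) = cur (per h / 2)" by simp
    then show False using not_congruent[of "per h / 2 + per h" "per h / 2"] len_ge T by simp
  next
    case False
    then have "0 < h" using \<open>\<not> h < 0\<close> by simp
    have "a < rad h pi"
    proof (rule ccontr)
      assume "\<not> a < rad h pi"
      then have "ham (a + of_real (rad h pi) * cis pi) \<le> ham (a + of_real a * cis pi)"
        using ham_ray_increasing[of "rad h pi" a pi] rad_pos[OF h, of pi] by (cases "rad h pi = a") auto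
      then show False using ham_pol[OF h, of pi] \<open>0 < h\<close> ham_0 by (simp add: pol_def)
    qed
    then have "zeta h (per h / 2) \<noteq> 0" unfolding half of_real_eq_0_iff by simp
    then have m0: "?m \<noteq> 0" using cur_eq_0 by blast
    \<comment> \<open>Up to the factor \<open>cmod ?m\<close> this is the distance from the axis
      through \<open>?m\<close>, signed so that the slope at 0 is \<open>rad h pi - a\<close>, which
      is positive at positive levels.\<close>
    define e where "e u = - Im (cnj ?m * cur (per h / 2 + u))" for u
    have "0 < e (per h / 2)"
    proof (rule constant_sign[where e = e and d = "rad h pi - a" and b = "len / 2" and t = "per h / 2"])
      show "e 0 = 0" by (simp add: e_def)
      have "cnj ?m * cis (\<theta> (per h / 2)) = \<i> * of_real (a - rad h pi)"
        using cnj_mult_tangent[of cur "per h / 2" \<theta>] frame_cur[of "per h / 2"] half by simp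
      then have "((\<lambda>t. - Im (cnj ?m * cur t)) has_real_derivative rad h pi - a) (at (per h / 2))"
        using DERIV_minus[OF Im_derivative[of "cnj ?m" "per h / 2"]] by simp
      then show "(e has_real_derivative rad h pi - a) (at 0)"
        unfolding e_def using DERIV_shift[of "\<lambda>t. - Im (cnj ?m * cur t)" "rad h pi - a" 0 "per h / 2"]
        by (simp add: add.commute)
      show "0 < rad h pi - a" using \<open>a < rad h pi\<close> by simp
      show "continuous_on UNIV e"
        unfolding e_def by (intro continuous_intros continuous_on_compose2[OF continuous_on_cur[of UNIV]]) auto
      show "0 < per h / 2" "per h / 2 < len / 2" using T len_ge by auto
      fix u assume u: "0 < u" "u < len / 2"
      show "e u \<noteq> 0"
      proof
        let ?w = "cur (per h / 2 + u)"
        assume "e u = 0"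
        then have "cnj ?m * ?w = cnj (cnj ?m * ?w)" by (simp add: e_def complex_eq_iff)
        then have sym: "cnj ?m * ?w = ?m * cnj ?w" by simp
        have "?m = cis turn * cnj ?m" using cur_half_reflection[of 0] by simp
        then have "?m * ?w = cis turn * (cnj ?m * ?w)" by (metis mult.assoc)
        also have "\<dots> = ?m * (cis turn * cnj ?w)" by (simp only: sym mult_ac)
        finally have "?m * ?w = ?m * (cis turn * cnj ?w)" .
        then have "?w = cis turn * cnj ?w" using m0 by simp
        then have "cur (per h / 2 + u) = cur (per h / 2 - u)" by (simp add: cur_half_reflection)
        then show False using not_congruent[of "per h / 2 + u" "per h / 2 - u"] u by simp
      qed
    qed
    \<comment> \<open>The point \<open>cur (per h)\<close> is the mirror image of
      \<open>cur 0\<close> in the axis through \<open>?m\<close>, so the sign of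
      \<open>Im ?m\<close> tells on which side it lies.\<close>
    moreover have "Im (cnj ?m * cur (per h)) = cmod (zeta h 0) * Im ?m"
    proof -
      have "cur (per h) = cis turn * of_real (cmod (zeta h 0))"
        using cur_periodic_int[of 0 1] zeta_0_pos(2) by simp
      moreover have "?m = cis turn * cnj ?m" using cur_half_reflection[of 0] by simp
      ultimately have "cnj ?m * cur (per h) = ?m * of_real (cmod (zeta h 0))" by (simp add: mult_ac)
      then show ?thesis by simp
    qed
    moreover have "0 < Im ?m" using T len_ge by (intro Im_cur_pos) auto
    then have "0 < cmod (zeta h 0) * Im ?m" using zeta_0_pos(1) by (intro mult_pos_pos)
    ultimately show False by (simp add: e_def)
  qed
qed

text \<open>For negative levels the polar angle \<open>\<psi>\<close> of the curve is increasing.\<close>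

lemma total_turn: "real n * turn = 2 * pi"
proof -
  \<comment> \<open>Here the sign of the level enters: \<open>Re (zeta h t)\<close> equals
    \<open>prim\<close> of the modulus minus \<open>h\<close>. The principal logarithm is therefore
    smooth along the whole orbit.\<close>
  have re: "0 < Re (zeta h t)" for t
  proof -
    have "0 \<le> prim (cmod (zeta h t))"
      using prim_strict_mono[of 0 "cmod (zeta h t)"] prim_0 by (cases "zeta h t = 0") auto
    then show ?thesis using Re_zeta[OF h, of t] level_neg by simp
  qed
  then have nz: "zeta h t \<noteq> 0" for t by (metis less_irrefl zero_complex.simps(1))
  have np: "zeta h t \<notin> \<real>\<^sub>\<le>\<^sub>0" for t using re[of t] by (auto simp: complex_nonpos_Reals_iff)
  define \<psi> where "\<psi> t = \<theta> t - pi / 2 - Im (ln (zeta h t))" for t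
  have polar: "cur t = of_real (cmod (zeta h t)) * cis (\<psi> t)" for t
  proof -
    have "zeta h t = exp (ln (zeta h t))" using nz by simp
    also have "\<dots> = of_real (exp (Re (ln (zeta h t)))) * cis (Im (ln (zeta h t)))" by (simp add: exp_eq_polar)
    also have "exp (Re (ln (zeta h t))) = cmod (zeta h t)" using nz by simp
    finally have "cnj (zeta h t) = of_real (cmod (zeta h t)) * cis (- Im (ln (zeta h t)))"
      by (metis cis_cnj complex_cnj_complex_of_real complex_cnj_mult)
    moreover have "cis (\<psi> t) = cis (- (pi / 2)) * cis (\<theta> t) * cis (- Im (ln (zeta h t)))"
      unfolding cis_mult \<psi>_def by (simp add: algebra_simps)
    moreover have "cis (- (pi / 2)) = - \<i>" by (simp add: complex_eq_iff)
    ultimately show ?thesis by (simp add: cur_def mult_ac)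
  qed
  \<comment> \<open>Dividing the field by \<zeta> gives \<i> f - \<i>/\<zeta>, so \<kappa> cancels
    in the derivative of \<psi>.\<close>
  have der: "(\<psi> has_real_derivative Re (1 / zeta h t)) (at t)" for t
  proof -
    have "((\<lambda>t. ln (zeta h t)) has_vector_derivative (\<i> * grad (zeta h t)) * (1 / zeta h t)) (at t)"
      using field_vector_diff_chain_at[OF zeta_derivative[OF h nz] has_field_derivative_Ln[OF np]]
      by (simp add: o_def inverse_eq_divide)
    from bounded_linear.has_vector_derivative[OF bounded_linear_Im this]
    have "((\<lambda>t. Im (ln (zeta h t))) has_real_derivative Im ((\<i> * grad (zeta h t)) * (1 / zeta h t))) (at t)"
      by (simp add: has_real_derivative_iff_has_vector_derivative)
    moreover have "Im ((\<i> * grad (zeta h t)) * (1 / zeta h t)) = \<kappa> t - Re (1 / zeta h t)"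
    proof -
      have "(\<i> * grad (zeta h t)) * (1 / zeta h t) = \<i> * of_real (f (cmod (zeta h t))) - \<i> * (1 / zeta h t)"
        using nz[of t] by (simp add: grad_def field_simps)
      moreover have "Im (\<i> * of_real r - \<i> * w) = r - Re w" for r w by simp
      ultimately show ?thesis using \<kappa>_eq[OF nz] by (simp only:)
    qed
    ultimately have "((\<lambda>t. Im (ln (zeta h t))) has_real_derivative \<kappa> t - Re (1 / zeta h t)) (at t)"
      by (simp only:)
    from DERIV_diff[OF DERIV_diff[OF \<theta>_derivative[of t] DERIV_const[of "pi / 2"]] this]
    show ?thesis by (simp add: \<psi>_def[abs_def])
  qed
  have pos: "0 < Re (1 / zeta h t)" for t
  proof -
    have "0 < (cmod (zeta h t))\<^sup>2" using nz by simp
    then show ?thesis using re[of t] by (simp add: Re_divide cmod_power2)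
  qed
  have mono: "\<psi> x < \<psi> y" if "x < y" for x y
    by (rule DERIV_pos_imp_increasing[OF that]) (use der pos in blast)
  have \<psi>0: "\<psi> 0 = 0"
  proof -
    have "0 < a + rad h 0" using a_pos rad_pos[OF h, of 0] by simp
    then have "Im (ln (zeta h 0)) = 0" unfolding zeta_0[OF h] by (simp only: Ln_of_real Im_complex_of_real)
    then show ?thesis by (simp add: \<psi>_def \<theta>_0)
  qed
  have \<psi>_uminus: "\<psi> (- t) = - \<psi> t" for t
    using np[of t] by (simp add: \<psi>_def zeta_uminus[OF h] cnj_Ln[symmetric] \<theta>_uminus)
  have cont: "continuous_on S \<psi>" for S
    using der DERIV_isCont continuous_at_imp_continuous_on by blast
  note P = len_pos
  have "\<psi> (len / 2) = pi"
  proof -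
    have p0: "0 < \<psi> (len / 2)" using mono[of 0 "len / 2"] P \<psi>0 by simp
    \<comment> \<open>Otherwise \<psi> would reach \<pi> earlier, at a point of the real axis,
      contrary to \<open>Im_cur_pos\<close>. As \<open>cur (len / 2)\<close> is real, only \<pi>
      itself remains.\<close>
    have "\<psi> (len / 2) \<le> pi"
    proof (rule ccontr)
      assume gt: "\<not> \<psi> (len / 2) \<le> pi"
      then obtain t where t: "0 \<le> t" "t \<le> len / 2" "\<psi> t = pi"
        using IVT'[of \<psi> 0 pi "len / 2"] \<psi>0 P cont by force
      have "t \<noteq> 0" using t(3) \<psi>0 by auto
      moreover have "t \<noteq> len / 2" using t(3) gt by (metis order.refl)
      ultimately have "0 < Im (cur t)" using t by (intro Im_cur_pos) auto
      then show False using t(3) by (simp add: polar)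
    qed
    moreover have "sin (\<psi> (len / 2)) = 0"
    proof -
      have "cur (len / 2) = cur (- (len / 2))" using cur_len[of "- (len / 2)" 1] by simp
      then have "Im (cur (len / 2)) = 0" by (simp add: cur_uminus complex_eq_iff)
      then show ?thesis using nz by (simp add: polar)
    qed
    ultimately show ?thesis using p0 sin_gt_zero[of "\<psi> (len / 2)"] by force
  qed
  moreover have "\<psi> (len / 2) = \<psi> (- (len / 2)) + real n * turn"
  proof -
    have "len / 2 = - (len / 2) + of_int (int n) * per h" by (simp add: len_def)
    note shift = this
    have "\<theta> (len / 2) = \<theta> (- (len / 2)) + of_int (int n) * turn"
      by (subst shift) (rule \<theta>_periodic_int)
    moreover have z: "zeta h (len / 2) = zeta h (- (len / 2))"
      by (subst shift) (rule zeta_periodic[OF h])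
    have "Im (ln (zeta h (len / 2))) = Im (ln (zeta h (- (len / 2))))" by (simp only: z)
    ultimately show ?thesis unfolding \<psi>_def of_int_of_nat_eq by linarith
  qed
  ultimately show ?thesis using \<psi>_uminus[of "len / 2"] by linarith
qed

end

subsection \<open>Maximality\<close>

text \<open>Each point is isolated by a member of a countable basis, and different points need
  different members.\<close>

lemma countable_isolated:
  fixes S :: "'a::second_countable_topology set"
  assumes "\<And>x. x \<in> S \<Longrightarrow> \<exists>U. open U \<and> x \<in> U \<and> U \<inter> S = {x}"
  shows "countable S"
proof -
  obtain B :: "'a set set" where B: "countable B" "topological_basis B"
    using ex_countable_basis by blast
  have "\<exists>b\<in>B. b \<inter> S = {x}" if x: "x \<in> S" for x
  proof -
    obtain U where U: "open U" "x \<in> U" "U \<inter> S = {x}" using assms[OF x] by blast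
    then obtain b where "b \<in> B" "x \<in> b" "b \<subseteq> U" using topological_basisE[OF B(2)] by metis
    then show ?thesis using U(3) x by (intro bexI[of _ b]) auto
  qed
  then obtain b where b: "\<And>x. x \<in> S \<Longrightarrow> b x \<in> B \<and> b x \<inter> S = {x}" by metis
  have "inj_on b S" using b by (intro inj_onI) (metis singleton_inject)
  moreover have "b ` S \<subseteq> B" using b by blast
  ultimately show ?thesis using B(1) by (meson countable_image_inj_on countable_subset)
qed

text \<open>Transversality makes the derivative of \<open>c t - g u\<close> injective and hence
  bounded below, so that near the crossing the linear part dominates the remainder.\<close>

lemma transversal_isolated:
  assumes c: "(c has_vector_derivative p) (at t0)" and g: "(g has_vector_derivative q) (at u0)"
    and eq: "c t0 = g u0" and trans: "Im (cnj p * q) \<noteq> 0"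
  shows "\<exists>U. open U \<and> (t0, u0) \<in> U \<and> (\<forall>(t, u)\<in>U. c t = g u \<longrightarrow> (t, u) = (t0, u0))"
proof -
  define D where "D x = c (fst x) - g (snd x)" for x
  define D' where "D' v = fst v *\<^sub>R p - snd v *\<^sub>R q" for v :: "real \<times> real"
  have "((\<lambda>x. c (fst x)) has_derivative (\<lambda>v. fst v *\<^sub>R p)) (at (t0, u0))"
    using has_derivative_compose[OF bounded_linear_imp_has_derivative[OF bounded_linear_fst], of c _ "(t0, u0)" UNIV]
      c by (simp add: has_vector_derivative_def)
  moreover have "((\<lambda>x. g (snd x)) has_derivative (\<lambda>v. snd v *\<^sub>R q)) (at (t0, u0))"
    using has_derivative_compose[OF bounded_linear_imp_has_derivative[OF bounded_linear_snd], of g _ "(t0, u0)" UNIV]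
      g by (simp add: has_vector_derivative_def)
  ultimately have D: "(D has_derivative D') (at (t0, u0))"
    unfolding D_def D'_def by (rule has_derivative_diff)
  then have lin: "linear D'" by (rule has_derivative_linear)
  have "v = 0" if "D' v = 0" for v
  proof -
    have e: "fst v *\<^sub>R p = snd v *\<^sub>R q" using that by (simp add: D'_def)
    have "fst v * Im (cnj p * p) = Im (cnj p * (fst v *\<^sub>R p))" by (simp add: algebra_simps)
    also have "\<dots> = snd v * Im (cnj p * q)" unfolding e by (simp add: algebra_simps)
    finally have s: "snd v = 0" using trans by (simp add: mult.commute)
    have "p \<noteq> 0" using trans by auto
    then have "fst v = 0" using e s by simp
    with s show ?thesis by (simp add: prod_eq_iff)
  qed
  then have "inj D'" using lin by (simp add: linear_injective_0)
  then obtain B where B: "0 < B" "\<And>v. B * norm v \<le> norm (D' v)"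
    using linear_inj_bounded_below_pos[OF lin] by blast
  obtain d where d: "0 < d" "\<And>y. norm (y - (t0, u0)) < d \<Longrightarrow>
      norm (D y - D (t0, u0) - D' (y - (t0, u0))) \<le> B / 2 * norm (y - (t0, u0))"
    using D B(1) unfolding has_derivative_at_alt by (meson half_gt_zero)
  have D0: "D (t0, u0) = 0" using eq by (simp add: D_def)
  have "y = (t0, u0)" if "y \<in> ball (t0, u0) d" "D y = 0" for y
  proof -
    have "norm (D' (y - (t0, u0))) \<le> B / 2 * norm (y - (t0, u0))"
      using d(2)[of y] that D0 by (simp add: dist_norm norm_minus_commute)
    with B(2)[of "y - (t0, u0)"] have "B * norm (y - (t0, u0)) \<le> B / 2 * norm (y - (t0, u0))" by linarith
    then have "norm (y - (t0, u0)) \<le> 0" using B(1) by (simp add: field_simps mult_le_0_iff)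
    then show ?thesis by simp
  qed
  then show ?thesis
    using d(1) by (intro exI[of _ "ball (t0, u0) d"]) (auto simp: D_def)
qed

text \<open>On half a period the modulus is strictly monotone and takes each value at most once;
  reflection and periodicity add countably many further parameters.\<close>

lemma (in pre_rosette) countable_level_cmod: "countable {t. cmod (zeta h t) = r}"
proof -
  let ?A = "{t. cmod (zeta h t) = r}"
  let ?U = "{u. 0 \<le> u \<and> u \<le> per h / 2 \<and> cmod (zeta h u) = r}"
  have "x = y" if "x \<in> ?U" "y \<in> ?U" for x y
    using that cmod_zeta_decreasing[OF h, of x y] cmod_zeta_decreasing[OF h, of y x]
    by (cases x y rule: linorder_cases) auto
  then have "?U \<subseteq> {SOME u. u \<in> ?U}" by (metis (no_types, lifting) singletonI someI subsetI)
  then have "countable ?U" by (rule countable_subset) simp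
  then have "countable ((\<lambda>(u, k::int). u + of_int k * per h) ` (?U \<times> UNIV) \<union>
      (\<lambda>(u, k::int). - u + of_int k * per h) ` (?U \<times> UNIV))" by simp
  moreover have "?A \<subseteq> (\<lambda>(u, k::int). u + of_int k * per h) ` (?U \<times> UNIV) \<union>
      (\<lambda>(u, k::int). - u + of_int k * per h) ` (?U \<times> UNIV)"
  proof
    fix t assume t: "t \<in> ?A"
    obtain k :: int and u where u: "t = u + of_int k * per h" "\<bar>u\<bar> \<le> per h / 2" by (rule reduce_period)
    have "cmod (zeta h \<bar>u\<bar>) = r" using t u(1) zeta_periodic[OF h] by (simp add: cmod_zeta_abs)
    then have "(\<bar>u\<bar>, k) \<in> ?U \<times> UNIV" using u(2) by simp
    moreover have "t = \<bar>u\<bar> + of_int k * per h \<or> t = - \<bar>u\<bar> + of_int k * per h" using u(1) by auto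
    ultimately show "t \<in> (\<lambda>(u, k::int). u + of_int k * per h) ` (?U \<times> UNIV) \<union>
      (\<lambda>(u, k::int). - u + of_int k * per h) ` (?U \<times> UNIV)" by force
  qed
  ultimately show ?thesis using countable_subset[rotated] by meson
qed

lemma unit_parallel:
  assumes "cmod p = 1" "cmod q = 1" "Im (cnj p * q) = 0"
  shows "q = p \<or> q = - p"
proof -
  have "cmod (cnj p * q) = 1" using assms by (simp add: norm_mult)
  then have "\<bar>Re (cnj p * q)\<bar> = 1" using assms(3) by (simp add: cmod_eq_Re)
  then have "cnj p * q = 1 \<or> cnj p * q = - 1" using assms(3) by (auto simp: complex_eq_iff abs_if split: if_splits)
  moreover have "p * (cnj p * q) = q"
    using complex_norm_square[of p] assms(1) by (simp flip: mult.assoc)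
  ultimately show ?thesis by (metis mult.right_neutral mult_minus_right)
qed

lemma (in attractive_curvature) ham_frame_constant:
  assumes "sol_path f J c \<psi>"
  obtains h' where "\<And>t. t \<in> J \<Longrightarrow> ham (frame c \<psi> t) = h'"
  using assms
proof (cases rule: frame_cases)
  case fixed
  then show ?thesis using that[of ham_min] by (simp add: ham_min_def)
next
  case (orbit h d)
  then show ?thesis using that[of h] ham_zeta by simp
qed

context rosette
begin

text \<open>A solution whose trace contains that of \<open>cur\<close> meets it transversally at most at countably many
  points unless both run along the same orbit.\<close>

lemma maximal_aux:
  assumes h0: "h \<noteq> 0" and g: "sol_path f J g \<psi>" and sub: "range cur \<subseteq> g ` J"
  shows "g ` J \<subseteq> range cur"
proof -
  have nz: "zeta h t \<noteq> 0" for t using ham_zeta[OF h, of t] h0 ham_0 by auto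
  have cz: "cur t \<noteq> 0" for t using nz cur_eq_0 by blast
  obtain h' where h': "\<And>t. t \<in> J \<Longrightarrow> ham (frame g \<psi> t) = h'" using ham_frame_constant[OF g] by blast
  have "\<exists>t u. u \<in> J \<and> cur t = g u \<and> frame g \<psi> u = zeta h t"
  proof (rule ccontr)
    assume no: "\<not> ?thesis"
    \<comment> \<open>These parameters are discarded because tangency in opposite directions gives
      frames \<open>zeta h t\<close> and \<open>- zeta h t\<close>. Adding the two level equations,
      the real parts cancel and the equation of \<open>N\<close> remains.\<close>
    define N where "N = {t. 2 * prim (cmod (zeta h t)) = h + h'}"
    have "countable N"
    proof (cases "N = {}")
      case False
      then obtain t1 where t1: "t1 \<in> N" by blast
      have "N \<subseteq> {t. cmod (zeta h t) = cmod (zeta h t1)}"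
      proof
        fix t assume "t \<in> N"
        then have "prim (cmod (zeta h t)) = prim (cmod (zeta h t1))" using t1 by (simp add: N_def)
        then show "t \<in> {t. cmod (zeta h t) = cmod (zeta h t1)}"
          using prim_strict_mono[of "cmod (zeta h t)" "cmod (zeta h t1)"]
            prim_strict_mono[of "cmod (zeta h t1)" "cmod (zeta h t)"]
          by (cases "cmod (zeta h t)" "cmod (zeta h t1)" rule: linorder_cases) auto
      qed
      then show ?thesis using countable_level_cmod countable_subset by blast
    qed simp
    define S where "S = {(t, u). t \<notin> N \<and> u \<in> J \<and> cur t = g u}"
    have "countable S"
    proof (rule countable_isolated)
      fix x assume "x \<in> S"
      then obtain t u where x: "x = (t, u)" "t \<notin> N" "u \<in> J" "cur t = g u" by (auto simp: S_def)
      have "Im (cnj (cis (\<theta> t)) * cis (\<psi> u)) \<noteq> 0"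
      proof
        assume "Im (cnj (cis (\<theta> t)) * cis (\<psi> u)) = 0"
        then have "cis (\<psi> u) = cis (\<theta> t) \<or> cis (\<psi> u) = - cis (\<theta> t)"
          by (intro unit_parallel) auto
        then have "frame g \<psi> u = frame cur \<theta> t \<or> frame g \<psi> u = - frame cur \<theta> t"
          using x(4) by (auto simp: frame_def)
        then have "frame g \<psi> u = - zeta h t" using no x by (auto simp: frame_cur)
        then have "Re (frame g \<psi> u) = - Re (zeta h t)" "cmod (frame g \<psi> u) = cmod (zeta h t)" by auto
        then have "prim (cmod (zeta h t)) - h' = - (prim (cmod (zeta h t)) - h)"
          using h'[OF x(3)] Re_zeta[OF h, of t] by (simp add: ham_def)
        then show False using x(2) by (simp add: N_def)
      qed
      then obtain U where U: "open U" "(t, u) \<in> U" "\<forall>(t', u')\<in>U. cur t' = g u' \<longrightarrow> (t', u') = (t, u)"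
        using transversal_isolated[OF cur_derivative sol_pathD(7)[OF g x(3)] x(4)] by blast
      then show "\<exists>U. open U \<and> x \<in> U \<and> U \<inter> S = {x}"
        using \<open>x \<in> S\<close> x(1) by (intro exI[of _ U]) (auto simp: S_def)
    qed
    then have "countable (fst ` S)" by simp
    moreover have "UNIV \<subseteq> fst ` S \<union> N"
    proof
      fix t
      obtain u where "u \<in> J" "cur t = g u" using sub by blast
      then show "t \<in> fst ` S \<union> N" by (force simp: S_def)
    qed
    moreover have "countable (fst ` S \<union> N)" using calculation(1) \<open>countable N\<close> by simp
    ultimately have "countable (UNIV :: real set)" using countable_subset[of UNIV "fst ` S \<union> N"] by simp
    then show False using uncountable_UNIV_real by blast
  qed
  then obtain t u where tu: "u \<in> J" "cur t = g u" "frame g \<psi> u = zeta h t" by blast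
  from g show ?thesis
  proof (cases rule: frame_cases)
    case fixed
    then show ?thesis using tu zeta_neq[OF h] by metis
  next
    case (orbit h1 d)
    have "h1 = h" using orbit(2)[OF tu(1)] tu(3) ham_zeta[OF h] ham_zeta[OF orbit(1)] by metis
    then obtain \<alpha> where \<alpha>: "\<forall>x\<in>J. g x = cis \<alpha> * cur (x + d) \<and> \<psi> x = \<theta> (x + d) + \<alpha>"
      using rigid[OF g, of d] orbit(2) by blast
    have "zeta h (u + d) = zeta h t" using orbit(2)[OF tu(1)] tu(3) \<open>h1 = h\<close> by simp
    then obtain k :: int where k: "u + d = t + of_int k * per h" using zeta_eq_iff[OF h] by blast
    have "g u = cis \<alpha> * cis (of_int k * turn) * cur t"
      using \<alpha> tu(1) k cur_periodic_int[of t k] by (simp add: mult.assoc)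
    then have one: "cis \<alpha> * cis (of_int k * turn) = 1" using tu(2) cz[of t] by simp
    show ?thesis
    proof
      fix w assume "w \<in> g ` J"
      then obtain x where x: "x \<in> J" "w = g x" by blast
      have "w = cis \<alpha> * cur ((x + d - of_int k * per h) + of_int k * per h)" using x \<alpha> by simp
      also have "\<dots> = cis \<alpha> * cis (of_int k * turn) * cur (x + d - of_int k * per h)"
        unfolding cur_periodic_int by (simp only: mult.assoc)
      finally show "w \<in> range cur" using one by simp
    qed
  qed
qed

lemma range_rotated: "range (\<lambda>t. cis \<alpha> * cur (t + d)) = (\<lambda>w. cis \<alpha> * w) ` range cur"
proof -
  have "cur t \<in> range (\<lambda>t. cur (t + d))" for t by (rule image_eqI[of _ _ "t - d"]) auto
  then have "range (\<lambda>t. cur (t + d)) = range cur" by auto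
  then have "(\<lambda>w. cis \<alpha> * w) ` range (\<lambda>t. cur (t + d)) = (\<lambda>w. cis \<alpha> * w) ` range cur" by (rule arg_cong)
  then show ?thesis by (simp only: image_image)
qed

lemma maximal:
  assumes "h \<noteq> 0"
  shows "maximal_solution f (path_equiv `` {(UNIV, \<lambda>t. cis \<alpha> * cur (t + d))})"
proof -
  let ?c = "\<lambda>t. cis \<alpha> * cur (t + d)"
  let ?C = "path_equiv `` {(UNIV, ?c)}"
  have trace: "curve_trace ?C = (\<lambda>w. cis \<alpha> * w) ` range cur"
    using curve_trace_class[OF sol_pathD(1)[OF sol_rotated]] range_rotated by metis
  have "curve_trace ?C = curve_trace C'" if C': "is_solution f C'" "curve_trace ?C \<subseteq> curve_trace C'" for C'
  proof -
    have or: "C' \<in> oriented_curves" using C'(1) by (simp add: is_solution_def)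
    then obtain J g where g: "(J, g) \<in> C'" by (rule oriented_curve_rep)
    then obtain \<psi> where "sol_path f J g \<psi>" using solution_sol_path[OF C'(1)] by blast
    then have sg: "sol_path f J (\<lambda>t. cis (- \<alpha>) * g t) (\<lambda>t. \<psi> t + - \<alpha>)" by (rule sol_path_rotate)
    have tr: "curve_trace C' = g ` J" by (rule curve_trace_rep[OF or g])
    have inv: "cis (- \<alpha>) * (cis \<alpha> * w) = w" "cis \<alpha> * (cis (- \<alpha>) * w) = w" for w
      by (simp_all add: cis_mult flip: mult.assoc)
    have "range cur \<subseteq> (\<lambda>t. cis (- \<alpha>) * g t) ` J"
    proof
      fix w assume "w \<in> range cur"
      then have "cis \<alpha> * w \<in> g ` J" using C'(2) trace tr by blast
      then obtain x where "x \<in> J" "cis \<alpha> * w = g x" by blast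
      then have "w = cis (- \<alpha>) * g x" using inv(1)[of w] by simp
      then show "w \<in> (\<lambda>t. cis (- \<alpha>) * g t) ` J" using \<open>x \<in> J\<close> by blast
    qed
    from maximal_aux[OF assms sg this] have *: "cis (- \<alpha>) * g x \<in> range cur" if "x \<in> J" for x using that by blast
    have "curve_trace C' \<subseteq> curve_trace ?C"
    proof
      fix w assume "w \<in> curve_trace C'"
      then obtain x where "x \<in> J" "w = g x" using tr by blast
      then have "w = cis \<alpha> * (cis (- \<alpha>) * g x)" using inv(2) by simp
      then show "w \<in> curve_trace ?C" unfolding trace using *[OF \<open>x \<in> J\<close>] by blast
    qed
    then show ?thesis using C'(2) by blast
  qed
  then show ?thesis
    using sol_path_solution[OF sol_rotated] unfolding maximal_solution_def by blast
qed

end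

subsection \<open>Closed maximal solutions\<close>

context attractive_curvature
begin

text \<open>A solution of level 0 that avoids the origin extends to the whole interval between two
  consecutive zeros of its frame, without new points by maximality. There the modulus is positive
  but tends to 0, so it attains no minimum on the trace.\<close>

lemma no_compact_between_zeros:
  assumes C: "maximal_solution f C" "compact (curve_trace C)" "(J, c) \<in> C"
    and sol: "sol_path f J c \<psi>" and fr: "\<And>t. t \<in> J \<Longrightarrow> frame c \<psi> t = zeta 0 (t + d)"
  shows "\<exists>t\<in>J. c t = 0"
proof (rule ccontr)
  assume "\<not> ?thesis"
  then have cnz: "c t \<noteq> 0" if "t \<in> J" for t using that by blast
  note s = sol_pathD[OF sol]
  note h = ham_min_neg
  let ?T = "per 0"
  have T: "0 < ?T" using per_pos[OF h] .
  have z_half: "zeta 0 (?T / 2) = 0" "zeta 0 (- (?T / 2)) = 0"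
  proof -
    have "rad 0 pi = a" by (rule rad_eqI[OF h a_pos]) (simp add: ham_0)
    then show "zeta 0 (?T / 2) = 0" by (simp add: zeta_half[OF h])
    then show "zeta 0 (- (?T / 2)) = 0" by (simp only: zeta_uminus[OF h]) simp
  qed
  obtain k :: int and u where u: "d = u + of_int k * ?T" "\<bar>u\<bar> \<le> ?T / 2"
  proof
    let ?k = "round (d / ?T)"
    show "d = (d - of_int ?k * ?T) + of_int ?k * ?T" by simp
    have "\<bar>of_int ?k - d / ?T\<bar> * ?T \<le> 1/2 * ?T"
      using T of_int_round_abs_le[of "d / ?T"] by (intro mult_right_mono) auto
    moreover have "\<bar>of_int ?k - d / ?T\<bar> * ?T = \<bar>(of_int ?k - d / ?T) * ?T\<bar>" using T by (simp add: abs_mult)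
    moreover have "(of_int ?k - d / ?T) * ?T = - (d - of_int ?k * ?T)" using T by (simp add: algebra_simps)
    then have "\<bar>(of_int ?k - d / ?T) * ?T\<bar> = \<bar>d - of_int ?k * ?T\<bar>" by (simp only: abs_minus_cancel)
    ultimately show "\<bar>d - of_int ?k * ?T\<bar> \<le> ?T / 2" by simp
  qed
  have fr': "frame c \<psi> t = zeta 0 (t + u)" if "t \<in> J" for t
    using fr[OF that] zeta_periodic[OF h, of "t + u" k] u(1) by (simp add: add.assoc)
  have nzJ: "zeta 0 (t + u) \<noteq> 0" if "t \<in> J" for t
    using cnz[OF that] fr'[OF that] frame_eq_0[of c \<psi> t] by simp
  \<comment> \<open>The end points are consecutive zeros of \<open>zeta 0 (t + u)\<close> on either
    side of 0.\<close>
  define I where "I = {- (?T / 2) - u<..<?T / 2 - u}"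
  have "u \<noteq> v" if "zeta 0 v = 0" for v using nzJ[OF s(4)] that by auto
  from this[OF z_half(1)] this[OF z_half(2)] have u': "\<bar>u\<bar> < ?T / 2" using u(2) by auto
  have nzI: "zeta 0 (t + u) \<noteq> 0" if "t \<in> I" for t
  proof -
    have "cmod (zeta 0 (?T / 2)) < cmod (zeta 0 \<bar>t + u\<bar>)"
      by (rule cmod_zeta_decreasing[OF h abs_ge_zero _ order.refl])
        (use that in \<open>unfold I_def greaterThanLessThan_iff, linarith\<close>)
    moreover have "cmod (zeta 0 \<bar>t + u\<bar>) = cmod (zeta 0 (t + u))"
      using zeta_uminus[OF h, of "t + u"] by (simp add: abs_if)
    ultimately show ?thesis by auto
  qed
  have JI: "J \<subseteq> I"
  proof
    fix t assume t: "t \<in> J"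
    have "t < ?T / 2 - u"
    proof (rule ccontr)
      assume "\<not> ?thesis"
      then have "?T / 2 - u \<in> J" using mem_is_interval_1_I[OF s(3) s(4) t, of "?T / 2 - u"] u' by auto
      then show False using nzJ z_half(1) by force
    qed
    moreover have "- (?T / 2) - u < t"
    proof (rule ccontr)
      assume "\<not> ?thesis"
      then have "- (?T / 2) - u \<in> J" using mem_is_interval_1_I[OF s(3) t s(4), of "- (?T / 2) - u"] u' by auto
      then show False using nzJ z_half(2) by force
    qed
    ultimately show "t \<in> I" by (simp add: I_def)
  qed
  have I: "open I" "is_interval I" "0 \<in> I" using u' by (auto simp: I_def)
  define \<kappa> where "\<kappa> t = f (cmod (zeta 0 (t + u)))" for t
  have zc: "continuous_on UNIV (\<lambda>t. zeta 0 (t + u))"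
    by (rule continuous_on_compose2[OF continuous_on_zeta[OF h, of UNIV]]) (intro continuous_intros, simp)
  have "isCont \<kappa> t" if "t \<in> I" for t
    unfolding \<kappa>_def
  proof (rule isCont_o2[OF _ isCont_f])
    have "isCont (\<lambda>t. zeta 0 (t + u)) t" using zc by (simp add: continuous_on_eq_continuous_at)
    then show "isCont (\<lambda>t. cmod (zeta 0 (t + u))) t" by (intro continuous_intros)
    show "0 < cmod (zeta 0 (t + u))" using nzI[OF that] by simp
  qed
  then have "continuous_on I \<kappa>" by (simp add: continuous_at_imp_continuous_on)
  then obtain G where G: "\<forall>t\<in>I. (G has_vector_derivative \<kappa> t) (at t)"
    using antiderivative_on_interval[OF I(1,2)] by blast
  define \<theta> where "\<theta> t = G t - G 0 + \<psi> 0" for t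
  have \<theta>: "(\<theta> has_real_derivative \<kappa> t) (at t)" if "t \<in> I" for t
    unfolding \<theta>_def using G that
    by (auto simp: has_real_derivative_iff_has_vector_derivative intro!: derivative_eq_intros)
  define g where "g t = - \<i> * cnj (zeta 0 (t + u)) * cis (\<theta> t)" for t
  have cg: "cmod (g t) = cmod (zeta 0 (t + u))" for t by (simp add: g_def norm_mult)
  have sg: "sol_path f I g \<theta>"
  proof (rule sol_path_bootstrap[OF f_smooth I])
    fix t assume t: "t \<in> I"
    have "((\<lambda>t. t + u) has_vector_derivative 1) (at t)" by (auto intro!: derivative_eq_intros)
    from vector_diff_chain_at[OF this zeta_derivative[OF h nzI[OF t]]]
    have "((\<lambda>t. zeta 0 (t + u)) has_vector_derivative \<i> * grad (zeta 0 (t + u))) (at t)" by (simp add: o_def)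
    from curve_of_frame[OF this] show "(g has_vector_derivative cis (\<theta> t)) (at t)"
      using \<theta>[OF t] by (simp add: g_def[abs_def] \<kappa>_def)
    show "g t \<noteq> 0" using cg[of t] nzI[OF t] by auto
    show "(\<theta> has_real_derivative f (cmod (g t))) (at t)" using \<theta>[OF t] cg by (simp add: \<kappa>_def)
  qed
  have "\<psi> t - \<theta> t = \<psi> 0 - \<theta> 0" if t: "t \<in> J" for t
  proof (rule zero_derivative_constant[of J "\<lambda>t. \<psi> t - \<theta> t" "\<lambda>_. False"])
    show "continuous_on J (\<lambda>t. \<psi> t - \<theta> t)"
      using smooth_on_continuous[OF s(6)] continuous_on_subset[OF smooth_on_continuous[OF sol_pathD(6)[OF sg]] JI]
      by (intro continuous_intros)
    fix t assume t: "t \<in> J"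
    have "cmod (c t) = cmod (zeta 0 (t + u))" using fr'[OF t] cmod_frame[of c \<psi> t] by simp
    then have "(\<psi> has_real_derivative \<kappa> t) (at t)" using s(8)[OF t cnz[OF t]] by (simp add: \<kappa>_def)
    from DERIV_diff[OF this \<theta>] show "((\<lambda>t. \<psi> t - \<theta> t) has_vector_derivative 0) (at t)"
      using t JI by (auto simp: has_real_derivative_iff_has_vector_derivative)
  qed (use s t in auto)
  then have "\<psi> t = \<theta> t" if "t \<in> J" for t using that by (simp add: \<theta>_def)
  then have eq: "c t = g t" if "t \<in> J" for t
    using frame_inverse[of c t \<psi>] fr'[OF that] that by (simp add: g_def)
  have "c ` J \<subseteq> g ` I" using eq JI by auto
  from maximal_solution_trace[OF C(1,3) sg this]
  have "compact (g ` I)"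
    using C curve_trace_rep[of C J c] by (simp add: maximal_solution_def is_solution_def)
  then obtain w where w: "w \<in> g ` I" "\<And>v. v \<in> g ` I \<Longrightarrow> norm w \<le> norm v"
    using continuous_attains_inf[of "g ` I" norm] I(3) continuous_on_norm_id by blast
  then obtain t1 where "t1 \<in> I" "w = g t1" by blast
  then have w0: "0 < norm w" using nzI cg by simp
  have "((\<lambda>t. cmod (zeta 0 (t + u))) \<longlongrightarrow> cmod (zeta 0 (?T / 2 - u + u))) (at_left (?T / 2 - u))"
  proof -
    have "isCont (\<lambda>t. cmod (zeta 0 (t + u))) (?T / 2 - u)"
      using continuous_on_norm[OF zc] by (simp add: continuous_on_eq_continuous_at)
    then show ?thesis by (auto simp: isCont_def intro: filterlim_mono at_le)
  qed
  then have "\<forall>\<^sub>F t in at_left (?T / 2 - u). cmod (zeta 0 (t + u)) < norm w"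
    using order_tendstoD(2) w0 z_half(1) by force
  moreover have "\<forall>\<^sub>F t in at_left (?T / 2 - u). t \<in> I"
    unfolding I_def using u' by (intro eventually_at_leftI[of "- (?T / 2) - u"]) auto
  ultimately have "\<forall>\<^sub>F t in at_left (?T / 2 - u). cmod (zeta 0 (t + u)) < norm w \<and> t \<in> I"
    by (rule eventually_conj)
  then obtain t where "cmod (zeta 0 (t + u)) < norm w" "t \<in> I"
    using eventually_happens[of _ "at_left (?T / 2 - u)"] trivial_limit_at_left_real by blast
  then show False using w(2)[of "g t"] cg[of t] by auto
qed

lemma compact_rotated: "compact ((\<lambda>w. cis \<alpha> * w) ` S) \<longleftrightarrow> compact S"
proof -
  have *: "compact ((\<lambda>w. cis \<beta> * w) ` S)" if "compact S" for \<beta> and S :: "complex set"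
    by (rule compact_continuous_image[OF _ that]) (intro continuous_intros)
  have "(\<lambda>w. cis (- \<alpha>) * w) ` (\<lambda>w. cis \<alpha> * w) ` S = S"
    by (simp add: image_image cis_mult flip: mult.assoc)
  then show ?thesis using *[of S \<alpha>] *[of "(\<lambda>w. cis \<alpha> * w) ` S" "- \<alpha>"] by auto
qed

text \<open>A frame resting at \<open>a\<close> belongs to a circle, any other frame to an orbit. As
  the representative may live on a bounded interval, both cases deliver a continuation to the whole
  line, with the same trace by maximality. At level 0 compactness forces a passage through the
  origin, which makes the rosette available.\<close>

lemma closed_maximal_cases:
  assumes C: "maximal_solution f C" "compact (curve_trace C)"
  obtains (circle) J c \<alpha> where "(J, c) \<in> C"
      "sol_path f UNIV (\<lambda>t. - \<i> * of_real a * cis (t / a + \<alpha>)) (\<lambda>t. t / a + \<alpha>)"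
      "\<And>t. t \<in> J \<Longrightarrow> c t = - \<i> * of_real a * cis (t / a + \<alpha>)"
      "range (\<lambda>t. - \<i> * of_real a * cis (t / a + \<alpha>)) = curve_trace C"
  | (rosette) J c h \<kappa> \<theta> n \<alpha> d where "(J, c) \<in> C" "closed_rosette f a h \<kappa> \<theta> n"
      "\<And>t. t \<in> J \<Longrightarrow> c t = cis \<alpha> * pre_rosette.cur f a h \<theta> (t + d)"
      "curve_trace C = (\<lambda>w. cis \<alpha> * w) ` range (pre_rosette.cur f a h \<theta>)"
proof -
  have or: "C \<in> oriented_curves" and solC: "is_solution f C"
    using C(1) by (auto simp: maximal_solution_def is_solution_def)
  obtain J c where Jc: "(J, c) \<in> C" using oriented_curve_rep[OF or] .
  obtain \<psi> where sol0: "sol_path f J c \<psi>" using solution_sol_path[OF solC Jc] by blast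
  note s = sol_pathD[OF sol0]
  note trace = curve_trace_rep[OF or Jc]
  from sol0 show thesis
  proof (cases rule: frame_cases)
    case fixed
    let ?g = "\<lambda>t. - \<i> * of_real a * cis (t / a + \<psi> 0)"
    have ca: "cmod (c t) = a" if "t \<in> J" for t
      using cmod_frame[of c \<psi> t] fixed[OF that] a_pos by simp
    have fa: "f a = 1 / a" using f_a a_pos by (simp add: field_simps)
    have sg: "sol_path f UNIV ?g (\<lambda>t. t / a + \<psi> 0)"
    proof (rule sol_path_bootstrap[OF f_smooth])
      have d: "((\<lambda>t. t / a + \<psi> 0) has_real_derivative 1 / a) (at t)" for t
        using a_pos by (auto intro!: derivative_eq_intros)
      have cg: "cmod (?g t) = a" for t using a_pos by (simp add: norm_mult)
      show "(?g has_vector_derivative cis (t / a + \<psi> 0)) (at t)" for t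
        using bounded_linear.has_vector_derivative[OF bounded_linear_mult_right[of "- \<i> * of_real a"] cis_real_derivative[OF d[of t]]]
          a_pos by simp
      show "?g t \<noteq> 0" for t using a_pos by simp
      show "((\<lambda>t. t / a + \<psi> 0) has_real_derivative f (cmod (?g t))) (at t)" for t
        using d[of t] fa unfolding cg by simp
    qed auto
    have \<psi>: "\<psi> t = t / a + \<psi> 0" if t: "t \<in> J" for t
    proof -
      have "\<psi> t - t / a = \<psi> 0 - 0 / a"
      proof (rule zero_derivative_constant[of J "\<lambda>t. \<psi> t - t / a" "\<lambda>_. False"])
        show "continuous_on J (\<lambda>t. \<psi> t - t / a)"
          using a_pos by (intro continuous_intros smooth_on_continuous s) auto
        fix t assume t: "t \<in> J"
        have "c t \<noteq> 0" using ca[OF t] a_pos by auto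
        then have "(\<psi> has_real_derivative 1 / a) (at t)" using s(8)[OF t] ca[OF t] fa by simp
        then have "((\<lambda>t. \<psi> t - t / a) has_real_derivative 1 / a - 1 / a) (at t)"
          using a_pos by (auto intro!: derivative_eq_intros)
        then show "((\<lambda>t. \<psi> t - t / a) has_vector_derivative 0) (at t)"
          by (simp add: has_real_derivative_iff_has_vector_derivative)
      qed (use s t in auto)
      then show ?thesis by simp
    qed
    have eq: "c t = ?g t" if "t \<in> J" for t
      using frame_inverse[of c t \<psi>] fixed[OF that] \<psi>[OF that] by simp
    then have "c ` J \<subseteq> range ?g" by auto
    from maximal_solution_trace[OF C(1) Jc sg this] have "range ?g = curve_trace C" using trace by simp
    then show thesis using circle[OF Jc sg eq] by blast
  next
    case (orbit h d)
    have "\<exists>\<kappa> \<theta>. rosette f a h \<kappa> \<theta>"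
    proof (cases "h = 0")
      case True
      then obtain t1 where t1: "t1 \<in> J" "c t1 = 0"
        using no_compact_between_zeros[OF C Jc sol0, of d] orbit(2) by auto
      from rosette_exists_through_0[OF sol0 orbit(2) orbit(1) t1] show ?thesis .
    qed (rule rosette_exists[OF orbit(1)])
    then obtain \<kappa> \<theta> where "rosette f a h \<kappa> \<theta>" by blast
    then interpret rosette f a h \<kappa> \<theta> .
    obtain \<alpha> where \<alpha>: "\<forall>t\<in>J. c t = cis \<alpha> * cur (t + d) \<and> \<psi> t = \<theta> (t + d) + \<alpha>"
      using rigid[OF sol0 orbit(2)] by blast
    then have "c ` J \<subseteq> range (\<lambda>t. cis \<alpha> * cur (t + d))" by auto
    from maximal_solution_trace[OF C(1) Jc sol_rotated this]
    have tr: "curve_trace C = (\<lambda>w. cis \<alpha> * w) ` range cur" using trace range_rotated by simp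
    then have "compact (range cur)" using C(2) compact_rotated by metis
    then have ex: "\<exists>n::nat. 0 < n \<and> cis (real n * turn) = 1" by (rule compact_imp_closes)
    define n where "n = (LEAST n::nat. 0 < n \<and> cis (real n * turn) = 1)"
    have n: "0 < n \<and> cis (real n * turn) = 1" unfolding n_def by (rule LeastI_ex[OF ex])
    have "n \<le> m" if "0 < m" "cis (real m * turn) = 1" for m
      unfolding n_def using that by (intro Least_le) simp
    then have "closed_rosette f a h \<kappa> \<theta> n" using n by unfold_locales auto
    then show thesis using rosette[OF Jc] \<alpha> tr by blast
  qed
qed

end

subsection \<open>The theorem for positive curvature\<close>

text \<open>The increment of \<theta> over one period does not depend on the starting point, here
  the near real point.\<close>

lemma (in rosette) integral_curvature:
  assumes "\<And>t. zeta h t \<noteq> 0"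
  shows "integral {0..per h} (\<lambda>t. f (cmod (zeta h (t + per h / 2)))) = turn"
proof -
  have "((\<lambda>t. \<theta> (t + per h / 2)) has_vector_derivative f (cmod (zeta h (t + per h / 2)))) (at t within {0..per h})" for t
    using DERIV_shift[of \<theta> "\<kappa> (t + per h / 2)" t "per h / 2"] \<theta>_derivative[of "t + per h / 2"] \<kappa>_eq[OF assms]
    by (auto simp: has_real_derivative_iff_has_vector_derivative intro: has_vector_derivative_at_within)
  then have "((\<lambda>t. f (cmod (zeta h (t + per h / 2)))) has_integral
      \<theta> (per h + per h / 2) - \<theta> (0 + per h / 2)) {0..per h}"
    using per_pos[OF h] by (intro fundamental_theorem_of_calculus) auto
  then show ?thesis using \<theta>_periodic[of "per h / 2"] by (simp add: integral_unique add.commute)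
qed

context attractive_curvature
begin

lemma inner_rosette:
  assumes "0 < s" "s < a"
  obtains \<kappa> \<theta> where "rosette f a (ham (of_real s)) \<kappa> \<theta>"
  using inner_level[OF assms] rosette_exists[of "ham (of_real s)"] by force

lemma net_winding_eq_turn:
  assumes "0 < s" "s < a" "rosette f a (ham (of_real s)) \<kappa> \<theta>"
  shows "net_winding f (of_real s) = pre_rosette.turn f a (ham (of_real s)) \<theta> / (2 * pi)"
    and "net_winding (\<lambda>s. - f s) (of_real (- s)) = pre_rosette.turn f a (ham (of_real s)) \<theta> / (2 * pi)"
proof -
  interpret rosette f a "ham (of_real s)" \<kappa> \<theta> by (rule assms(3))
  have "zeta (ham (of_real s)) t \<noteq> 0" for t
    using ham_zeta[OF h, of t] inner_level(2)[OF assms(1,2)] ham_0 by auto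
  from integral_curvature[OF this]
  show "net_winding f (of_real s) = turn / (2 * pi)"
    "net_winding (\<lambda>s. - f s) (of_real (- s)) = turn / (2 * pi)"
    using net_winding_pos[OF assms(1,2)] net_winding_neg[OF assms(1,2)] by simp_all
qed

text \<open>The parameter \<open>s\<close> is recovered from the trace as its smallest modulus,
  independently of rotations; the uniqueness of \<open>s\<close> rests on this.\<close>

lemma inner_min_modulus:
  assumes "0 < s" "s < a" "rosette f a (ham (of_real s)) \<kappa> \<theta>"
  shows "s \<in> cmod ` (\<lambda>w. cis \<alpha> * w) ` range (pre_rosette.cur f a (ham (of_real s)) \<theta>)"
    and "r \<in> cmod ` (\<lambda>w. cis \<alpha> * w) ` range (pre_rosette.cur f a (ham (of_real s)) \<theta>) \<Longrightarrow> s \<le> r"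
proof -
  interpret rosette f a "ham (of_real s)" \<kappa> \<theta> by (rule assms(3))
  let ?h = "ham (of_real s)"
  have half: "cmod (zeta ?h (per ?h / 2)) = s" using inner_level(3)[OF assms(1,2)] assms(1) by simp
  show "s \<in> cmod ` (\<lambda>w. cis \<alpha> * w) ` range cur"
  proof -
    have "s = cmod (cis \<alpha> * cur (per ?h / 2))" using half by (simp add: norm_mult cmod_cur)
    then show ?thesis by blast
  qed
  assume "r \<in> cmod ` (\<lambda>w. cis \<alpha> * w) ` range cur"
  then obtain t where "r = cmod (zeta ?h t)" by (auto simp: norm_mult cmod_cur)
  then show "s \<le> r" using cmod_zeta_min[of t] half by simp
qed

text \<open>The last condition says that the frame starts at \<open>s\<close>. In this form it fits
  the initial values of \<open>C_sol\<close> as well as those of its mirror image for the opposite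
  sign of the curvature.\<close>

lemma trace_of_initial_value:
  assumes s: "0 < s" "s < a" and ros: "rosette f a (ham (of_real s)) \<kappa> \<theta>"
    and C: "maximal_solution f C" "(J, c) \<in> C" "is_tangent_angle (J, c) \<psi>"
      "- \<i> * cnj (c 0) * cis (\<psi> 0) = of_real s"
  shows "\<exists>\<alpha>. curve_trace C = (\<lambda>w. cis \<alpha> * w) ` range (pre_rosette.cur f a (ham (of_real s)) \<theta>)"
proof -
  interpret rosette f a "ham (of_real s)" \<kappa> \<theta> by (rule ros)
  have or: "C \<in> oriented_curves" and solC: "is_solution f C"
    using C(1) by (auto simp: maximal_solution_def is_solution_def)
  obtain \<psi>' where sol0: "sol_path f J c \<psi>'" using solution_sol_path[OF solC C(2)] by blast
  have "0 \<in> J" by (rule sol_pathD(4)[OF sol0])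
  then have "cis (\<psi>' 0) = cis (\<psi> 0)"
    using C(3) sol0 unfolding sol_path_def is_tangent_angle_def by auto
  then have fr0: "frame c \<psi>' 0 = of_real s" using C(4) by (simp add: frame_def)
  from sol0 show ?thesis
  proof (cases rule: frame_cases)
    case fixed
    then show ?thesis using fixed[OF \<open>0 \<in> J\<close>] fr0 s by simp
  next
    case (orbit h1 d)
    have "h1 = ham (of_real s)" using orbit(2)[OF \<open>0 \<in> J\<close>] fr0 ham_zeta[OF orbit(1)] by metis
    then obtain \<alpha> where \<alpha>: "\<forall>x\<in>J. c x = cis \<alpha> * cur (x + d) \<and> \<psi>' x = \<theta> (x + d) + \<alpha>"
      using rigid[OF sol0, of d] orbit(2) by blast
    then have "c ` J \<subseteq> range (\<lambda>t. cis \<alpha> * cur (t + d))" by auto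
    from maximal_solution_trace[OF C(1,2) sol_rotated this] show ?thesis
      using curve_trace_rep[OF or C(2)] range_rotated by metis
  qed
qed

lemma inner_solution:
  assumes "0 < s" "s < a" "rosette f a (ham (of_real s)) \<kappa> \<theta>"
  obtains c where "maximal_solution f (path_equiv `` {(UNIV, c)})" "(UNIV, c) \<in> path_equiv `` {(UNIV, c)}"
    "c 0 = of_real s" "\<exists>\<psi>. is_tangent_angle (UNIV, c) \<psi> \<and> \<psi> 0 = pi / 2"
proof -
  interpret rosette f a "ham (of_real s)" \<kappa> \<theta> by (rule assms(3))
  let ?h = "ham (of_real s)"
  \<comment> \<open>The shift by half a period puts the nearest point at parameter 0, and the
    rotation removes its argument \<open>turn / 2\<close>.\<close>
  let ?c = "\<lambda>t. cis (- (turn / 2)) * cur (t + per ?h / 2)"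
  note sol = sol_rotated[of "- (turn / 2)" "per ?h / 2"]
  have "maximal_solution f (path_equiv `` {(UNIV, ?c)})"
    by (rule maximal) (use inner_level(2)[OF assms(1,2)] in simp)
  moreover have "(UNIV, ?c) \<in> path_equiv `` {(UNIV, ?c)}" by (rule class_of_path(1)[OF sol_pathD(1)[OF sol]])
  moreover have "?c 0 = of_real s"
  proof -
    have "cur (per ?h / 2) = - \<i> * of_real s * cis (pi / 2 + turn / 2)"
      unfolding cur_def \<theta>_half inner_level(3)[OF assms(1,2)] by simp
    also have "cis (pi / 2 + turn / 2) = \<i> * cis (turn / 2)" by (simp add: cis_mult[symmetric])
    finally have "cur (per ?h / 2) = of_real s * cis (turn / 2)" by (simp add: complex_eq_iff)
    then have "?c 0 = of_real s * (cis (- (turn / 2)) * cis (turn / 2))" by simp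
    then show ?thesis by (simp only: cis_mult) simp
  qed
  moreover have "\<exists>\<psi>. is_tangent_angle (UNIV, ?c) \<psi> \<and> \<psi> 0 = pi / 2"
    using sol \<theta>_half unfolding sol_path_def
    by (intro exI[of _ "\<lambda>t. \<theta> (t + per ?h / 2) + - (turn / 2)"]) simp
  ultimately show thesis using that by blast
qed

text \<open>Whatever curve \<open>C_sol\<close> chooses, its initial values alone determine the
  trace up to a rotation; the explicit rosette shows that there is something to choose.\<close>

lemma C_sol_trace:
  assumes "eps f = 1" "0 < s" "s < a" "rosette f a (ham (of_real s)) \<kappa> \<theta>"
  shows "\<exists>\<alpha>. curve_trace (C_sol f s) = (\<lambda>w. cis \<alpha> * w) ` range (pre_rosette.cur f a (ham (of_real s)) \<theta>)"
proof -
  let ?P = "\<lambda>C. maximal_solution f C \<and>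
     (\<exists>(J, c)\<in>C. c 0 = of_real (eps f * s) \<and> (\<exists>\<psi>. is_tangent_angle (J, c) \<psi> \<and> \<psi> 0 = pi / 2))"
  obtain c where c: "maximal_solution f (path_equiv `` {(UNIV, c)})" "(UNIV, c) \<in> path_equiv `` {(UNIV, c)}"
    "c 0 = of_real s" "\<exists>\<psi>. is_tangent_angle (UNIV, c) \<psi> \<and> \<psi> 0 = pi / 2"
    by (rule inner_solution[OF assms(2-4)])
  have "?P (path_equiv `` {(UNIV, c)})"
    using c assms(1) by (intro conjI bexI[of _ "(UNIV, c)"]) auto
  then have "?P (C_sol f s)" unfolding C_sol_def by (rule someI)
  then obtain J c' \<psi> where *: "maximal_solution f (C_sol f s)" "(J, c') \<in> C_sol f s" "c' 0 = of_real s"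
      "is_tangent_angle (J, c') \<psi>" "\<psi> 0 = pi / 2"
    using assms(1) by auto
  show ?thesis
    by (rule trace_of_initial_value[OF assms(2-4) *(1,2,4)]) (simp add: *(3,5) complex_eq_iff)
qed

text \<open>\<open>tr s\<close> stands for \<open>[C\<^sub>f\<^sub>,\<^sub>s]\<close> and \<open>Os\<close> for \<open>\<O>\<^sub>f\<close>, or for their counterparts for the curvature function
  \<open>- f\<close>, seen in the mirror.\<close>

lemma Jordan_characterization:
  fixes tr :: "real \<Rightarrow> complex set"
  assumes f': "\<And>s. 0 < s \<Longrightarrow> deriv f s \<noteq> 0"
    and C: "maximal_solution f C" "compact (curve_trace C)"
    and tr: "\<And>s \<kappa> \<theta>. 0 < s \<Longrightarrow> s < a \<Longrightarrow> rosette f a (ham (of_real s)) \<kappa> \<theta> \<Longrightarrow>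
      \<exists>\<alpha>. tr s = (\<lambda>w. cis \<alpha> * w) ` range (pre_rosette.cur f a (ham (of_real s)) \<theta>)"
    and Os: "Os = (\<Union>n\<in>{2::nat..}. {s. 0 < s \<and> s < a \<and> net_winding f (of_real s) = 1 / real n})"
  shows "curve_trace C homeomorphic sphere (0::complex) 1 \<longleftrightarrow>
    curve_trace C = sphere 0 a \<or>
    (\<exists>!s. s \<in> Os \<and> (\<exists>\<phi>::real. curve_trace C = (\<lambda>w. cis \<phi> * w) ` tr s))"
    (is "?hom \<longleftrightarrow> ?circ \<or> ?ros")
proof
  have rot: "(\<lambda>w. cis \<alpha> * w) ` S homeomorphic S" for \<alpha> and S :: "complex set"
    unfolding homeomorphic_def homeomorphism_def
    by (intro exI[of _ "\<lambda>w. cis (- \<alpha>) * w"] exI[of _ "\<lambda>w. cis \<alpha> * w"])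
      (auto simp: image_image cis_mult intro!: continuous_intros simp flip: mult.assoc)
  have O_pos: "0 < s" "s < a" if "s \<in> Os" for s using that Os by auto
  have unique: "s = s'"
    if "s \<in> Os" "curve_trace C = (\<lambda>w. cis \<phi> * w) ` tr s" "s' \<in> Os" "curve_trace C = (\<lambda>w. cis \<phi>' * w) ` tr s'"
    for s s' \<phi> \<phi>'
  proof -
    have min: "s \<in> cmod ` curve_trace C \<and> (\<forall>r\<in>cmod ` curve_trace C. s \<le> r)"
      if s: "s \<in> Os" and e: "curve_trace C = (\<lambda>w. cis \<phi> * w) ` tr s" for s \<phi>
    proof -
      note p = O_pos[OF s]
      obtain \<kappa> \<theta> where r: "rosette f a (ham (of_real s)) \<kappa> \<theta>" by (rule inner_rosette[OF p])
      obtain \<alpha> where "tr s = (\<lambda>w. cis \<alpha> * w) ` range (pre_rosette.cur f a (ham (of_real s)) \<theta>)"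
        using tr[OF p r] by blast
      then have "curve_trace C = (\<lambda>w. cis (\<phi> + \<alpha>) * w) ` range (pre_rosette.cur f a (ham (of_real s)) \<theta>)"
        unfolding e by (simp add: image_image cis_mult[symmetric] mult.assoc)
      then show ?thesis using inner_min_modulus(1)[OF p r, of "\<phi> + \<alpha>"] inner_min_modulus(2)[OF p r, of _ "\<phi> + \<alpha>"] by auto
    qed
    show ?thesis using min[OF that(1,2)] min[OF that(3,4)] by (meson order_antisym)
  qed
  {
    assume hom: ?hom
    from C show "?circ \<or> ?ros"
    proof (cases rule: closed_maximal_cases)
      case (circle J c \<alpha>)
      have "range (\<lambda>t. - \<i> * of_real a * cis (t / a + \<alpha>)) = sphere 0 a"
      proof (intro equalityI subsetI)
        fix w :: complex assume "w \<in> sphere 0 a"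
        then have "w = of_real a * cis (Arg w)" using rcis_cmod_Arg[of w] by (simp add: rcis_def)
        also have "\<dots> = - \<i> * of_real a * cis ((a * (Arg w + pi / 2 - \<alpha>)) / a + \<alpha>)"
          using a_pos by (simp add: complex_eq_iff cos_add sin_add)
        finally show "w \<in> range (\<lambda>t. - \<i> * of_real a * cis (t / a + \<alpha>))" by blast
      qed (use a_pos in \<open>auto simp: norm_mult\<close>)
      then show ?thesis using circle(4) by simp
    next
      case (rosette J c h \<kappa> \<theta> n \<alpha> d)
      interpret closed_rosette f a h \<kappa> \<theta> n by (rule rosette(2))
      have "range cur homeomorphic sphere (0::complex) 1"
        using hom rot[of \<alpha> "range cur"] homeomorphic_sym homeomorphic_trans unfolding rosette(4) by blast
      then have "simple_rosette f a h \<kappa> \<theta> n"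
        using f' circle_imp_injective by unfold_locales auto
      then interpret simple_rosette f a h \<kappa> \<theta> n .
      have "rad h pi < a"
      proof (rule ccontr)
        assume "\<not> rad h pi < a"
        then have "ham (a + of_real a * cis pi) \<le> ham (a + of_real (rad h pi) * cis pi)"
          using ham_ray_increasing[of a "rad h pi" pi] a_pos by (cases "rad h pi = a") auto
        then show False using ham_pol[OF h, of pi] level_neg ham_0 by (simp add: pol_def)
      qed
      \<comment> \<open>This is the near real point of the level curve. It is positive because the
        level is negative.\<close>
      define s where "s = a - rad h pi"
      have s: "0 < s" "s < a" using \<open>rad h pi < a\<close> rad_pos[OF h, of pi] by (auto simp: s_def)
      have hs: "ham (of_real s) = h" using ham_pol[OF h, of pi] by (simp add: s_def pol_def)
      have r: "rosette f a (ham (of_real s)) \<kappa> \<theta>" unfolding hs by (rule rosette_axioms)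
      have "net_winding f (of_real s) = turn / (2 * pi)" using net_winding_eq_turn(1)[OF s r] by (simp add: hs)
      also have "\<dots> = 1 / real n" using total_turn n_pos by (simp add: field_simps)
      finally have "s \<in> Os" using s n_ge_2 Os by auto
      obtain \<beta> where \<beta>: "tr s = (\<lambda>w. cis \<beta> * w) ` range cur" using tr[OF s r] by (auto simp: hs)
      have "curve_trace C = (\<lambda>w. cis (\<alpha> - \<beta>) * w) ` tr s"
        unfolding rosette(4) \<beta> by (simp add: image_image cis_mult flip: mult.assoc)
      note tr_s = this
      then have ex: "\<exists>\<phi>::real. curve_trace C = (\<lambda>w. cis \<phi> * w) ` tr s" by blast
      have "s' = s" if s': "s' \<in> Os \<and> (\<exists>\<phi>::real. curve_trace C = (\<lambda>w. cis \<phi> * w) ` tr s')" for s'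
      proof -
        obtain \<phi> where "curve_trace C = (\<lambda>w. cis \<phi> * w) ` tr s'" using s' by blast
        then show ?thesis by (rule unique[OF conjunct1[OF s'] _ \<open>s \<in> Os\<close> tr_s])
      qed
      with \<open>s \<in> Os\<close> ex have ?ros by (intro ex1I[of _ s] conjI)
      then show ?thesis by blast
    qed
  next
    assume "?circ \<or> ?ros"
    then show ?hom
    proof
      assume ?circ
      then show ?hom using homeomorphic_spheres[OF a_pos zero_less_one] by metis
    next
      assume ?ros
      then obtain s \<phi> where s: "s \<in> Os" "curve_trace C = (\<lambda>w. cis \<phi> * w) ` tr s" by blast
      note p = O_pos[OF s(1)]
      obtain \<kappa> \<theta> where r: "rosette f a (ham (of_real s)) \<kappa> \<theta>" by (rule inner_rosette[OF p])
      interpret rosette f a "ham (of_real s)" \<kappa> \<theta> by (rule r)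
      obtain \<alpha> where \<alpha>: "tr s = (\<lambda>w. cis \<alpha> * w) ` range cur" using tr[OF p r] by blast
      obtain n :: nat where n: "2 \<le> n" "net_winding f (of_real s) = 1 / real n" using s(1) Os by auto
      have nz: "zeta (ham (of_real s)) t \<noteq> 0" for t
        using ham_zeta[OF h, of t] inner_level(2)[OF p] ham_0 by auto
      have "real n * turn = 2 * pi"
        using n net_winding_eq_turn(1)[OF p r] by (simp add: field_simps)
      then have "range cur homeomorphic sphere (0::complex) 1"
        using convex_homeomorphic[OF _ _ nz, of n] n by simp
      then have "tr s homeomorphic sphere (0::complex) 1"
        unfolding \<alpha> using rot homeomorphic_trans by blast
      then show ?hom unfolding s(2) using rot homeomorphic_trans by blast
    qed
  }
qed

lemma periodic_solution_exists:
  assumes C: "maximal_solution f C" "compact (curve_trace C)"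
  obtains J c g T \<theta> where "(J, c) \<in> C" "\<And>t. t \<in> J \<Longrightarrow> c t = g t" "sol_path f UNIV g \<theta>" "minimal_period g T"
    "range g = curve_trace C" "\<theta> 0 < \<theta> T"
  using C
proof (cases rule: closed_maximal_cases)
  case (circle J c \<alpha>)
  let ?g = "\<lambda>t. - \<i> * of_real a * cis (t / a + \<alpha>)"
  have "minimal_period ?g (2 * pi * a)"
    unfolding minimal_period_def
  proof (intro conjI allI impI notI)
    show "0 < 2 * pi * a" using a_pos by simp
    show "?g (t + 2 * pi * a) = ?g t" for t
      using a_pos by (simp add: add_divide_distrib cis_mult[symmetric])
    fix S assume S: "0 < S \<and> S < 2 * pi * a" "\<forall>t. ?g (t + S) = ?g t"
    have "cis (S / a + \<alpha>) = cis \<alpha>" using S(2)[rule_format, of 0] a_pos by simp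
    then have "cis (S / a) * cis \<alpha> = 1 * cis \<alpha>" by (simp only: cis_mult mult_1)
    then have "cis (S / a) = 1" by simp
    then have "cos (S / a) = 1" by (simp add: complex_eq_iff)
    then obtain k :: int where "S / a = of_int k * 2 * pi" using cos_one_2pi_int by blast
    moreover have "0 < S / a" "S / a < 2 * pi" using S(1) a_pos by (auto simp: field_simps)
    ultimately have "0 < real_of_int k * (2 * pi)" "real_of_int k * (2 * pi) < 1 * (2 * pi)" by auto
    then have "0 < k" "k < 1" by (simp_all add: zero_less_mult_iff mult_less_cancel_right)
    then show False by simp
  qed
  then show ?thesis using that[OF circle(1,3,2) _ circle(4)] a_pos by simp
next
  case (rosette J c h \<kappa> \<theta> n \<alpha> d)
  interpret closed_rosette f a h \<kappa> \<theta> n by (rule rosette(2))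
  have "\<theta> (len + d) = \<theta> d + real n * turn"
    using \<theta>_periodic_int[of d "int n"] by (simp add: len_def add.commute)
  then have "\<theta> (0 + d) + \<alpha> < \<theta> (len + d) + \<alpha>" using n_pos turn_pos by simp
  moreover have "range (\<lambda>t. cis \<alpha> * cur (t + d)) = curve_trace C" unfolding rosette(4) by (rule range_rotated)
  ultimately show ?thesis
    using that[OF rosette(1,3) sol_rotated minimal_period_cur] by blast
qed

end

subsection \<open>The class of curvature functions\<close>

lemma F_prim_second_derivative:
  assumes "smooth_on {0<..} f" "0 < s"
  shows "deriv (deriv (F_prim f)) s = f s + s * deriv f s"
    and "((\<lambda>s. s * f s) has_real_derivative f s + s * deriv f s) (at s)"
proof -
  have "(f has_real_derivative deriv f s) (at s)" if "0 < s" for s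
    using smooth_on_real_derivative[OF assms(1)] that DERIV_imp_deriv by fastforce
  then have d: "((\<lambda>s. s * f s) has_real_derivative f s + s * deriv f s) (at s)" if "0 < s" for s
    using that by (auto intro!: derivative_eq_intros)
  then show "((\<lambda>s. s * f s) has_real_derivative f s + s * deriv f s) (at s)" using assms(2) .
  have "continuous_on {0<..} (\<lambda>s. s * f s - 1)"
    using d DERIV_isCont by (intro continuous_intros continuous_at_imp_continuous_on) auto
  then obtain G where "\<forall>t\<in>{0<..}. (G has_vector_derivative t * f t - 1) (at t)"
    using antiderivative_on_interval[of "{0::real<..}" "\<lambda>s. s * f s - 1"] by (auto simp: is_interval_1)
  then have "\<exists>F. \<forall>s>0. (F has_real_derivative (s * f s - 1)) (at s)"
    by (auto simp: has_real_derivative_iff_has_vector_derivative)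
  then have F: "\<forall>s>0. (F_prim f has_real_derivative (s * f s - 1)) (at s)"
    unfolding F_prim_def by (rule someI_ex)
  have "((\<lambda>s. s * f s - 1) has_real_derivative f s + s * deriv f s) (at s)"
    using DERIV_diff[OF d[OF assms(2)] DERIV_const[of 1]] by simp
  then have "(deriv (F_prim f) has_real_derivative f s + s * deriv f s) (at s)"
    by (rule has_field_derivative_transform_within_open[of _ _ _ "{0<..}"])
      (use F assms(2) DERIV_imp_deriv in \<open>force+\<close>)
  then show "deriv (deriv (F_prim f)) s = f s + s * deriv f s" by (rule DERIV_imp_deriv)
qed

lemma constant_sign_on_interval:
  fixes g :: "real \<Rightarrow> real"
  assumes "continuous_on S g" "is_interval S" "\<And>s. s \<in> S \<Longrightarrow> g s \<noteq> 0"
  shows "\<exists>e\<in>{-1, 1}. \<forall>s\<in>S. 0 < e * g s"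
proof (rule ccontr)
  assume no: "\<not> ?thesis"
  then obtain s t where st: "s \<in> S" "t \<in> S" "\<not> 0 < (- 1) * g s" "\<not> 0 < 1 * g t" by auto
  have "is_interval (g ` S)"
    using connected_continuous_image[OF assms(1)] assms(2) by (simp add: is_interval_connected_1)
  then have "0 \<in> g ` S" using mem_is_interval_1_I[of "g ` S" "g t" "g s" 0] st by auto
  then show False using assms(3) by auto
qed

text \<open>The second derivative of \<open>F_prim f\<close> is the derivative of
  \<open>s * f s\<close>. It has no zero, so multiplication by the sign \<open>eps f\<close> makes
  \<open>s * f s\<close> increasing, and membership of 1 in \<open>interval_I f\<close> provides
  values on both sides of 1.\<close>

lemma class_F_star_cases:
  assumes "f \<in> class_F_star"
  shows "eps f \<in> {-1, 1} \<and> attractive_curvature (\<lambda>s. eps f * f s) (s_crit f) \<and>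
    (\<forall>s>0. deriv (\<lambda>s. eps f * f s) s \<noteq> 0)"
proof -
  have sm: "smooth_on {0<..} f" and nz: "\<And>s. 0 < s \<Longrightarrow> f s * deriv f s * deriv (deriv (F_prim f)) s \<noteq> 0"
    and I: "1 \<in> interval_I f"
    using assms by (auto simp: class_F_star_def class_F_def)
  note F2 = F_prim_second_derivative[OF sm]
  obtain k where k: "smooth_on {0<..} k" "\<forall>t\<in>{0<..}. (f has_real_derivative k t) (at t)"
    using smooth_on_real_derivative[OF sm] by blast
  then have dk: "deriv f s = k s" if "0 < s" for s using that DERIV_imp_deriv by fastforce
  have "continuous_on {0<..} (\<lambda>s. f s + s * k s)"
    by (intro continuous_intros smooth_on_continuous sm k)
  then have "continuous_on {0<..} (\<lambda>s. deriv (deriv (F_prim f)) s)"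
    by (rule continuous_on_eq) (simp add: F2(1) dk)
  then have "\<exists>e\<in>{-1, 1}. \<forall>s\<in>{0<..}. 0 < e * deriv (deriv (F_prim f)) s"
    by (rule constant_sign_on_interval) (use nz in \<open>auto simp: is_interval_1\<close>)
  then obtain e where e: "e \<in> {-1, 1::real}" "\<forall>s>0. 0 < e * deriv (deriv (F_prim f)) s"
    unfolding Ball_def greaterThan_iff by blast
  have eps: "eps f = e"
    unfolding eps_def
  proof (rule the_equality)
    show "e \<in> {-1, 1} \<and> (\<forall>s>0. 0 < e * deriv (deriv (F_prim f)) s)" using e by blast
    fix e' assume "e' \<in> {-1, 1} \<and> (\<forall>s>0. 0 < e' * deriv (deriv (F_prim f)) s)"
    then have "0 < e' * deriv (deriv (F_prim f)) 1" "e' \<in> {-1, 1}" by auto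
    moreover have "0 < e * deriv (deriv (F_prim f)) 1" using e(2) by simp
    ultimately show "e' = e" using e(1) by auto
  qed
  define g where "g s = e * f s" for s
  have smg: "smooth_on {0<..} g"
    unfolding g_def by (rule smooth_on_linear[OF sm bounded_linear_mult_right])
  have dg: "((\<lambda>s. s * g s) has_real_derivative e * deriv (deriv (F_prim f)) s) (at s)" if "0 < s" for s
  proof -
    have "(\<lambda>s. s * g s) = (\<lambda>s. e * (s * f s))" by (simp add: g_def fun_eq_iff)
    then show ?thesis using DERIV_cmult[OF F2(2)[OF that], of e] F2(1)[OF that] by simp
  qed
  have mono: "s * g s < t * g t" if "0 < s" "s < t" for s t
  proof (rule DERIV_pos_imp_increasing[OF that(2)])
    fix x assume "s \<le> x"
    then have x: "0 < x" using that by simp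
    show "\<exists>y. ((\<lambda>s. s * g s) has_real_derivative y) (at x) \<and> 0 < y"
      using dg[OF x] e(2)[rule_format, OF x] by blast
  qed
  have lo: "\<exists>s>0. s * g s < 1"
  proof (rule ccontr)
    assume "\<not> ?thesis"
    then have ge: "1 \<le> s * g s" if "0 < s" for s using that by force
    let ?G = "\<lambda>s. ereal (s * g s)"
    \<comment> \<open>By monotonicity the limit at 0 is the infimum, here at least 1, which
      contradicts the lower end of \<open>interval_I f\<close>.\<close>
    have "(?G \<longlongrightarrow> Inf (?G ` {0<..})) (at_right 0)"
    proof (rule order_tendstoI)
      fix y assume y: "y < Inf (?G ` {0<..})"
      have "\<forall>\<^sub>F s in at_right 0. s \<in> {0::real<..}" by (auto simp: eventually_at_filter)
      then show "\<forall>\<^sub>F s in at_right 0. y < ?G s"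
        by (rule eventually_mono) (use y in \<open>meson INF_lower less_le_trans\<close>)
    next
      fix y assume "Inf (?G ` {0<..}) < y"
      then obtain s where s: "0 < s" "?G s < y" by (auto simp: Inf_less_iff)
      have "\<forall>\<^sub>F t in at_right 0. t \<in> {0<..<s}" using s(1) by (rule eventually_at_right_real)
      then show "\<forall>\<^sub>F t in at_right 0. ?G t < y"
      proof (rule eventually_mono)
        fix t assume "t \<in> {0<..<s}"
        then have "t * g t < s * g s" by (intro mono) auto
        then show "?G t < y" using s(2) by (meson ereal_less_eq(3) le_less_trans less_imp_le)
      qed
    qed
    then have "Lim (at_right 0) ?G = Inf (?G ` {0<..})" by (intro tendsto_Lim) auto
    moreover have "1 \<le> Inf (?G ` {0<..})" using ge by (intro INF_greatest) auto
    moreover have "(\<lambda>s. ereal (eps f * s * f s)) = ?G" by (simp add: eps g_def mult_ac)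
    ultimately show False using I unfolding interval_I_def mem_Collect_eq one_ereal_def
      by (simp only: linorder_not_le[symmetric] simp_thms)
  qed
  have hi: "\<exists>s>0. 1 < s * g s"
  proof (rule ccontr)
    assume "\<not> ?thesis"
    then have le: "s * g s \<le> 1" if "0 < s" for s using that not_le by blast
    let ?G = "\<lambda>s. ereal (s * g s)"
    have "(?G \<longlongrightarrow> Sup (?G ` {0<..})) at_top"
    proof (rule order_tendstoI)
      fix y assume y: "Sup (?G ` {0<..}) < y"
      show "\<forall>\<^sub>F s in at_top. ?G s < y"
        using eventually_gt_at_top[of 0]
        by (rule eventually_mono) (use y in \<open>meson SUP_upper greaterThan_iff le_less_trans\<close>)
    next
      fix y assume "y < Sup (?G ` {0<..})"
      then obtain s where s: "0 < s" "y < ?G s" by (auto simp: less_Sup_iff)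
      show "\<forall>\<^sub>F t in at_top. y < ?G t"
        using eventually_gt_at_top[of s]
      proof (rule eventually_mono)
        fix t assume "s < t"
        then have "s * g s < t * g t" using s by (intro mono) auto
        then show "y < ?G t" using s(2) by (meson ereal_less_eq(3) less_le_trans less_imp_le)
      qed
    qed
    then have "Lim at_top ?G = Sup (?G ` {0<..})" by (intro tendsto_Lim) auto
    moreover have "Sup (?G ` {0<..}) \<le> 1" using le by (intro SUP_least) auto
    moreover have "(\<lambda>s. ereal (eps f * s * f s)) = ?G" by (simp add: eps g_def mult_ac)
    ultimately show False using I unfolding interval_I_def mem_Collect_eq one_ereal_def
      by (simp only: linorder_not_le[symmetric] simp_thms)
  qed
  have "continuous_on {0<..} g" by (rule smooth_on_continuous[OF smg])
  then have cont: "continuous_on {0<..} (\<lambda>s. s * g s)" by (intro continuous_intros)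
  obtain s1 s2 where s12: "0 < s1" "s1 * g s1 < 1" "0 < s2" "1 < s2 * g s2" using lo hi by blast
  then have "s1 < s2" using mono[of s2 s1] by (cases s1 s2 rule: linorder_cases) auto
  have "continuous_on {s1..s2} (\<lambda>s. s * g s)"
    by (rule continuous_on_subset[OF cont]) (use s12 in auto)
  then obtain a where "s1 \<le> a" "a * g a = 1"
    using IVT'[of "\<lambda>s. s * g s" s1 1 s2] s12 \<open>s1 < s2\<close> by force
  then have a: "0 < a" "a * g a = 1" using s12 by auto
  have gnz: "g s \<noteq> 0" if "0 < s" for s using nz[OF that] e(1) by (auto simp: g_def)
  have "\<exists>e\<in>{-1, 1}. \<forall>s\<in>{0<..}. 0 < e * g s"
    by (rule constant_sign_on_interval[OF \<open>continuous_on {0<..} g\<close>])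
      (use gnz in \<open>auto simp: is_interval_1\<close>)
  then obtain e' where e': "e' \<in> {-1, 1::real}" "\<forall>s>0. 0 < e' * g s"
    unfolding Ball_def greaterThan_iff by blast
  \<comment> \<open>The value at \<open>a\<close> decides which constant sign \<open>g\<close>
    has.\<close>
  have "0 < a * g a" using a by simp
  then have "0 < g a" using a(1) by (simp add: zero_less_mult_iff)
  moreover have "0 < e' * g a" using e'(2) a(1) by blast
  ultimately have "e' = 1" using e'(1) by (elim insertE) auto
  then have gpos: "0 < g s" if "0 < s" for s using e'(2) that by simp
  have "s_crit f = a"
    unfolding s_crit_def eps
  proof (rule the_equality)
    have ee: "e * e = 1" using e(1) by auto
    have iff: "s * f s = e \<longleftrightarrow> s * g s = 1" for s
    proof
      assume "s * f s = e"
      then have "e * (s * f s) = e * e" by simp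
      then show "s * g s = 1" using ee by (simp add: g_def mult_ac)
    next
      assume "s * g s = 1"
      then have "(e * e) * (s * f s) = e" by (simp add: g_def mult_ac)
      then show "s * f s = e" using ee by simp
    qed
    then show "0 < a \<and> a * f a = e" using a by simp
    fix s assume "0 < s \<and> s * f s = e"
    then have "0 < s" "s * g s = 1" using iff by auto
    then show "s = a" using mono[of s a] mono[of a s] a by (cases s a rule: linorder_cases) auto
  qed
  moreover have "attractive_curvature g a"
    by unfold_locales (use smg gpos mono a in auto)
  moreover have "deriv g s \<noteq> 0" if "0 < s" for s
  proof -
    have "(g has_real_derivative e * k s) (at s)"
      unfolding g_def[abs_def] using DERIV_cmult[of f "k s" s UNIV e] k(2) that by simp
    then have "deriv g s = e * deriv f s" using dk[OF that] by (simp add: DERIV_imp_deriv)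
    then show ?thesis using nz[OF that] e(1) by auto
  qed
  moreover have "(\<lambda>s. eps f * f s) = g" by (simp add: g_def[abs_def] eps)
  ultimately show ?thesis using e(1) eps by simp
qed

subsection \<open>Reflected solutions\<close>

definition reflect :: "plane_curve \<Rightarrow> plane_curve" where
  "reflect C = (\<lambda>(J, c). (J, \<lambda>t. cnj (c t))) ` C"

lemma reflect_reflect: "reflect (reflect C) = C"
  by (force simp: reflect_def image_iff)

lemma cnj_sol_path:
  assumes "sol_path f J c \<theta>"
  shows "sol_path (\<lambda>s. - f s) J (\<lambda>t. cnj (c t)) (\<lambda>t. - \<theta> t)"
proof (rule sol_pathI)
  note s = sol_pathD[OF assms]
  show "open J" "is_interval J" "0 \<in> J" using s by auto
  show "smooth_on J (\<lambda>t. cnj (c t))" by (rule smooth_on_linear[OF s(5) bounded_linear_cnj])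
  show "smooth_on J (\<lambda>t. - \<theta> t)" by (rule smooth_on_linear[OF s(6) bounded_linear_minus[OF bounded_linear_ident]])
  show "((\<lambda>t. cnj (c t)) has_vector_derivative cis (- \<theta> t)) (at t)" if "t \<in> J" for t
    using has_vector_derivative_cnj[OF s(7)[OF that]] by (simp add: cis_cnj)
  show "((\<lambda>t. - \<theta> t) has_real_derivative - f (cmod (cnj (c t)))) (at t)" if "t \<in> J" "cnj (c t) \<noteq> 0" for t
    using DERIV_minus[OF s(8)[OF that(1)]] that(2) by simp
qed

lemma cnj_arc_path:
  assumes "(J, c) \<in> arc_paths"
  shows "(J, \<lambda>t. cnj (c t)) \<in> arc_paths"
proof -
  have "smooth_on J c" using assms by (auto simp: arc_paths_def)
  then have "smooth_on J (\<lambda>t. cnj (c t))" by (rule smooth_on_linear[OF _ bounded_linear_cnj])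
  moreover have "vector_derivative (\<lambda>t. cnj (c t)) (at t) = cnj (vector_derivative c (at t))" if "t \<in> J" for t
    using vector_derivative_at[OF has_vector_derivative_cnj[OF arc_path_derivative(1)[OF assms that]]] .
  ultimately show ?thesis using assms by (auto simp: arc_paths_def)
qed

lemma reflect_class:
  assumes "(J, c) \<in> arc_paths"
  shows "reflect (path_equiv `` {(J, c)}) = path_equiv `` {(J, \<lambda>t. cnj (c t))}"
proof -
  have *: "((J, \<lambda>t. cnj (c t)), (J', \<lambda>t. cnj (c' t))) \<in> path_equiv"
    if "((J, c), (J', c')) \<in> path_equiv" for J c J' c'
    using that cnj_arc_path unfolding path_equiv_def by fastforce
  show ?thesis
  proof (intro equalityI subsetI)
    fix p assume "p \<in> reflect (path_equiv `` {(J, c)})"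
    then obtain J' c' where "((J, c), (J', c')) \<in> path_equiv" "p = (J', \<lambda>t. cnj (c' t))"
      by (auto simp: reflect_def)
    then show "p \<in> path_equiv `` {(J, \<lambda>t. cnj (c t))}" using * by auto
  next
    fix p assume "p \<in> path_equiv `` {(J, \<lambda>t. cnj (c t))}"
    then obtain J' c' where p: "((J, \<lambda>t. cnj (c t)), (J', c')) \<in> path_equiv" "p = (J', c')" by (cases p) auto
    from *[OF p(1)] have "(J', \<lambda>t. cnj (c' t)) \<in> path_equiv `` {(J, c)}" by simp
    then have "(\<lambda>(J, c). (J, \<lambda>t. cnj (c t))) (J', \<lambda>t. cnj (c' t)) \<in> reflect (path_equiv `` {(J, c)})"
      unfolding reflect_def by (rule imageI)
    then show "p \<in> reflect (path_equiv `` {(J, c)})" using p(2) by simp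
  qed
qed

lemma curve_trace_reflect: "curve_trace (reflect C) = cnj ` curve_trace C"
  unfolding curve_trace_def reflect_def by (auto simp: image_iff)

lemma reflect_solution:
  assumes "is_solution f C"
  shows "is_solution (\<lambda>s. - f s) (reflect C)"
proof -
  have or: "C \<in> oriented_curves" using assms by (simp add: is_solution_def)
  then obtain J c where Jc: "(J, c) \<in> C" by (rule oriented_curve_rep)
  obtain \<theta> where sol: "sol_path f J c \<theta>" using solution_sol_path[OF assms Jc] by blast
  have "C = path_equiv `` {(J, c)}" by (rule class_eq_of_mem(2)[OF or Jc])
  then have "reflect C = path_equiv `` {(J, \<lambda>t. cnj (c t))}" using reflect_class[OF sol_pathD(1)[OF sol]] by simp
  then show ?thesis using sol_path_solution[OF cnj_sol_path[OF sol]] by simp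
qed

lemma reflect_maximal:
  assumes "maximal_solution f C"
  shows "maximal_solution (\<lambda>s. - f s) (reflect C)"
  unfolding maximal_solution_def
proof (intro conjI allI impI)
  show "is_solution (\<lambda>s. - f s) (reflect C)"
    using assms reflect_solution by (simp add: maximal_solution_def)
  have cc: "cnj ` cnj ` S = S" for S by (simp add: image_image)
  fix C' assume C': "is_solution (\<lambda>s. - f s) C'" "curve_trace (reflect C) \<subseteq> curve_trace C'"
  have "is_solution f (reflect C')" using reflect_solution[OF C'(1)] by simp
  moreover have "curve_trace C \<subseteq> curve_trace (reflect C')"
    using image_mono[OF C'(2), of cnj] by (simp add: curve_trace_reflect cc)
  ultimately have "curve_trace C = curve_trace (reflect C')"
    using assms by (simp add: maximal_solution_def)
  then show "curve_trace (reflect C) = curve_trace C'" by (simp add: curve_trace_reflect cc)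
qed

subsection \<open>Main theorem\<close>

lemma minimal_period_cnj: "minimal_period g T \<Longrightarrow> minimal_period (\<lambda>t. cnj (g t)) T"
  by (simp add: minimal_period_def)

lemma cnj_homeomorphic: "cnj ` S homeomorphic S"
  unfolding homeomorphic_def homeomorphism_def
  by (intro exI[of _ cnj]) (auto simp: image_image intro!: continuous_intros)

lemma theorem_positive:
  assumes "attractive_curvature f a" "\<And>s. 0 < s \<Longrightarrow> deriv f s \<noteq> 0" "eps f = 1" "s_crit f = a"
    and C: "maximal_solution f C" "closed_curve C"
  shows "oriented_counterclockwise f C"
    and "Jordan_solution f C \<longleftrightarrow> curve_trace C = sphere 0 (s_crit f) \<or>
      (\<exists>!s. s \<in> O_set f \<and> (\<exists>\<theta>::real. curve_trace C = (\<lambda>w. cis \<theta> * w) ` curve_trace (C_sol f s)))"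
proof -
  interpret attractive_curvature f a by (rule assms(1))
  have comp: "compact (curve_trace C)" using C(2) by (simp add: closed_curve_def)
  obtain J c g T \<theta> where *: "(J, c) \<in> C" "\<And>t. t \<in> J \<Longrightarrow> c t = g t" "sol_path f UNIV g \<theta>"
    "minimal_period g T" "range g = curve_trace C" "\<theta> 0 < \<theta> T"
    by (rule periodic_solution_exists[OF C(1) comp]) (rule that)
  have "periodic_continuation f C g T"
    using * sol_path_solution[OF *(3)] sol_pathD(1)[OF *(3)] unfolding periodic_continuation_def
    by (auto intro!: bexI[of _ "(J, c)"])
  moreover have "is_tangent_angle (UNIV, g) \<theta>" using *(3) by (simp add: sol_path_def)
  ultimately show "oriented_counterclockwise f C"
    unfolding oriented_counterclockwise_def using *(6) by (intro exI[of _ g] exI[of _ T] exI[of _ \<theta>]) simp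
  have "curve_trace C homeomorphic sphere (0::complex) 1 \<longleftrightarrow> curve_trace C = sphere 0 a \<or>
    (\<exists>!s. s \<in> O_set f \<and> (\<exists>\<phi>::real. curve_trace C = (\<lambda>w. cis \<phi> * w) ` curve_trace (C_sol f s)))"
    by (rule Jordan_characterization[OF assms(2) C(1) comp C_sol_trace[OF assms(3)]])
      (simp_all add: O_set_def assms(3,4))
  then show "Jordan_solution f C \<longleftrightarrow> curve_trace C = sphere 0 (s_crit f) \<or>
      (\<exists>!s. s \<in> O_set f \<and> (\<exists>\<theta>::real. curve_trace C = (\<lambda>w. cis \<theta> * w) ` curve_trace (C_sol f s)))"
    using C(1) by (simp add: Jordan_solution_def assms(4))
qed

lemma (in attractive_curvature) C_sol_trace_negative:
  assumes "eps (\<lambda>s. - f s) = - 1" "0 < s" "s < a" "rosette f a (ham (of_real s)) \<kappa> \<theta>"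
  shows "\<exists>\<alpha>. cnj ` curve_trace (C_sol (\<lambda>s. - f s) s) =
    (\<lambda>w. cis \<alpha> * w) ` range (pre_rosette.cur f a (ham (of_real s)) \<theta>)"
proof -
  let ?f = "\<lambda>s. - f s"
  interpret rosette f a "ham (of_real s)" \<kappa> \<theta> by (rule assms(4))
  let ?h = "ham (of_real s)"
  \<comment> \<open>The nearest point has argument \<open>turn / 2\<close>. This rotation takes it
    to \<open>- s\<close>, the prescribed starting point when \<open>eps\<close> is -1, and
    conjugation leaves it there.\<close>
  let ?\<beta> = "pi - turn / 2"
  let ?c = "\<lambda>t. cis ?\<beta> * cur (t + per ?h / 2)"
  let ?P = "\<lambda>C. maximal_solution ?f C \<and>
     (\<exists>(J, c)\<in>C. c 0 = of_real (eps ?f * s) \<and> (\<exists>\<psi>. is_tangent_angle (J, c) \<psi> \<and> \<psi> 0 = pi / 2))"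
  note sol = sol_rotated[of ?\<beta> "per ?h / 2"]
  have half: "cur (per ?h / 2) = of_real s * cis (turn / 2)"
  proof -
    have "cur (per ?h / 2) = - \<i> * of_real s * cis (pi / 2 + turn / 2)"
      unfolding cur_def \<theta>_half inner_level(3)[OF assms(2,3)] by simp
    then show ?thesis by (simp add: complex_eq_iff cos_add sin_add)
  qed
  have max: "maximal_solution ?f (reflect (path_equiv `` {(UNIV, ?c)}))"
    by (intro reflect_maximal maximal) (use inner_level(2)[OF assms(2,3)] in simp)
  have mem: "(UNIV, \<lambda>t. cnj (?c t)) \<in> reflect (path_equiv `` {(UNIV, ?c)})"
    using imageI[OF class_of_path(1)[OF sol_pathD(1)[OF sol]], of "\<lambda>(J, c). (J, \<lambda>t. cnj (c t))"]
    by (simp add: reflect_def)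
  \<comment> \<open>After conjugation the tangent angle at 0 is -3\<pi>/2, which a full turn
    corrects to the prescribed \<pi>/2.\<close>
  have sol2: "sol_path ?f UNIV (\<lambda>t. cnj (?c t)) (\<lambda>t. - (\<theta> (t + per ?h / 2) + ?\<beta>) + 2 * pi)"
    using sol_path_rotate[OF cnj_sol_path[OF sol], of "2 * pi"] by simp
  have "?c 0 = of_real s * (cis ?\<beta> * cis (turn / 2))" by (simp add: half)
  also have "\<dots> = - of_real s" by (simp only: cis_mult) simp
  finally have c0: "cnj (?c 0) = of_real (eps ?f * s)" using assms(1) by simp
  have "is_tangent_angle (UNIV, \<lambda>t. cnj (?c t)) (\<lambda>t. - (\<theta> (t + per ?h / 2) + ?\<beta>) + 2 * pi)"
    using sol2 by (simp add: sol_path_def)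
  moreover have "- (\<theta> (0 + per ?h / 2) + ?\<beta>) + 2 * pi = pi / 2" by (simp add: \<theta>_half)
  ultimately have ang: "\<exists>\<psi>. is_tangent_angle (UNIV, \<lambda>t. cnj (?c t)) \<psi> \<and> \<psi> 0 = pi / 2"
    by (intro exI[of _ "\<lambda>t. - (\<theta> (t + per ?h / 2) + ?\<beta>) + 2 * pi"] conjI)
  have "?P (reflect (path_equiv `` {(UNIV, ?c)}))"
  proof (intro conjI max bexI[OF _ mem])
    show "case (UNIV, \<lambda>t. cnj (?c t)) of (J, c) \<Rightarrow> c 0 = of_real (eps ?f * s) \<and>
        (\<exists>\<psi>. is_tangent_angle (J, c) \<psi> \<and> \<psi> 0 = pi / 2)"
      unfolding prod.case by (rule conjI[OF c0 ang])
  qed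
  then have "?P (C_sol ?f s)" unfolding C_sol_def by (rule someI[of ?P])
  then have max': "maximal_solution ?f (C_sol ?f s)" and
      ex: "\<exists>(J, c)\<in>C_sol ?f s. c 0 = of_real (eps ?f * s) \<and> (\<exists>\<psi>. is_tangent_angle (J, c) \<psi> \<and> \<psi> 0 = pi / 2)"
    by (rule conjunct1, rule conjunct2)
  from ex obtain p where p: "p \<in> C_sol ?f s" "case p of (J, c) \<Rightarrow> c 0 = of_real (eps ?f * s) \<and>
      (\<exists>\<psi>. is_tangent_angle (J, c) \<psi> \<and> \<psi> 0 = pi / 2)"
    by (rule bexE)
  obtain J c' where p': "p = (J, c')" by (cases p)
  obtain \<psi> where q: "c' 0 = of_real (eps ?f * s)" "is_tangent_angle (J, c') \<psi>" "\<psi> 0 = pi / 2"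
    using p(2) unfolding p' prod.case by blast
  have "c' 0 = - of_real s" using q(1) assms(1) by simp
  note * = max' p(1)[unfolded p'] this q(2,3)
  have "maximal_solution f (reflect (C_sol ?f s))" using reflect_maximal[OF *(1)] by simp
  moreover have "(J, \<lambda>t. cnj (c' t)) \<in> reflect (C_sol ?f s)"
    using imageI[OF *(2), of "\<lambda>(J, c). (J, \<lambda>t. cnj (c t))"] by (simp add: reflect_def)
  moreover have "is_tangent_angle (J, \<lambda>t. cnj (c' t)) (\<lambda>t. - \<psi> t)"
  proof -
    have arc: "(J, c') \<in> arc_paths"
      using *(1,2) class_eq_of_mem(1) by (auto simp: maximal_solution_def is_solution_def)
    have "smooth_on J \<psi>" using *(4) by (simp add: is_tangent_angle_def)
    then have "smooth_on J (\<lambda>t. - \<psi> t)" by (rule smooth_on_linear[OF _ bounded_linear_minus[OF bounded_linear_ident]])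
    moreover have "vector_derivative (\<lambda>t. cnj (c' t)) (at t) = cis (- \<psi> t)" if "t \<in> J" for t
      using vector_derivative_at[OF has_vector_derivative_cnj[OF tangent_angle_derivative[OF arc *(4) that]]]
      by (simp add: cis_cnj)
    ultimately show ?thesis by (simp add: is_tangent_angle_def)
  qed
  moreover have "- \<i> * cnj (cnj (c' 0)) * cis (- \<psi> 0) = of_real s" by (simp add: *(3,5) complex_eq_iff)
  ultimately show ?thesis
    using trace_of_initial_value[OF assms(2-4), of "reflect (C_sol ?f s)" J "\<lambda>t. cnj (c' t)" "\<lambda>t. - \<psi> t"]
    by (simp add: curve_trace_reflect)
qed

text \<open>Complex conjugation leads back to the positive function. It reverses the tangent
  rotation and the rotation angles, while \<open>O_set\<close> is unaffected because both net
  windings equal \<open>turn / (2 * pi)\<close>.\<close>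

lemma theorem_negative:
  assumes "attractive_curvature f a" "\<And>s. 0 < s \<Longrightarrow> deriv f s \<noteq> 0"
    "eps (\<lambda>s. - f s) = - 1" "s_crit (\<lambda>s. - f s) = a"
    and C: "maximal_solution (\<lambda>s. - f s) C" "closed_curve C"
  shows "oriented_clockwise (\<lambda>s. - f s) C"
    and "Jordan_solution (\<lambda>s. - f s) C \<longleftrightarrow> curve_trace C = sphere 0 (s_crit (\<lambda>s. - f s)) \<or>
      (\<exists>!s. s \<in> O_set (\<lambda>s. - f s) \<and>
        (\<exists>\<theta>::real. curve_trace C = (\<lambda>w. cis \<theta> * w) ` curve_trace (C_sol (\<lambda>s. - f s) s)))"
proof -
  let ?f = "\<lambda>s. - f s"
  let ?C = "reflect C"
  interpret attractive_curvature f a by (rule assms(1))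
  have cc: "cnj ` cnj ` S = S" for S by (simp add: image_image)
  have max: "maximal_solution f ?C" using reflect_maximal[OF C(1)] by simp
  have comp: "compact (curve_trace ?C)"
    using C(2) unfolding closed_curve_def curve_trace_reflect
    by (intro compact_continuous_image continuous_intros)
  obtain J c g T \<theta> where *: "(J, c) \<in> ?C" "\<And>t. t \<in> J \<Longrightarrow> c t = g t" "sol_path f UNIV g \<theta>"
    "minimal_period g T" "range g = curve_trace ?C" "\<theta> 0 < \<theta> T"
    by (rule periodic_solution_exists[OF max comp]) (rule that)
  note s = cnj_sol_path[OF *(3)]
  have "(J, \<lambda>t. cnj (c t)) \<in> reflect ?C"
    using imageI[OF *(1), of "\<lambda>(J, c). (J, \<lambda>t. cnj (c t))"] by (simp add: reflect_def)
  then have mem: "(J, \<lambda>t. cnj (c t)) \<in> C" by (simp add: reflect_reflect)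
  have "range (\<lambda>t. cnj (g t)) = cnj ` range g" by (simp add: image_image)
  also have "\<dots> = curve_trace C" unfolding *(5) by (simp add: curve_trace_reflect cc)
  finally have "periodic_continuation ?f C (\<lambda>t. cnj (g t)) T"
    using sol_path_solution[OF s] sol_pathD(1)[OF s] minimal_period_cnj[OF *(4)] mem *(2)
    unfolding periodic_continuation_def by (auto intro!: bexI[OF _ mem])
  moreover have "is_tangent_angle (UNIV, \<lambda>t. cnj (g t)) (\<lambda>t. - \<theta> t)" using s by (simp add: sol_path_def)
  ultimately show "oriented_clockwise ?f C"
    unfolding oriented_clockwise_def using *(6)
    by (intro exI[of _ "\<lambda>t. cnj (g t)"] exI[of _ T] exI[of _ "\<lambda>t. - \<theta> t"]) simp
  have Oset: "O_set ?f = (\<Union>n\<in>{2::nat..}. {s. 0 < s \<and> s < a \<and> net_winding f (of_real s) = 1 / real n})"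
  proof -
    have nw: "net_winding ?f (of_real (eps ?f * s)) = net_winding f (of_real s)" if s: "0 < s" "s < a" for s
    proof -
      obtain \<kappa> \<theta> where r: "rosette f a (ham (of_real s)) \<kappa> \<theta>" by (rule inner_rosette[OF s])
      show ?thesis using net_winding_eq_turn[OF s r] assms(3) by simp
    qed
    show ?thesis unfolding O_set_def assms(4) using nw by (intro SUP_cong refl) auto
  qed
  have char: "curve_trace ?C homeomorphic sphere (0::complex) 1 \<longleftrightarrow> curve_trace ?C = sphere 0 a \<or>
    (\<exists>!s. s \<in> O_set ?f \<and> (\<exists>\<phi>::real. curve_trace ?C = (\<lambda>w. cis \<phi> * w) ` cnj ` curve_trace (C_sol ?f s)))"
    by (rule Jordan_characterization[OF assms(2) max comp C_sol_trace_negative[OF assms(3)] Oset])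
  have 1: "curve_trace ?C homeomorphic sphere (0::complex) 1 \<longleftrightarrow> curve_trace C homeomorphic sphere (0::complex) 1"
    unfolding curve_trace_reflect
    using cnj_homeomorphic[of "curve_trace C"] homeomorphic_sym homeomorphic_trans by blast
  have inj: "cnj ` A = B \<longleftrightarrow> A = cnj ` B" for A B using cc by metis
  have 2: "curve_trace ?C = sphere 0 a \<longleftrightarrow> curve_trace C = sphere 0 a"
  proof -
    have "cnj ` sphere 0 a = sphere 0 a"
    proof (intro equalityI subsetI)
      fix w assume "w \<in> sphere (0::complex) a"
      then have "w = cnj (cnj w)" "cnj w \<in> sphere 0 a" by auto
      then show "w \<in> cnj ` sphere 0 a" by (rule image_eqI)
    qed auto
    then show ?thesis unfolding curve_trace_reflect inj by simp
  qed
  have 3: "(\<exists>\<phi>::real. curve_trace ?C = (\<lambda>w. cis \<phi> * w) ` cnj ` S) \<longleftrightarrow>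
      (\<exists>\<phi>::real. curve_trace C = (\<lambda>w. cis \<phi> * w) ` S)" for S
  proof -
    have "curve_trace ?C = (\<lambda>w. cis \<phi> * w) ` cnj ` S \<longleftrightarrow> curve_trace C = (\<lambda>w. cis (- \<phi>) * w) ` S" for \<phi>
      unfolding curve_trace_reflect inj by (simp add: image_image cis_cnj)
    then show ?thesis by (metis minus_minus)
  qed
  show "Jordan_solution ?f C \<longleftrightarrow> curve_trace C = sphere 0 (s_crit ?f) \<or>
      (\<exists>!s. s \<in> O_set ?f \<and> (\<exists>\<theta>::real. curve_trace C = (\<lambda>w. cis \<theta> * w) ` curve_trace (C_sol ?f s)))"
    using char C(1) unfolding 1 2 3 by (simp add: Jordan_solution_def assms(4))
qed

theorem theorem4p6:
  fixes f :: "real \<Rightarrow> real" and C :: plane_curve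
  assumes "f \<in> class_F_star"
    and "maximal_solution f C"
    and "closed_curve C"
  shows "((\<forall>s>0. f s > 0) \<longrightarrow> oriented_counterclockwise f C) \<and>
         ((\<forall>s>0. f s < 0) \<longrightarrow> oriented_clockwise f C) \<and>
         (Jordan_solution f C \<longleftrightarrow>
            curve_trace C = sphere 0 (s_crit f) \<or>
            (\<exists>!s. s \<in> O_set f \<and>
               (\<exists>\<theta>::real. curve_trace C = (\<lambda>w. cis \<theta> * w) ` curve_trace (C_sol f s))))"
proof -
  note cl = class_F_star_cases[OF assms(1)]
  then consider "eps f = 1" | "eps f = - 1" by auto
  then show ?thesis
  proof cases
    case 1
    then have g: "attractive_curvature f (s_crit f)" "\<And>s. 0 < s \<Longrightarrow> deriv f s \<noteq> 0" using cl by auto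
    have "0 < f 1" using attractive_curvature.f_pos[OF g(1), of 1] by simp
    \<comment> \<open>The claim about the other orientation is vacuous.\<close>
    then have "\<not> (\<forall>s>0. f s < 0)" by (auto intro!: exI[of _ 1])
    then show ?thesis using theorem_positive[OF g 1 refl assms(2,3)] by blast
  next
    case 2
    let ?g = "\<lambda>s. - f s"
    have g: "attractive_curvature ?g (s_crit f)" "\<And>s. 0 < s \<Longrightarrow> deriv ?g s \<noteq> 0" using cl 2 by auto
    have m: "eps (\<lambda>s. - ?g s) = - 1" "s_crit (\<lambda>s. - ?g s) = s_crit f" "maximal_solution (\<lambda>s. - ?g s) C"
      using 2 assms(2) by simp_all
    have "f 1 < 0" using attractive_curvature.f_pos[OF g(1), of 1] by simp
    then have "\<not> (\<forall>s>0. 0 < f s)" by (auto intro!: exI[of _ 1])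
    then show ?thesis using theorem_negative[OF g m assms(3)] by simp blast
  qed
qed

end
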